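(* The algebra $\mathcal R_{[\alpha]}(\Gamma)^\sigma$ of $\sigma$-fixed points of $\mathcal R_{[\alpha]}(\Gamma)$ has the following presentation. The generating set is $\{e(\gamma)\}_{\gamma\in K^{[\alpha]}_\sigma}\cup\{y_1,\dots,y_n\}\cup\{\psi_1,\dots,\psi_{n-1}\}$ and the relations are (for all $\gamma,\gamma'\in K^{[\alpha]}_\sigma$ and all admissible indices $a,b$): 1. $\sum_{\gamma}e(\gamma)=1$; 2. $e(\gamma)e(\gamma')=\delta_{\gamma,\gamma'}e(\gamma)$; 3. $y_ae(\gamma)=e(\gamma)y_a$; 4. $\psi_ae(\gamma)=e(s_a\cdot\gamma)\psi_a$; 5. $y_ay_b=y_by_a$; 6. $\psi_ay_b=y_b\psi_a$ if $b\ne a,a+1$; 7. $\psi_a\psi_b=\psi_b\psi_a$ if $|a-b|>1$; 8. $\psi_ay_{a+1}e(\gamma)=(y_a\psi_a+1)e(\gamma)$ if $\gamma_a=\gamma_{a+1}$, and $=y_a\psi_ae(\gamma)$ if $\gamma_a\ne\gamma_{a+1}$; 9. $y_{a+1}\psi_ae(\gamma)=(\psi_ay_a+1)e(\gamma)$ if $\gamma_a=\gamma_{a+1}$, and $=\psi_ay_ae(\gamma)$ if $\gamma_a\ne\gamma_{a+1}$; 10. $\psi_a^2e(\gamma)$ equals $0$ if $\gamma_a=\gamma_{a+1}$; $e(\gamma)$ if $\gamma_a\nleftrightarrow\gamma_{a+1}$; $(y_{a+1}-y_a)e(\gamma)$ if $\gamma_a\to\gamma_{a+1}$; $(y_a-y_{a+1})e(\gamma)$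 if $\gamma_a\leftarrow\gamma_{a+1}$; $(y_{a+1}-y_a)(y_a-y_{a+1})e(\gamma)$ if $\gamma_a\leftrightarrows\gamma_{a+1}$; 11. $\psi_{a+1}\psi_a\psi_{a+1}e(\gamma)$ equals $(\psi_a\psi_{a+1}\psi_a-1)e(\gamma)$ if $\gamma_{a+2}=\gamma_a\to\gamma_{a+1}$; $(\psi_a\psi_{a+1}\psi_a+1)e(\gamma)$ if $\gamma_{a+2}=\gamma_a\leftarrow\gamma_{a+1}$; $(\psi_a\psi_{a+1}\psi_a+2y_{a+1}-y_a-y_{a+2})e(\gamma)$ if $\gamma_{a+2}=\gamma_a\leftrightarrows\gamma_{a+1}$; $\psi_a\psi_{a+1}\psi_ae(\gamma)$ otherwise.
   Context: $n,p$ are positive integers and $F$ is a field containing a primitive $p$-th root of unity. $K$ is a set and $\Gamma$ is a loop-free quiver with vertex set $K$ and without multiple directed edges. For $k,k'\in K$: $k\nleftrightarrow k'$ means $k\ne k'$ and neither $(k,k')$ nor $(k',k)$ is an edge; $k\to k'$ means $(k,k')$ is an edge and $(k',k)$ is not; $k\leftarrow k'$ means $k'\to k$; $k\leftrightarrows k'$ means both are edges. A $K$-composition $\alpha$ of $n$ is a finitely supported tuple $(\alpha_k)_{k\in K}$ of non-negative integers with sum $n$; $K^\alpha\subset K^n$ is the (finite) set of tuples with exactly $\alpha_k$ components equal to $k$ for each $k$. $\mathfrak S_n$ acts on $K^n$ by place permutations, $s_a=(a,a+1)$. $\mathcal R_\alpha(\Gamma)$ is the unital associative $F$-algebra generated by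 $e(\boldsymbol k)$ ($\boldsymbol k\in K^\alpha$), $y_1,\dots,y_n$, $\psi_1,\dots,\psi_{n-1}$ with relations: $\sum_{\boldsymbol k}e(\boldsymbol k)=1$; $e(\boldsymbol k)e(\boldsymbol k')=\delta_{\boldsymbol k,\boldsymbol k'}e(\boldsymbol k)$; $y_ae(\boldsymbol k)=e(\boldsymbol k)y_a$; $\psi_ae(\boldsymbol k)=e(s_a\cdot\boldsymbol k)\psi_a$; $y_ay_b=y_by_a$; $\psi_ay_b=y_b\psi_a$ if $b\ne a,a+1$; $\psi_a\psi_b=\psi_b\psi_a$ if $|a-b|>1$; $\psi_ay_{a+1}e(\boldsymbol k)=(y_a\psi_a+\delta_{k_a,k_{a+1}})e(\boldsymbol k)$; $y_{a+1}\psi_ae(\boldsymbol k)=(\psi_ay_a+\delta_{k_a,k_{a+1}})e(\boldsymbol k)$; $\psi_a^2e(\boldsymbol k)=0$, $e(\boldsymbol k)$, $(y_{a+1}-y_a)e(\boldsymbol k)$, $(y_a-y_{a+1})e(\boldsymbol k)$, $(y_{a+1}-y_a)(y_a-y_{a+1})e(\boldsymbol k)$ according as $k_a=k_{a+1}$, $k_a\nleftrightarrow k_{a+1}$, $k_a\to k_{a+1}$, $k_a\leftarrow k_{a+1}$, $k_a\leftrightarrows k_{a+1}$; and $\psi_{a+1}\psi_a\psi_{a+1}e(\boldsymbol k)=(\psi_a\psi_{a+1}\psi_a+c)e(\boldsymbol k)$ with $c=-1$ if $k_{a+2}=k_a\to k_{a+1}$, $c=1$ if $k_{a+2}=k_a\leftarrow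 k_{a+1}$, $c=2y_{a+1}-y_a-y_{a+2}$ if $k_{a+2}=k_a\leftrightarrows k_{a+1}$, $c=0$ otherwise. $\sigma:K\to K$ is a bijection mapping edges of $\Gamma$ to edges of $\Gamma$, such that $\sigma^{p_1}(k)\ne k=\sigma^p(k)$ for all $k\in K$ and $1\le p_1\le p-1$. It acts componentwise on $K^n$, and on $K$-compositions by $(\sigma\cdot\alpha)_k=\alpha_{\sigma^{-1}(k)}$. Fix a $K$-composition $\alpha$ of $n$; $[\alpha]$ is its $\langle\sigma\rangle$-orbit, $K^{[\alpha]}=\bigsqcup_{\beta\in[\alpha]}K^\beta$, $\mathcal R_{[\alpha]}(\Gamma)=\bigoplus_{\beta\in[\alpha]}\mathcal R_\beta(\Gamma)$. The assignment $e(\boldsymbol k)\mapsto e(\sigma(\boldsymbol k))$, $y_a\mapsto y_a$, $\psi_a\mapsto\psi_a$ defines an automorphism $\sigma$ of $\mathcal R_{[\alpha]}(\Gamma)$. $K^{[\alpha]}_\sigma$ is the set of $\langle\sigma\rangle$-orbits on $K^{[\alpha]}$. For $\gamma\in K^{[\alpha]}_\sigma$, $e(\gamma)=\sum_{\boldsymbol k\in\gamma}e(\boldsymbol k)$; $s_a\cdot\gamma$ is the orbit of $s_a\cdot\boldsymbol k$, and $\gamma_a=\gamma_b$, $\gamma_a\to\gamma_b$, $\gamma_a\nleftrightarrow\gamma_b$, etc. are defined through any representative $\boldsymbol k\in\gamma$ (independent of the choice). *)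

theory Defs
  imports "HOL-Algebra.QuotRing" "HOL-Algebra.Module" "HOL-Combinatorics.Transposition"
begin

section \<open>Associative unital algebras given by generators and relations\<close>

text \<open>
  An algebra over the field \<^typ>\<open>'f\<close> is a record of type \<^typ>\<open>('f, 'a) module\<close>, whose fields
  are the ring operations together with the scalar multiplication.  The locale
  \<^locale>\<open>algebra\<close> of the library is about commutative algebras and does not apply here.
\<close>

definition alg_hom :: "('f, 'a, 'm) module_scheme \<Rightarrow> ('f, 'b, 'n) module_scheme \<Rightarrow> ('a \<Rightarrow> 'b) set"
  where "alg_hom A B =
    {h \<in> ring_hom A B. \<forall>c. \<forall>x\<in>carrier A. h (c \<odot>\<^bsub>A\<^esub> x) = c \<odot>\<^bsub>B\<^esub> h x}"

definition alg_iso :: "('f, 'a, 'm) module_scheme \<Rightarrow> ('f, 'b, 'n) module_scheme \<Rightarrow> ('a \<Rightarrow> 'b) set"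
  where "alg_iso A B = {h \<in> alg_hom A B. bij_betw h (carrier A) (carrier B)}"

text \<open>
  The free algebra on \<open>G\<close> has the words over \<open>G\<close> as a basis; an element is the function sending
  a word to its coefficient, and the product is the convolution along all ways of cutting a word
  into a prefix and a suffix.
\<close>

definition free_alg :: "'x set \<Rightarrow> ('f::field, 'x list \<Rightarrow> 'f) module"
  where "free_alg G =
    \<lparr>carrier = {f. finite {w. f w \<noteq> 0} \<and> {w. f w \<noteq> 0} \<subseteq> lists G},
     mult = (\<lambda>f g w. \<Sum>i\<le>length w. f (take i w) * g (drop i w)),
     one = (\<lambda>w. if w = [] then 1 else 0),
     zero = (\<lambda>w. 0),
     add = (\<lambda>f g w. f w + g w),
     smult = (\<lambda>c f w. c * f w)\<rparr>"

definition free_gen :: "'x \<Rightarrow> 'x list \<Rightarrow> 'f::field"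
  where "free_gen x = (\<lambda>w. if w = [x] then 1 else 0)"

definition quot_alg :: "('f, 'a, 'm) module_scheme \<Rightarrow> 'a set \<Rightarrow> ('f, 'a set) module"
  where "quot_alg A I =
    \<lparr>carrier = carrier (A Quot I),
     mult = mult (A Quot I),
     one = one (A Quot I),
     zero = zero (A Quot I),
     add = add (A Quot I),
     smult = (\<lambda>c C. \<Union>x\<in>C. I +>\<^bsub>A\<^esub> (c \<odot>\<^bsub>A\<^esub> x))\<rparr>"

text \<open>
  A pair \<open>(u, v)\<close> stands for the relation \<open>u = v\<close>.  A two-sided ring ideal of a unital algebra is
  automatically stable under scalars.
\<close>

definition rel_ideal :: "'x set \<Rightarrow> (('x list \<Rightarrow> 'f::field) \<times> ('x list \<Rightarrow> 'f)) set \<Rightarrow> ('x list \<Rightarrow> 'f) set"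
  where "rel_ideal G S = Idl\<^bsub>free_alg G\<^esub> {u \<ominus>\<^bsub>free_alg G\<^esub> v | u v. (u, v) \<in> S}"

definition presented_alg ::
    "'x set \<Rightarrow> (('x list \<Rightarrow> 'f::field) \<times> ('x list \<Rightarrow> 'f)) set \<Rightarrow> ('f, ('x list \<Rightarrow> 'f) set) module"
  where "presented_alg G S = quot_alg (free_alg G) (rel_ideal G S)"

definition presented_gen ::
    "'x set \<Rightarrow> (('x list \<Rightarrow> 'f::field) \<times> ('x list \<Rightarrow> 'f)) set \<Rightarrow> 'x \<Rightarrow> ('x list \<Rightarrow> 'f) set"
  where "presented_gen G S x = rel_ideal G S +>\<^bsub>free_alg G\<^esub> free_gen x"

text \<open>
  \<open>A\<close> is presented by the generators \<open>g x\<close>, \<open>x \<in> G\<close>, subject to the relations \<open>S\<close>.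
\<close>

definition has_presentation ::
    "('f::field, 'a) module \<Rightarrow> 'x set \<Rightarrow> ('x \<Rightarrow> 'a) \<Rightarrow> (('x list \<Rightarrow> 'f) \<times> ('x list \<Rightarrow> 'f)) set \<Rightarrow> bool"
  where "has_presentation A G g S \<longleftrightarrow>
    (\<exists>\<phi>\<in>alg_iso (presented_alg G S) A. \<forall>x\<in>G. \<phi> (presented_gen G S x) = g x)"

definition prod_alg :: "'i set \<Rightarrow> ('i \<Rightarrow> ('f, 'a) module) \<Rightarrow> ('f, 'i \<Rightarrow> 'a) module"
  where "prod_alg I A =
    \<lparr>carrier = (\<Pi>\<^sub>E i\<in>I. carrier (A i)),
     mult = (\<lambda>x y. \<lambda>i\<in>I. x i \<otimes>\<^bsub>A i\<^esub> y i),
     one = (\<lambda>i\<in>I. \<one>\<^bsub>A i\<^esub>),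
     zero = (\<lambda>i\<in>I. \<zero>\<^bsub>A i\<^esub>),
     add = (\<lambda>x y. \<lambda>i\<in>I. x i \<oplus>\<^bsub>A i\<^esub> y i),
     smult = (\<lambda>c x. \<lambda>i\<in>I. c \<odot>\<^bsub>A i\<^esub> x i)\<rparr>"

definition fixed_alg :: "('f, 'a) module \<Rightarrow> ('a \<Rightarrow> 'a) \<Rightarrow> ('f, 'a) module"
  where "fixed_alg A \<tau> = A\<lparr>carrier := {x \<in> carrier A. \<tau> x = x}\<rparr>"

definition primitive_root_of_unity :: "nat \<Rightarrow> 'f::field \<Rightarrow> bool"
  where "primitive_root_of_unity p \<zeta> \<longleftrightarrow> \<zeta> ^ p = 1 \<and> (\<forall>m. 0 < m \<and> m < p \<longrightarrow> \<zeta> ^ m \<noteq> 1)"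


section \<open>Quivers, tuples and compositions\<close>

text \<open>
  The vertex set of the quiver is the type \<^typ>\<open>'k\<close>; the quiver is its set of edges.
\<close>

definition q_none :: "'k rel \<Rightarrow> 'k \<Rightarrow> 'k \<Rightarrow> bool"
  where "q_none \<Gamma> k k' \<longleftrightarrow> k \<noteq> k' \<and> (k, k') \<notin> \<Gamma> \<and> (k', k) \<notin> \<Gamma>"

definition q_to :: "'k rel \<Rightarrow> 'k \<Rightarrow> 'k \<Rightarrow> bool"
  where "q_to \<Gamma> k k' \<longleftrightarrow> (k, k') \<in> \<Gamma> \<and> (k', k) \<notin> \<Gamma>"

definition q_both :: "'k rel \<Rightarrow> 'k \<Rightarrow> 'k \<Rightarrow> bool"
  where "q_both \<Gamma> k k' \<longleftrightarrow> (k, k') \<in> \<Gamma> \<and> (k', k) \<in> \<Gamma>"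

definition composition :: "nat \<Rightarrow> ('k \<Rightarrow> nat) \<Rightarrow> bool"
  where "composition n \<alpha> \<longleftrightarrow> finite {k. \<alpha> k \<noteq> 0} \<and> (\<Sum>k | \<alpha> k \<noteq> 0. \<alpha> k) = n"

text \<open>
  An \<open>n\<close>-tuple is a function on \<open>{1..n}\<close> (extended by \<^const>\<open>undefined\<close>).
\<close>

definition tuples :: "nat \<Rightarrow> ('k \<Rightarrow> nat) \<Rightarrow> (nat \<Rightarrow> 'k) set"
  where "tuples n \<alpha> = {k \<in> {1..n} \<rightarrow>\<^sub>E UNIV. \<forall>x. card {a \<in> {1..n}. k a = x} = \<alpha> x}"

definition swap_at :: "nat \<Rightarrow> (nat \<Rightarrow> 'k) \<Rightarrow> nat \<Rightarrow> 'k"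
  where "swap_at a k = k \<circ> transpose a (a + 1)"

definition tuple_map :: "nat \<Rightarrow> ('k \<Rightarrow> 'k) \<Rightarrow> (nat \<Rightarrow> 'k) \<Rightarrow> nat \<Rightarrow> 'k"
  where "tuple_map n \<sigma> k = (\<lambda>a\<in>{1..n}. \<sigma> (k a))"

text \<open>
  Orbit of the cyclic group generated by a permutation \<open>f\<close> of finite order, for which the
  non-negative powers suffice.
\<close>

definition cyc_orbit :: "('a \<Rightarrow> 'a) \<Rightarrow> 'a \<Rightarrow> 'a set"
  where "cyc_orbit f x = range (\<lambda>j. (f ^^ j) x)"

definition comp_orbit :: "('k \<Rightarrow> 'k) \<Rightarrow> ('k \<Rightarrow> nat) \<Rightarrow> ('k \<Rightarrow> nat) set"
  where "comp_orbit \<sigma> \<alpha> = cyc_orbit (\<lambda>\<beta>. \<beta> \<circ> inv_into UNIV \<sigma>) \<alpha>"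

definition orbit_tuples :: "nat \<Rightarrow> ('k \<Rightarrow> 'k) \<Rightarrow> ('k \<Rightarrow> nat) \<Rightarrow> (nat \<Rightarrow> 'k) set"
  where "orbit_tuples n \<sigma> \<alpha> = (\<Union>\<beta>\<in>comp_orbit \<sigma> \<alpha>. tuples n \<beta>)"

definition tuple_orbits :: "nat \<Rightarrow> ('k \<Rightarrow> 'k) \<Rightarrow> ('k \<Rightarrow> nat) \<Rightarrow> (nat \<Rightarrow> 'k) set set"
  where "tuple_orbits n \<sigma> \<alpha> = cyc_orbit (tuple_map n \<sigma>) ` orbit_tuples n \<sigma> \<alpha>"

text \<open>
  Notions for an orbit \<open>\<gamma>\<close> such as \<open>\<gamma>\<^sub>a = \<gamma>\<^sub>b\<close> or \<open>\<gamma>\<^sub>a \<rightarrow> \<gamma>\<^sub>b\<close> are those of a representative;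
  they do not depend on its choice.
\<close>

definition orbit_rep :: "'a set \<Rightarrow> 'a"
  where "orbit_rep \<gamma> = (SOME k. k \<in> \<gamma>)"

definition orbit_swap :: "nat \<Rightarrow> ('k \<Rightarrow> 'k) \<Rightarrow> nat \<Rightarrow> (nat \<Rightarrow> 'k) set \<Rightarrow> (nat \<Rightarrow> 'k) set"
  where "orbit_swap n \<sigma> a \<gamma> = cyc_orbit (tuple_map n \<sigma>) (swap_at a (orbit_rep \<gamma>))"


section \<open>Quiver Hecke algebras\<close>

datatype 'i klr_gen = E_gen 'i | Y_gen nat | Psi_gen nat

definition klr_gens :: "nat \<Rightarrow> 'i set \<Rightarrow> 'i klr_gen set"
  where "klr_gens n I = E_gen ` I \<union> Y_gen ` {1..n} \<union> Psi_gen ` {1..<n}"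

text \<open>
  The relations, between elements \<open>e i\<close>, \<open>y a\<close>, \<open>\<psi> a\<close> of an algebra \<open>A\<close>.  They are needed with
  idempotents indexed by tuples and with idempotents indexed by orbits of tuples, so they are stated
  for any finite index set \<open>I\<close> together with maps \<open>rep\<close>, giving the tuple of vertices through which
  the case distinctions at \<open>i \<in> I\<close> are made, and \<open>act a\<close>, giving the action of the simple
  transposition \<open>s\<^sub>a\<close> on \<open>I\<close>.  For a loop-free quiver the five cases for \<open>\<psi>\<^sub>a\<^sup>2\<close> are mutually
  exclusive, the last one being \<^const>\<open>q_both\<close>.
\<close>

definition klr_relations ::
    "('f::field, 'a) module \<Rightarrow> 'k rel \<Rightarrow> nat \<Rightarrow> 'i set \<Rightarrow> ('i \<Rightarrow> nat \<Rightarrow> 'k) \<Rightarrow> (nat \<Rightarrow> 'i \<Rightarrow> 'i) \<Rightarrow>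
      ('i \<Rightarrow> 'a) \<Rightarrow> (nat \<Rightarrow> 'a) \<Rightarrow> (nat \<Rightarrow> 'a) \<Rightarrow> ('a \<times> 'a) set"
  where "klr_relations A \<Gamma> n I rep act e y \<psi> =
    {(\<Oplus>i\<in>I. e i, \<one>)}
  \<union> {(e i \<otimes> e j, if i = j then e i else \<zero>) | i j. i \<in> I \<and> j \<in> I}
  \<union> {(y a \<otimes> e i, e i \<otimes> y a) | a i. a \<in> {1..n} \<and> i \<in> I}
  \<union> {(\<psi> a \<otimes> e i, e (act a i) \<otimes> \<psi> a) | a i. a \<in> {1..<n} \<and> i \<in> I}
  \<union> {(y a \<otimes> y b, y b \<otimes> y a) | a b. a \<in> {1..n} \<and> b \<in> {1..n}}
  \<union> {(\<psi> a \<otimes> y b, y b \<otimes> \<psi> a) | a b. a \<in> {1..<n} \<and> b \<in> {1..n} \<and> b \<noteq> a \<and> b \<noteq> a + 1}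
  \<union> {(\<psi> a \<otimes> \<psi> b, \<psi> b \<otimes> \<psi> a) | a b. a \<in> {1..<n} \<and> b \<in> {1..<n} \<and> \<bar>int a - int b\<bar> > 1}
  \<union> {(\<psi> a \<otimes> y (a + 1) \<otimes> e i,
      (if rep i a = rep i (a + 1) then y a \<otimes> \<psi> a \<oplus> \<one> else y a \<otimes> \<psi> a) \<otimes> e i)
      | a i. a \<in> {1..<n} \<and> i \<in> I}
  \<union> {(y (a + 1) \<otimes> \<psi> a \<otimes> e i,
      (if rep i a = rep i (a + 1) then \<psi> a \<otimes> y a \<oplus> \<one> else \<psi> a \<otimes> y a) \<otimes> e i)
      | a i. a \<in> {1..<n} \<and> i \<in> I}
  \<union> {(\<psi> a \<otimes> \<psi> a \<otimes> e i,
      if rep i a = rep i (a + 1) then \<zero>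
      else if q_none \<Gamma> (rep i a) (rep i (a + 1)) then e i
      else if q_to \<Gamma> (rep i a) (rep i (a + 1)) then (y (a + 1) \<ominus> y a) \<otimes> e i
      else if q_to \<Gamma> (rep i (a + 1)) (rep i a) then (y a \<ominus> y (a + 1)) \<otimes> e i
      else (y (a + 1) \<ominus> y a) \<otimes> (y a \<ominus> y (a + 1)) \<otimes> e i)
      | a i. a \<in> {1..<n} \<and> i \<in> I}
  \<union> {(\<psi> (a + 1) \<otimes> \<psi> a \<otimes> \<psi> (a + 1) \<otimes> e i,
      (if rep i (a + 2) = rep i a \<and> q_to \<Gamma> (rep i a) (rep i (a + 1))
         then \<psi> a \<otimes> \<psi> (a + 1) \<otimes> \<psi> a \<ominus> \<one>
       else if rep i (a + 2) = rep i a \<and> q_to \<Gamma> (rep i (a + 1)) (rep i a)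
         then \<psi> a \<otimes> \<psi> (a + 1) \<otimes> \<psi> a \<oplus> \<one>
       else if rep i (a + 2) = rep i a \<and> q_both \<Gamma> (rep i a) (rep i (a + 1))
         then \<psi> a \<otimes> \<psi> (a + 1) \<otimes> \<psi> a \<oplus> (2 \<odot> y (a + 1) \<ominus> y a \<ominus> y (a + 2))
       else \<psi> a \<otimes> \<psi> (a + 1) \<otimes> \<psi> a) \<otimes> e i)
      | a i. 1 \<le> a \<and> a + 2 \<le> n \<and> i \<in> I}"
  for A (structure)

definition klr_free_relations ::
    "'k rel \<Rightarrow> nat \<Rightarrow> 'i set \<Rightarrow> ('i \<Rightarrow> nat \<Rightarrow> 'k) \<Rightarrow> (nat \<Rightarrow> 'i \<Rightarrow> 'i) \<Rightarrow>
      (('i klr_gen list \<Rightarrow> 'f::field) \<times> ('i klr_gen list \<Rightarrow> 'f)) set"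
  where "klr_free_relations \<Gamma> n I rep act =
    klr_relations (free_alg (klr_gens n I)) \<Gamma> n I rep act
      (\<lambda>i. free_gen (E_gen i)) (\<lambda>a. free_gen (Y_gen a)) (\<lambda>a. free_gen (Psi_gen a))"

type_synonym ('f, 'k) klr_elem = "((nat \<Rightarrow> 'k) klr_gen list \<Rightarrow> 'f) set"

definition klr_alg :: "'k rel \<Rightarrow> nat \<Rightarrow> ('k \<Rightarrow> nat) \<Rightarrow> ('f::field, ('f, 'k) klr_elem) module"
  where "klr_alg \<Gamma> n \<beta> =
    presented_alg (klr_gens n (tuples n \<beta>)) (klr_free_relations \<Gamma> n (tuples n \<beta>) (\<lambda>k. k) swap_at)"

definition klr_alg_gen ::
    "'k rel \<Rightarrow> nat \<Rightarrow> ('k \<Rightarrow> nat) \<Rightarrow> (nat \<Rightarrow> 'k) klr_gen \<Rightarrow> ('f::field, 'k) klr_elem"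
  where "klr_alg_gen \<Gamma> n \<beta> =
    presented_gen (klr_gens n (tuples n \<beta>)) (klr_free_relations \<Gamma> n (tuples n \<beta>) (\<lambda>k. k) swap_at)"

type_synonym ('f, 'k) orbit_klr_elem = "('k \<Rightarrow> nat) \<Rightarrow> ('f, 'k) klr_elem"

text \<open>The orbit of a composition is finite, so the direct sum of algebras is their product.\<close>

definition orbit_klr_alg ::
    "'k rel \<Rightarrow> nat \<Rightarrow> ('k \<Rightarrow> 'k) \<Rightarrow> ('k \<Rightarrow> nat) \<Rightarrow> ('f::field, ('f, 'k) orbit_klr_elem) module"
  where "orbit_klr_alg \<Gamma> n \<sigma> \<alpha> = prod_alg (comp_orbit \<sigma> \<alpha>) (klr_alg \<Gamma> n)"

definition klr_e ::
    "'k rel \<Rightarrow> nat \<Rightarrow> ('k \<Rightarrow> 'k) \<Rightarrow> ('k \<Rightarrow> nat) \<Rightarrow> (nat \<Rightarrow> 'k) \<Rightarrow> ('f::field, 'k) orbit_klr_elem"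
  where "klr_e \<Gamma> n \<sigma> \<alpha> k = (\<lambda>\<beta>\<in>comp_orbit \<sigma> \<alpha>.
    if k \<in> tuples n \<beta> then klr_alg_gen \<Gamma> n \<beta> (E_gen k) else \<zero>\<^bsub>klr_alg \<Gamma> n \<beta>\<^esub>)"

definition klr_y ::
    "'k rel \<Rightarrow> nat \<Rightarrow> ('k \<Rightarrow> 'k) \<Rightarrow> ('k \<Rightarrow> nat) \<Rightarrow> nat \<Rightarrow> ('f::field, 'k) orbit_klr_elem"
  where "klr_y \<Gamma> n \<sigma> \<alpha> a = (\<lambda>\<beta>\<in>comp_orbit \<sigma> \<alpha>. klr_alg_gen \<Gamma> n \<beta> (Y_gen a))"

definition klr_psi ::
    "'k rel \<Rightarrow> nat \<Rightarrow> ('k \<Rightarrow> 'k) \<Rightarrow> ('k \<Rightarrow> nat) \<Rightarrow> nat \<Rightarrow> ('f::field, 'k) orbit_klr_elem"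
  where "klr_psi \<Gamma> n \<sigma> \<alpha> a = (\<lambda>\<beta>\<in>comp_orbit \<sigma> \<alpha>. klr_alg_gen \<Gamma> n \<beta> (Psi_gen a))"

text \<open>
  The automorphism of \<^const>\<open>orbit_klr_alg\<close> induced by \<open>\<sigma>\<close>.  Membership in \<^const>\<open>extensional\<close>
  only normalises its values outside the algebra, which makes it unique.
\<close>

definition is_klr_sigma ::
    "'k rel \<Rightarrow> nat \<Rightarrow> ('k \<Rightarrow> 'k) \<Rightarrow> ('k \<Rightarrow> nat) \<Rightarrow>
      (('f::field, 'k) orbit_klr_elem \<Rightarrow> ('f, 'k) orbit_klr_elem) \<Rightarrow> bool"
  where "is_klr_sigma \<Gamma> n \<sigma> \<alpha> \<tau> \<longleftrightarrow>
    \<tau> \<in> alg_iso (orbit_klr_alg \<Gamma> n \<sigma> \<alpha>) (orbit_klr_alg \<Gamma> n \<sigma> \<alpha>) \<and>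
    \<tau> \<in> extensional (carrier (orbit_klr_alg \<Gamma> n \<sigma> \<alpha>)) \<and>
    (\<forall>k\<in>orbit_tuples n \<sigma> \<alpha>. \<tau> (klr_e \<Gamma> n \<sigma> \<alpha> k) = klr_e \<Gamma> n \<sigma> \<alpha> (tuple_map n \<sigma> k)) \<and>
    (\<forall>a\<in>{1..n}. \<tau> (klr_y \<Gamma> n \<sigma> \<alpha> a) = klr_y \<Gamma> n \<sigma> \<alpha> a) \<and>
    (\<forall>a\<in>{1..<n}. \<tau> (klr_psi \<Gamma> n \<sigma> \<alpha> a) = klr_psi \<Gamma> n \<sigma> \<alpha> a)"

definition klr_sigma ::
    "'k rel \<Rightarrow> nat \<Rightarrow> ('k \<Rightarrow> 'k) \<Rightarrow> ('k \<Rightarrow> nat) \<Rightarrow>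
      ('f::field, 'k) orbit_klr_elem \<Rightarrow> ('f, 'k) orbit_klr_elem"
  where "klr_sigma \<Gamma> n \<sigma> \<alpha> = (THE \<tau>. is_klr_sigma \<Gamma> n \<sigma> \<alpha> \<tau>)"

definition klr_fixed_alg ::
    "'k rel \<Rightarrow> nat \<Rightarrow> ('k \<Rightarrow> 'k) \<Rightarrow> ('k \<Rightarrow> nat) \<Rightarrow> ('f::field, ('f, 'k) orbit_klr_elem) module"
  where "klr_fixed_alg \<Gamma> n \<sigma> \<alpha> = fixed_alg (orbit_klr_alg \<Gamma> n \<sigma> \<alpha>) (klr_sigma \<Gamma> n \<sigma> \<alpha>)"

fun klr_fixed_gen ::
    "'k rel \<Rightarrow> nat \<Rightarrow> ('k \<Rightarrow> 'k) \<Rightarrow> ('k \<Rightarrow> nat) \<Rightarrow> (nat \<Rightarrow> 'k) set klr_gen \<Rightarrow>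
      ('f::field, 'k) orbit_klr_elem"
  where
    "klr_fixed_gen \<Gamma> n \<sigma> \<alpha> (E_gen \<gamma>) = (\<Oplus>\<^bsub>orbit_klr_alg \<Gamma> n \<sigma> \<alpha>\<^esub> k\<in>\<gamma>. klr_e \<Gamma> n \<sigma> \<alpha> k)"
  | "klr_fixed_gen \<Gamma> n \<sigma> \<alpha> (Y_gen a) = klr_y \<Gamma> n \<sigma> \<alpha> a"
  | "klr_fixed_gen \<Gamma> n \<sigma> \<alpha> (Psi_gen a) = klr_psi \<Gamma> n \<sigma> \<alpha> a"

end

theory Submission
  imports Defs
begin

text \<open>
  Let \<open>A\<close> be the algebra presented by the relations indexed by the orbits. Sending \<open>e(\<gamma>)\<close> to the sum
  of the \<open>e(k)\<close>, \<open>k \<in> \<gamma>\<close>, defines a homomorphism \<open>\<phi>\<close> from \<open>A\<close> to the fixed points, because every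
  relation multiplying \<open>e(k)\<close> has coefficients that depend only on the orbit of \<open>k\<close>.

  Surjectivity: any \<open>x\<close> satisfies \<open>x e(k) = b e(k)\<close> with \<open>b\<close> in the subalgebra generated by the \<open>y\<^sub>a\<close> and
  \<open>\<psi>\<^sub>a\<close>. If \<open>x\<close> is fixed, applying the powers of \<open>\<sigma>\<close> and summing over the orbit \<open>\<gamma>\<close> of \<open>k\<close> gives
  \<open>x e(\<gamma>) = b e(\<gamma>)\<close>, and \<open>x\<close> is the sum of the \<open>x e(\<gamma>)\<close>.

  Injectivity: no basis theorem is needed. The quiver Hecke algebra acts on the families
  \<open>(v\<^sub>k)\<close> with \<open>v\<^sub>k \<in> e([k]) A\<close>, where \<open>e(k)\<close> projects to the component \<open>k\<close>, \<open>y\<^sub>a\<close> acts componentwise and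
  \<open>\<psi>\<^sub>a v\<close> has the component \<open>\<psi>\<^sub>a v(s\<^sub>a k)\<close> at \<open>k\<close>. Taking the sum of the components intertwines the resulting action of \<open>A\<close>
  with left multiplication, so an element of the kernel of \<open>\<phi>\<close> annihilates every \<open>e(\<gamma>)\<close>.
\<close>

section \<open>Unital algebras\<close>

text \<open>An algebra with a complete family of orthogonal idempotents is a linear category whose
  objects are the indices of the idempotents. In these terms the orbit map is a functor from the
  category of a quiver Hecke algebra to that of the orbit presentation. It exists because both sides
  of a relation at k lead from k to one and the same tuple: the correction terms 1, -1 or 2y-y-y
  lead from k to k, and they occur only where the place permutation of the main terms fixes k. The
  families \<open>(v k)\<close> form the left regular module restricted along this functor, which is
  why their entries lie in the target algebra and no knowledge of its size is required. All that
  enters is a map q of index sets that commutes with the place permutations and preserves and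
  reflects equality and edges between entries (\<open>klr_cover\<close>). It is used twice: for the
  orbit map on the tuples of one composition, and for the inverse of \<sigma> acting on tuples,
  where it produces the automorphism. The direct sum is handled through its summands, since one
  orbit of tuples is spread over all of them.\<close>

locale lin_space = abelian_group V for V :: "('f::field, 'a, 'm) module_scheme" (structure) +
  assumes smult_closed [simp, intro]: "x \<in> carrier V \<Longrightarrow> c \<odot> x \<in> carrier V"
    and smult_l_distr: "x \<in> carrier V \<Longrightarrow> (c + d) \<odot> x = c \<odot> x \<oplus> d \<odot> x"
    and smult_r_distr: "x \<in> carrier V \<Longrightarrow> y \<in> carrier V \<Longrightarrow> c \<odot> (x \<oplus> y) = c \<odot> x \<oplus> c \<odot> y"
    and smult_assoc: "x \<in> carrier V \<Longrightarrow> (c * d) \<odot> x = c \<odot> (d \<odot> x)"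
    and smult_one [simp]: "x \<in> carrier V \<Longrightarrow> 1 \<odot> x = x"
begin

lemma smult_zero_left [simp]: "x \<in> carrier V \<Longrightarrow> 0 \<odot> x = \<zero>"
  using smult_l_distr[of x 0 0] by (metis add.r_cancel_one' add_0 smult_closed)

lemma smult_zero_right [simp]: "c \<odot> \<zero> = \<zero>"
  using smult_r_distr[of \<zero> \<zero> c] by (metis add.l_cancel_one' l_zero smult_closed zero_closed)

text \<open>Turns negation into scaling, so that a map compatible with sums and scalars is
  compatible with differences.\<close>

lemma smult_uminus_one: "x \<in> carrier V \<Longrightarrow> (- 1) \<odot> x = \<ominus> x"
  using smult_l_distr[of x "- 1" 1] by (simp add: minus_equality)

lemma minus_eq_zero_iff: "x \<in> carrier V \<Longrightarrow> y \<in> carrier V \<Longrightarrow> x \<ominus> y = \<zero> \<longleftrightarrow> x = y"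
  by (metis a_minus_def add.inv_closed add.inv_inv minus_equality r_neg)

lemma smult_finsum:
  assumes "finite I" "f \<in> I \<rightarrow> carrier V"
  shows "c \<odot> finsum V f I = finsum V (\<lambda>i. c \<odot> f i) I"
  using assms by (induction I) (auto simp: smult_r_distr finsum_insert Pi_def finsum_closed)

end

text \<open>The two compatibility laws together say that scalars act through central
  elements.\<close>

locale unital_algebra = ring A + lin_space A for A :: "('f::field, 'a, 'm) module_scheme" (structure) +
  assumes smult_mult_left: "x \<in> carrier A \<Longrightarrow> y \<in> carrier A \<Longrightarrow> c \<odot> (x \<otimes> y) = (c \<odot> x) \<otimes> y"
    and smult_mult_right: "x \<in> carrier A \<Longrightarrow> y \<in> carrier A \<Longrightarrow> c \<odot> (x \<otimes> y) = x \<otimes> (c \<odot> y)"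

section \<open>Homomorphisms of unital algebras\<close>

lemma alg_hom_closed: "h \<in> alg_hom A B \<Longrightarrow> x \<in> carrier A \<Longrightarrow> h x \<in> carrier B"
  by (auto simp: alg_hom_def ring_hom_closed)

lemma alg_hom_add:
  "h \<in> alg_hom A B \<Longrightarrow> x \<in> carrier A \<Longrightarrow> y \<in> carrier A \<Longrightarrow> h (x \<oplus>\<^bsub>A\<^esub> y) = h x \<oplus>\<^bsub>B\<^esub> h y"
  by (auto simp: alg_hom_def ring_hom_add)

lemma alg_hom_mult:
  "h \<in> alg_hom A B \<Longrightarrow> x \<in> carrier A \<Longrightarrow> y \<in> carrier A \<Longrightarrow> h (x \<otimes>\<^bsub>A\<^esub> y) = h x \<otimes>\<^bsub>B\<^esub> h y"
  by (auto simp: alg_hom_def ring_hom_mult)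

lemma alg_hom_one: "h \<in> alg_hom A B \<Longrightarrow> h \<one>\<^bsub>A\<^esub> = \<one>\<^bsub>B\<^esub>"
  by (auto simp: alg_hom_def ring_hom_one)

lemma alg_hom_smult: "h \<in> alg_hom A B \<Longrightarrow> x \<in> carrier A \<Longrightarrow> h (c \<odot>\<^bsub>A\<^esub> x) = c \<odot>\<^bsub>B\<^esub> h x"
  by (auto simp: alg_hom_def)

lemma alg_homI:
  assumes "\<And>x. x \<in> carrier A \<Longrightarrow> h x \<in> carrier B"
    and "\<And>x y. x \<in> carrier A \<Longrightarrow> y \<in> carrier A \<Longrightarrow> h (x \<oplus>\<^bsub>A\<^esub> y) = h x \<oplus>\<^bsub>B\<^esub> h y"
    and "\<And>x y. x \<in> carrier A \<Longrightarrow> y \<in> carrier A \<Longrightarrow> h (x \<otimes>\<^bsub>A\<^esub> y) = h x \<otimes>\<^bsub>B\<^esub> h y"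
    and "h \<one>\<^bsub>A\<^esub> = \<one>\<^bsub>B\<^esub>"
    and "\<And>c x. x \<in> carrier A \<Longrightarrow> h (c \<odot>\<^bsub>A\<^esub> x) = c \<odot>\<^bsub>B\<^esub> h x"
  shows "h \<in> alg_hom A B"
  using assms by (auto simp: alg_hom_def intro!: ring_hom_memI)

lemma alg_hom_zero:
  assumes "h \<in> alg_hom A B" "unital_algebra A" "unital_algebra B"
  shows "h \<zero>\<^bsub>A\<^esub> = \<zero>\<^bsub>B\<^esub>"
proof -
  interpret A: unital_algebra A by fact
  interpret B: unital_algebra B by fact
  show ?thesis
    using alg_hom_smult[OF assms(1), of "\<zero>\<^bsub>A\<^esub>" 0] alg_hom_closed[OF assms(1)] by simp
qed

lemma alg_hom_minus:
  assumes h: "h \<in> alg_hom A B" and "unital_algebra A" "unital_algebra B"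
    and "x \<in> carrier A" "y \<in> carrier A"
  shows "h (x \<ominus>\<^bsub>A\<^esub> y) = h x \<ominus>\<^bsub>B\<^esub> h y"
proof -
  interpret A: unital_algebra A by fact
  interpret B: unital_algebra B by fact
  have "h (\<ominus>\<^bsub>A\<^esub> y) = \<ominus>\<^bsub>B\<^esub> h y"
    using assms alg_hom_smult[OF h, of y "- 1"] alg_hom_closed[OF h]
    by (simp add: A.smult_uminus_one B.smult_uminus_one)
  then show ?thesis
    using assms by (simp add: a_minus_def alg_hom_add)
qed

lemma alg_hom_finsum:
  assumes h: "h \<in> alg_hom A B" and A: "unital_algebra A" and B: "unital_algebra B"
    and "finite I" "f \<in> I \<rightarrow> carrier A"
  shows "h (finsum A f I) = finsum B (\<lambda>i. h (f i)) I"
proof -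
  interpret A: unital_algebra A by fact
  interpret B: unital_algebra B by fact
  show ?thesis
    using assms(4,5)
  proof (induction I)
    case empty
    then show ?case using alg_hom_zero[OF h A B] by simp
  next
    case (insert x F)
    then have "f \<in> F \<rightarrow> carrier A" "f x \<in> carrier A" "(\<lambda>i. h (f i)) \<in> F \<rightarrow> carrier B"
        "h (f x) \<in> carrier B"
      using alg_hom_closed[OF h] by auto
    then show ?case
      using insert by (simp add: A.finsum_insert B.finsum_insert alg_hom_add[OF h])
  qed
qed

lemma alg_hom_comp: "h \<in> alg_hom A B \<Longrightarrow> g \<in> alg_hom B C \<Longrightarrow> (\<lambda>x. g (h x)) \<in> alg_hom A C"
  by (rule alg_homI)
    (simp_all add: alg_hom_closed alg_hom_add alg_hom_mult alg_hom_one alg_hom_smult)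

lemma alg_hom_inj_on:
  assumes h: "h \<in> alg_hom A B" and A: "unital_algebra A" and B: "unital_algebra B"
    and ker: "\<And>x. x \<in> carrier A \<Longrightarrow> h x = \<zero>\<^bsub>B\<^esub> \<Longrightarrow> x = \<zero>\<^bsub>A\<^esub>"
  shows "inj_on h (carrier A)"
proof (rule inj_onI)
  interpret A: unital_algebra A by fact
  interpret B: unital_algebra B by fact
  fix x y assume xy: "x \<in> carrier A" "y \<in> carrier A" "h x = h y"
  then have "h (x \<ominus>\<^bsub>A\<^esub> y) = \<zero>\<^bsub>B\<^esub>"
    using alg_hom_minus[OF h A B] alg_hom_closed[OF h] by (simp add: B.r_neg a_minus_def)
  then have "x \<ominus>\<^bsub>A\<^esub> y = \<zero>\<^bsub>A\<^esub>"
    using ker xy by simp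
  then show "x = y"
    using xy by (simp add: A.minus_eq_zero_iff)
qed

section \<open>Free algebras\<close>

definition conv :: "('x list \<Rightarrow> 'f::field) \<Rightarrow> ('x list \<Rightarrow> 'f) \<Rightarrow> 'x list \<Rightarrow> 'f"
  where "conv f g w = (\<Sum>i\<le>length w. f (take i w) * g (drop i w))"

lemma conv_Nil [simp]: "conv f g [] = f [] * g []"
  by (simp add: conv_def)

text \<open>The cut with empty prefix is split off; the remaining cuts of \<open>x # w\<close> are
  the cuts of \<open>w\<close> for the shifted function. This recursion takes the place of
  manipulations of double sums.\<close>

lemma conv_Cons [simp]: "conv f g (x # w) = f [] * g (x # w) + conv (\<lambda>u. f (x # u)) g w"
  by (simp add: conv_def sum.atMost_Suc_shift del: sum.atMost_Suc)

lemma conv_add_left: "conv (\<lambda>w. f w + g w) h w = conv f h w + conv g h w"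
  by (simp add: conv_def sum.distrib algebra_simps)

lemma conv_add_right: "conv h (\<lambda>w. f w + g w) w = conv h f w + conv h g w"
  by (simp add: conv_def sum.distrib algebra_simps)

lemma conv_smult_left: "conv (\<lambda>w. c * f w) h w = c * conv f h w"
  by (simp add: conv_def sum_distrib_left algebra_simps)

lemma conv_smult_right: "conv f (\<lambda>w. c * h w) w = c * conv f h w"
  by (simp add: conv_def sum_distrib_left algebra_simps)

lemma conv_zero_left [simp]: "conv (\<lambda>w. 0) h w = 0"
  by (simp add: conv_def)

text \<open>The recursion shifts the left factor, so \<open>f\<close> has to vary in the induction;
  bilinearity then separates the contribution of the empty prefix.\<close>

lemma conv_assoc: "conv (conv f g) h w = conv f (conv g h) w"
proof (induction w arbitrary: f)
  case (Cons x w)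
  then show ?case
    by (simp add: conv_add_left conv_smult_left algebra_simps)
qed simp

lemma conv_one_left: "conv (\<lambda>w. if w = [] then 1 else 0) f w = f w"
  by (cases w) simp_all

lemma conv_one_right: "conv f (\<lambda>w. if w = [] then 1 else 0) w = f w"
  by (induction w arbitrary: f) simp_all

lemma conv_support:
  "{w. conv f g w \<noteq> 0} \<subseteq> (\<lambda>(u, v). u @ v) ` ({w. f w \<noteq> 0} \<times> {w. g w \<noteq> 0})"
proof
  fix w assume "w \<in> {w. conv f g w \<noteq> 0}"
  then obtain i where i: "f (take i w) * g (drop i w) \<noteq> 0"
    unfolding conv_def by (auto elim: sum.not_neutral_contains_not_neutral)
  then show "w \<in> (\<lambda>(u, v). u @ v) ` ({w. f w \<noteq> 0} \<times> {w. g w \<noteq> 0})"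
    by (intro image_eqI[of _ _ "(take i w, drop i w)"]) auto
qed

lemma free_alg_simps [simp]:
  "mult (free_alg G) = conv"
  "one (free_alg G) = (\<lambda>w. if w = [] then 1 else 0)"
  "zero (free_alg G) = (\<lambda>w. 0)"
  "add (free_alg G) = (\<lambda>f g w. f w + g w)"
  "smult (free_alg G) = (\<lambda>c f w. c * f w)"
  by (simp_all add: free_alg_def conv_def [abs_def])

lemma free_alg_carrier:
  "f \<in> carrier (free_alg G) \<longleftrightarrow> finite {w. f w \<noteq> 0} \<and> {w. f w \<noteq> 0} \<subseteq> lists G"
  by (simp add: free_alg_def)

lemma free_gen_carrier [intro]: "x \<in> G \<Longrightarrow> free_gen x \<in> carrier (free_alg G)"
  by (auto simp: free_alg_carrier free_gen_def)

lemma free_alg_unital: "unital_algebra (free_alg G :: ('f::field, 'x list \<Rightarrow> 'f) module)"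
proof -
  let ?F = "free_alg G :: ('f, 'x list \<Rightarrow> 'f) module"
  have add: "(\<lambda>w. f w + g w) \<in> carrier ?F" if "f \<in> carrier ?F" "g \<in> carrier ?F" for f g
  proof -
    have "{w. f w + g w \<noteq> 0} \<subseteq> {w. f w \<noteq> 0} \<union> {w. g w \<noteq> 0}"
      by auto
    then show ?thesis
      using that unfolding free_alg_carrier by (meson finite_Un finite_subset le_sup_iff subset_trans)
  qed
  have smult: "(\<lambda>w. c * f w) \<in> carrier ?F" if "f \<in> carrier ?F" for f c
    using that by (auto simp: free_alg_carrier intro: rev_finite_subset)
  have conv: "conv f g \<in> carrier ?F" if "f \<in> carrier ?F" "g \<in> carrier ?F" for f g
  proof -
    have "finite {w. conv f g w \<noteq> 0}"
      using that by (intro finite_subset[OF conv_support]) (auto simp: free_alg_carrier)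
    moreover have "{w. conv f g w \<noteq> 0} \<subseteq> lists G"
      using that by (intro subset_trans[OF conv_support]) (auto simp: free_alg_carrier in_lists_conv_set dest!: subsetD)
    ultimately show ?thesis
      by (simp add: free_alg_carrier)
  qed
  have one: "(\<lambda>w. if w = [] then 1 else 0) \<in> carrier ?F"
    by (auto simp: free_alg_carrier)
  have zero: "(\<lambda>w. 0) \<in> carrier ?F"
    by (auto simp: free_alg_carrier)
  have neg: "\<exists>g\<in>carrier ?F. (\<lambda>w. g w + f w) = (\<lambda>w. 0)" if "f \<in> carrier ?F" for f
    using smult[OF that, of "- 1"] by (intro bexI[of _ "\<lambda>w. - 1 * f w"]) auto
  have ab: "abelian_group ?F"
    using neg by (intro abelian_groupI) (auto simp: add zero algebra_simps)
  have mon: "Group.monoid ?F"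
    by (intro monoidI) (auto simp: conv one conv_assoc conv_one_left conv_one_right)
  show ?thesis
    by (intro unital_algebra.intro lin_space.intro ringI ab mon unital_algebra_axioms.intro
        lin_space_axioms.intro)
      (auto simp: smult conv_add_left conv_add_right conv_smult_left conv_smult_right algebra_simps)
qed

lemma conv_free_gen:
  "conv (free_gen x) f w = (case w of [] \<Rightarrow> 0 | y # v \<Rightarrow> if y = x then f v else 0)"
  by (cases w) (auto simp: free_gen_def conv_one_left)

text \<open>Every word arises from the empty one by prepending letters, and every element is a
  finite combination of words. Hence the product case may be restricted to a generator on the
  left.\<close>

lemma free_alg_induct [consumes 1, case_names one add smult gen]:
  assumes f: "f \<in> carrier (free_alg G :: ('f::field, 'x list \<Rightarrow> 'f) module)"
    and one: "P \<one>\<^bsub>free_alg G\<^esub>"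
    and add: "\<And>f g. f \<in> carrier (free_alg G) \<Longrightarrow> g \<in> carrier (free_alg G) \<Longrightarrow> P f \<Longrightarrow> P g \<Longrightarrow>
      P (f \<oplus>\<^bsub>free_alg G\<^esub> g)"
    and smult: "\<And>c f. f \<in> carrier (free_alg G) \<Longrightarrow> P f \<Longrightarrow> P (c \<odot>\<^bsub>free_alg G\<^esub> f)"
    and gen: "\<And>x f. x \<in> G \<Longrightarrow> f \<in> carrier (free_alg G) \<Longrightarrow> P f \<Longrightarrow> P (free_gen x \<otimes>\<^bsub>free_alg G\<^esub> f)"
  shows "P f"
proof -
  let ?F = "free_alg G :: ('f, 'x list \<Rightarrow> 'f) module"
  interpret F: unital_algebra ?F by (rule free_alg_unital)
  define word where "word w = (\<lambda>u. if u = w then 1 else 0 :: 'f)" for w :: "'x list"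
  have word: "word w \<in> carrier ?F \<and> P (word w)" if "w \<in> lists G" for w
    using that
  proof (induction w)
    case Nil
    then show ?case using one F.one_closed by (simp add: word_def [abs_def])
  next
    case (Cons x w)
    have "word (x # w) = free_gen x \<otimes>\<^bsub>?F\<^esub> word w"
      by (rule ext) (auto simp: word_def conv_free_gen split: list.splits)
    then show ?case
      using Cons gen F.m_closed free_gen_carrier by metis
  qed
  \<comment> \<open>Induction on the support: removing one word \<open>w\<close> from
    \<open>f\<close> leaves an element with smaller support.\<close>
  have "\<forall>f. f \<in> carrier ?F \<longrightarrow> {w. f w \<noteq> 0} = S \<longrightarrow> P f" if "finite S" for S
    using that
  proof (induction S)
    case empty
    \<comment> \<open>The zero element has no case of its own; it is the multiple \<open>0\<close>
      of the unit.\<close>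
    have "P (\<lambda>w. 0)"
      using smult[OF _ one, of 0] F.one_closed by simp
    moreover have "f = (\<lambda>w. 0)" if "{w. f w \<noteq> 0} = {}" for f :: "'x list \<Rightarrow> 'f"
      using that by auto
    ultimately show ?case
      by blast
  next
    case (insert w S)
    show ?case
    proof (intro allI impI)
      fix f assume f: "f \<in> carrier ?F" and S: "{w. f w \<noteq> 0} = insert w S"
      define g where "g = (\<lambda>u. if u = w then 0 else f u)"
      have supp: "{w. g w \<noteq> 0} = S"
        using S insert.hyps by (auto simp: g_def)
      then have g: "g \<in> carrier ?F"
        using f S insert.hyps by (auto simp: free_alg_carrier)
      then have "P g"
        using insert.IH supp by simp
      moreover have w: "w \<in> lists G"
        using f S by (auto simp: free_alg_carrier)
      moreover have "f = g \<oplus>\<^bsub>?F\<^esub> (f w \<odot>\<^bsub>?F\<^esub> word w)"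
        by (auto simp: g_def word_def)
      ultimately show "P f"
        using add smult word g F.smult_closed by metis
    qed
  qed
  then show ?thesis
    using f by (auto simp: free_alg_carrier)
qed

text \<open>The value of a noncommutative polynomial when each letter \<open>x\<close> is replaced
  by \<open>g x\<close>. Folding from the right makes prepending a letter a multiplication from the
  left.\<close>

definition free_lift :: "('f::field, 'a, 'm) module_scheme \<Rightarrow> ('x \<Rightarrow> 'a) \<Rightarrow> ('x list \<Rightarrow> 'f) \<Rightarrow> 'a"
  where "free_lift A g f =
    (\<Oplus>\<^bsub>A\<^esub>w\<in>{w. f w \<noteq> 0}. f w \<odot>\<^bsub>A\<^esub> foldr (\<lambda>x a. g x \<otimes>\<^bsub>A\<^esub> a) w \<one>\<^bsub>A\<^esub>)"

context unital_algebra
begin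

lemma foldr_mult_closed:
  "g \<in> G \<rightarrow> carrier A \<Longrightarrow> w \<in> lists G \<Longrightarrow> foldr (\<lambda>x a. g x \<otimes> a) w \<one> \<in> carrier A"
  by (induction w) auto

text \<open>Supports change under the operations of the algebra; summing over a common finite set of
  words makes the values comparable.\<close>

lemma free_lift_superset:
  assumes "g \<in> G \<rightarrow> carrier A" "finite W" "W \<subseteq> lists G" "{w. f w \<noteq> 0} \<subseteq> W"
  shows "free_lift A g f = (\<Oplus>w\<in>W. f w \<odot> foldr (\<lambda>x a. g x \<otimes> a) w \<one>)"
  unfolding free_lift_def
  using assms foldr_mult_closed[OF assms(1)]
  by (intro add.finprod_mono_neutral_cong_left) (auto simp: subset_iff)

lemma free_lift_closed:
  "g \<in> G \<rightarrow> carrier A \<Longrightarrow> f \<in> carrier (free_alg G) \<Longrightarrow> free_lift A g f \<in> carrier A"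
  unfolding free_lift_def free_alg_carrier
  by (intro finsum_closed) (auto simp: subset_iff intro!: foldr_mult_closed)

lemma free_lift_gen: "g x \<in> carrier A \<Longrightarrow> free_lift A g (free_gen x) = g x"
  by (subst free_lift_superset[of g "{x}" "{[x]}"]) (auto simp: free_gen_def)

text \<open>Multiplicativity is an induction on the left factor, so the only product that has to be
  computed is one with a generator on the left.\<close>

lemma free_lift_hom:
  assumes g: "g \<in> G \<rightarrow> carrier A"
  shows "free_lift A g \<in> alg_hom (free_alg G) A"
proof -
  let ?F = "free_alg G"
  interpret F: unital_algebra ?F by (rule free_alg_unital)
  let ?m = "\<lambda>w. foldr (\<lambda>x a. g x \<otimes> a) w \<one>"
  have m: "?m w \<in> carrier A" if "w \<in> lists G" for w
    using foldr_mult_closed[OF g that] .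
  have add: "free_lift A g (f \<oplus>\<^bsub>?F\<^esub> h) = free_lift A g f \<oplus> free_lift A g h"
    if f: "f \<in> carrier ?F" and h: "h \<in> carrier ?F" for f h
  proof -
    let ?W = "{w. f w \<noteq> 0} \<union> {w. h w \<noteq> 0}"
    have W: "finite ?W" "?W \<subseteq> lists G"
      using f h by (auto simp: free_alg_carrier)
    have "free_lift A g (f \<oplus>\<^bsub>?F\<^esub> h) = (\<Oplus>w\<in>?W. (f \<oplus>\<^bsub>?F\<^esub> h) w \<odot> ?m w)"
      by (rule free_lift_superset[OF g W]) auto
    also have "\<dots> = (\<Oplus>w\<in>?W. f w \<odot> ?m w \<oplus> h w \<odot> ?m w)"
      using W m by (intro finsum_cong') (auto simp: subset_iff smult_l_distr)
    also have "\<dots> = (\<Oplus>w\<in>?W. f w \<odot> ?m w) \<oplus> (\<Oplus>w\<in>?W. h w \<odot> ?m w)"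
      using W m by (intro finsum_addf) (auto simp: subset_iff)
    also have "(\<Oplus>w\<in>?W. f w \<odot> ?m w) = free_lift A g f"
      by (rule free_lift_superset[OF g W, symmetric]) auto
    also have "(\<Oplus>w\<in>?W. h w \<odot> ?m w) = free_lift A g h"
      by (rule free_lift_superset[OF g W, symmetric]) auto
    finally show ?thesis .
  qed
  have smult: "free_lift A g (c \<odot>\<^bsub>?F\<^esub> f) = c \<odot> free_lift A g f" if f: "f \<in> carrier ?F" for c f
  proof -
    let ?W = "{w. f w \<noteq> 0}"
    have W: "finite ?W" "?W \<subseteq> lists G"
      using f by (auto simp: free_alg_carrier)
    have "free_lift A g (c \<odot>\<^bsub>?F\<^esub> f) = (\<Oplus>w\<in>?W. (c \<odot>\<^bsub>?F\<^esub> f) w \<odot> ?m w)"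
      by (rule free_lift_superset[OF g W]) auto
    also have "\<dots> = (\<Oplus>w\<in>?W. c \<odot> (f w \<odot> ?m w))"
      using W m by (intro finsum_cong') (auto simp: subset_iff smult_assoc)
    also have "\<dots> = c \<odot> free_lift A g f"
      unfolding free_lift_def using W m by (subst smult_finsum) (auto simp: subset_iff)
    finally show ?thesis .
  qed
  have gen: "free_lift A g (free_gen x \<otimes>\<^bsub>?F\<^esub> f) = g x \<otimes> free_lift A g f"
    if x: "x \<in> G" and f: "f \<in> carrier ?F" for x f
  proof -
    let ?W = "{w. f w \<noteq> 0}"
    have W: "finite ?W" "?W \<subseteq> lists G"
      using f by (auto simp: free_alg_carrier)
    have gx: "g x \<in> carrier A"
      using g x by auto
    have supp: "{w. (free_gen x \<otimes>\<^bsub>?F\<^esub> f) w \<noteq> 0} \<subseteq> Cons x ` ?W"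
    proof
      fix w assume "w \<in> {w. (free_gen x \<otimes>\<^bsub>?F\<^esub> f) w \<noteq> 0}"
      then show "w \<in> Cons x ` ?W"
        by (cases w) (auto simp: conv_free_gen split: if_splits)
    qed
    \<comment> \<open>All words of the product begin with \<open>x\<close>, so the sum is reindexed
      by the injection \<open>Cons x\<close>.\<close>
    have "free_lift A g (free_gen x \<otimes>\<^bsub>?F\<^esub> f) =
        (\<Oplus>w\<in>Cons x ` ?W. (free_gen x \<otimes>\<^bsub>?F\<^esub> f) w \<odot> ?m w)"
      using W x by (intro free_lift_superset[OF g _ _ supp]) (force simp: subset_iff)+
    also have "\<dots> = (\<Oplus>w\<in>?W. (free_gen x \<otimes>\<^bsub>?F\<^esub> f) (x # w) \<odot> ?m (x # w))"
      using W m gx by (intro finsum_reindex) (auto simp: subset_iff)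
    also have "\<dots> = (\<Oplus>w\<in>?W. g x \<otimes> (f w \<odot> ?m w))"
    proof (intro finsum_cong')
      fix w assume "w \<in> ?W"
      then have "?m w \<in> carrier A"
        using W m by blast
      then show "(free_gen x \<otimes>\<^bsub>?F\<^esub> f) (x # w) \<odot> ?m (x # w) = g x \<otimes> (f w \<odot> ?m w)"
        using gx by (simp add: conv_free_gen smult_mult_right del: conv_Cons)
    next
      show "(\<lambda>w. g x \<otimes> (f w \<odot> ?m w)) \<in> ?W \<rightarrow> carrier A"
        using W m gx by blast
    qed simp
    also have "\<dots> = g x \<otimes> free_lift A g f"
      unfolding free_lift_def using W m gx by (subst finsum_rdistr) (auto simp: subset_iff)
    finally show ?thesis .
  qed
  have one: "free_lift A g \<one>\<^bsub>?F\<^esub> = \<one>"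
    by (subst free_lift_superset[OF g, of "{[]}"]) auto
  have mult: "free_lift A g (f \<otimes>\<^bsub>?F\<^esub> h) = free_lift A g f \<otimes> free_lift A g h"
    if f: "f \<in> carrier ?F" and h: "h \<in> carrier ?F" for f h
    using f
  proof (induction f rule: free_alg_induct)
    case one
    then show ?case
      using h free_lift_closed[OF g h] \<open>free_lift A g \<one>\<^bsub>?F\<^esub> = \<one>\<close> by (simp del: free_alg_simps)
  next
    case (add f k)
    then show ?case
      using h by (simp add: F.l_distr \<open>\<And>f h. _ \<Longrightarrow> _ \<Longrightarrow> free_lift A g (f \<oplus>\<^bsub>?F\<^esub> h) = _\<close>
          l_distr free_lift_closed[OF g] del: free_alg_simps)
  next
    case (smult c f)
    then show ?case
      using h by (simp add: F.smult_mult_left[symmetric] smult_mult_left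
          \<open>\<And>c f. _ \<Longrightarrow> free_lift A g (c \<odot>\<^bsub>?F\<^esub> f) = _\<close> free_lift_closed[OF g] del: free_alg_simps)
  next
    case (gen x f)
    then show ?case
      using h g by (simp add: F.m_assoc m_assoc free_gen_carrier Pi_def free_lift_closed[OF g]
          \<open>\<And>x f. _ \<Longrightarrow> _ \<Longrightarrow> free_lift A g (free_gen x \<otimes>\<^bsub>?F\<^esub> f) = _\<close> del: free_alg_simps)
  qed
  show ?thesis
    using free_lift_closed[OF g] add mult one smult by (intro alg_homI) auto
qed

end

section \<open>Quotients and presented algebras\<close>

context unital_algebra
begin

text \<open>Scaling by \<open>c\<close> is multiplication by the element
  \<open>c \<odot> \<one>\<close>.\<close>

lemma ideal_smult_closed:
  assumes "ideal I A" "x \<in> I"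
  shows "c \<odot> x \<in> I"
proof -
  interpret I: ideal I A by fact
  have "c \<odot> x = (c \<odot> \<one>) \<otimes> x"
    using assms(2) smult_mult_left[of \<one> x c] by simp
  then show ?thesis
    using assms(2) by (simp add: I.I_l_closed)
qed

text \<open>The union in \<open>quot_alg\<close> runs over the cosets obtained from all
  representatives. Two representatives differ by an element of the ideal, and so do their multiples,
  so these cosets coincide.\<close>

lemma quot_alg_smult:
  assumes I: "ideal I A" and x: "x \<in> carrier A"
  shows "c \<odot>\<^bsub>quot_alg A I\<^esub> (I +> x) = I +> (c \<odot> x)"
proof -
  interpret I: ideal I A by fact
  have "I +> (c \<odot> y) = I +> (c \<odot> x)" if y: "y \<in> I +> x" for y
  proof -
    obtain h where h: "h \<in> I" "y = h \<oplus> x"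
      using y by (auto simp: a_r_coset_def')
    moreover have hc: "h \<in> carrier A"
      using h(1) by (rule I.a_Hcarr)
    ultimately have "c \<odot> y \<ominus> c \<odot> x = c \<odot> h"
      using x by (simp add: smult_r_distr a_minus_def a_assoc r_neg)
    then have "c \<odot> y \<ominus> c \<odot> x \<in> I"
      using ideal_smult_closed[OF I h(1)] by simp
    then show ?thesis
      using x h hc by (subst quotient_eq_iff_same_a_r_cos[OF I, symmetric]) auto
  qed
  moreover have "x \<in> I +> x"
    using x by (rule I.a_rcos_self)
  ultimately have "(\<Union>y\<in>I +> x. I +> (c \<odot> y)) = I +> (c \<odot> x)"
    by (intro SUP_eq_const) blast+
  then show ?thesis
    by (simp add: quot_alg_def)
qed

lemma quot_alg_carrier:
  "carrier (quot_alg A I) = (\<lambda>x. I +> x) ` carrier A"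
  by (auto simp: quot_alg_def FactRing_def A_RCOSETS_def')

text \<open>The ring axioms come from \<open>A Quot I\<close>, whose operations
  \<open>quot_alg\<close> copies; the axioms for scalars are checked on representatives.\<close>

lemma quot_alg_unital:
  assumes I: "ideal I A"
  shows "unital_algebra (quot_alg A I)" and "(\<lambda>x. I +> x) \<in> alg_hom A (quot_alg A I)"
proof -
  interpret I: ideal I A by fact
  let ?Q = "quot_alg A I"
  interpret Q: ring "A Quot I" by (rule I.quotient_is_ring)
  have hom: "(\<lambda>x. I +> x) \<in> ring_hom A (A Quot I)"
    using I.rcos_ring_hom .
  then show h: "(\<lambda>x. I +> x) \<in> alg_hom A ?Q"
    by (auto simp: alg_hom_def ring_hom_def quot_alg_smult[OF I])
      (auto simp: quot_alg_def)
  have ab: "abelian_group ?Q"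
  proof (rule abelian_groupI)
    show "\<exists>y\<in>carrier ?Q. y \<oplus>\<^bsub>?Q\<^esub> x = \<zero>\<^bsub>?Q\<^esub>" if "x \<in> carrier ?Q" for x
      using that Q.l_neg Q.a_inv_closed by (auto simp: quot_alg_def)
  qed (simp_all add: quot_alg_def Q.a_ac)
  have mon: "Group.monoid ?Q"
    by (rule monoidI) (auto simp: quot_alg_def Q.m_assoc)
  have ring: "ring ?Q"
    by (rule ringI[OF ab mon]) (auto simp: quot_alg_def Q.l_distr Q.r_distr)
  show "unital_algebra ?Q"
  proof (intro unital_algebra.intro lin_space.intro ab ring unital_algebra_axioms.intro
        lin_space_axioms.intro)
    show "c \<odot>\<^bsub>?Q\<^esub> (x \<otimes>\<^bsub>?Q\<^esub> y) = x \<otimes>\<^bsub>?Q\<^esub> (c \<odot>\<^bsub>?Q\<^esub> y)"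
      if "x \<in> carrier ?Q" "y \<in> carrier ?Q" for c x y
      using that by (auto simp: quot_alg_carrier quot_alg_smult[OF I]
          alg_hom_mult[OF h, symmetric] smult_mult_right)
    show "c \<odot>\<^bsub>?Q\<^esub> (x \<otimes>\<^bsub>?Q\<^esub> y) = (c \<odot>\<^bsub>?Q\<^esub> x) \<otimes>\<^bsub>?Q\<^esub> y"
      if "x \<in> carrier ?Q" "y \<in> carrier ?Q" for c x y
      using that by (auto simp: quot_alg_carrier quot_alg_smult[OF I]
          alg_hom_mult[OF h, symmetric] smult_mult_left)
  qed (auto simp: quot_alg_carrier quot_alg_smult[OF I] alg_hom_add[OF h, symmetric]
      smult_l_distr smult_r_distr smult_assoc)
qed

end

section \<open>Presented algebras and their universal property\<close>

locale presentation =
  fixes G :: "'x set" and S :: "(('x list \<Rightarrow> 'f::field) \<times> ('x list \<Rightarrow> 'f)) set"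
  assumes rels: "S \<subseteq> carrier (free_alg G) \<times> carrier (free_alg G)"
begin

interpretation F: unital_algebra "free_alg G :: ('f, 'x list \<Rightarrow> 'f) module"
  by (rule free_alg_unital)

lemma rel_ideal: "ideal (rel_ideal G S) (free_alg G)"
  unfolding rel_ideal_def using rels by (intro F.genideal_ideal) (auto simp del: free_alg_simps)

lemma presented_unital: "unital_algebra (presented_alg G S)"
  unfolding presented_alg_def by (rule F.quot_alg_unital[OF rel_ideal])

lemma presented_proj:
  "(\<lambda>x. rel_ideal G S +>\<^bsub>free_alg G\<^esub> x) \<in> alg_hom (free_alg G) (presented_alg G S)"
  unfolding presented_alg_def by (rule F.quot_alg_unital[OF rel_ideal])

lemma presented_carrier:
  "carrier (presented_alg G S) = (\<lambda>x. rel_ideal G S +>\<^bsub>free_alg G\<^esub> x) ` carrier (free_alg G)"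
  unfolding presented_alg_def by (rule F.quot_alg_carrier)

lemma presented_gen_closed: "x \<in> G \<Longrightarrow> presented_gen G S x \<in> carrier (presented_alg G S)"
  unfolding presented_gen_def presented_carrier by (auto intro: free_gen_carrier)

lemma presented_relation:
  assumes "(u, v) \<in> S"
  shows "rel_ideal G S +>\<^bsub>free_alg G\<^esub> u = rel_ideal G S +>\<^bsub>free_alg G\<^esub> v"
proof -
  have "{u \<ominus>\<^bsub>free_alg G\<^esub> v | u v. (u, v) \<in> S} \<subseteq> rel_ideal G S"
    unfolding rel_ideal_def using rels by (intro F.genideal_self) (auto simp del: free_alg_simps)
  then have "u \<ominus>\<^bsub>free_alg G\<^esub> v \<in> rel_ideal G S"
    using assms by blast
  then show ?thesis
    using F.quotient_eq_iff_same_a_r_cos[OF rel_ideal] rels assms by auto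
qed

lemma presented_induct [consumes 1, case_names one add smult gen]:
  assumes f: "f \<in> carrier (presented_alg G S)"
    and one: "P \<one>\<^bsub>presented_alg G S\<^esub>"
    and add: "\<And>f g. f \<in> carrier (presented_alg G S) \<Longrightarrow> g \<in> carrier (presented_alg G S) \<Longrightarrow>
      P f \<Longrightarrow> P g \<Longrightarrow> P (f \<oplus>\<^bsub>presented_alg G S\<^esub> g)"
    and smult: "\<And>c f. f \<in> carrier (presented_alg G S) \<Longrightarrow> P f \<Longrightarrow> P (c \<odot>\<^bsub>presented_alg G S\<^esub> f)"
    and gen: "\<And>x f. x \<in> G \<Longrightarrow> f \<in> carrier (presented_alg G S) \<Longrightarrow> P f \<Longrightarrow>
      P (presented_gen G S x \<otimes>\<^bsub>presented_alg G S\<^esub> f)"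
  shows "P f"
proof -
  let ?h = "\<lambda>x. rel_ideal G S +>\<^bsub>free_alg G\<^esub> x"
  obtain f' where f': "f' \<in> carrier (free_alg G)" "f = ?h f'"
    using f unfolding presented_carrier by blast
  have "P (?h f')"
    using f'(1)
  proof (induction f' rule: free_alg_induct)
    case one
    then show ?case
      using alg_hom_one[OF presented_proj] \<open>P \<one>\<^bsub>presented_alg G S\<^esub>\<close> by simp
  next
    case (add f g)
    then show ?case
      using alg_hom_add[OF presented_proj, of f g] assms(3)[of "?h f" "?h g"]
        alg_hom_closed[OF presented_proj] by (simp del: free_alg_simps)
  next
    case (smult c f)
    then show ?case
      using alg_hom_smult[OF presented_proj, of f c] assms(4)[of "?h f" c]
        alg_hom_closed[OF presented_proj] by (simp del: free_alg_simps)
  next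
    case (gen x f)
    then show ?case
      using alg_hom_mult[OF presented_proj free_gen_carrier[OF gen(1)], of f] assms(5)[of x "?h f"]
        alg_hom_closed[OF presented_proj]
      by (simp add: presented_gen_def del: free_alg_simps)
  qed
  then show ?thesis
    using f' by simp
qed

text \<open>Evaluation at \<open>g\<close> kills the differences \<open>u - v\<close>, hence the
  ideal they generate, and so factors through the quotient.\<close>

lemma presented_universal:
  assumes A: "unital_algebra A" and g: "g \<in> G \<rightarrow> carrier A"
    and rel: "\<And>u v. (u, v) \<in> S \<Longrightarrow> free_lift A g u = free_lift A g v"
  obtains \<phi> where "\<phi> \<in> alg_hom (presented_alg G S) A"
    and "\<And>x. x \<in> G \<Longrightarrow> \<phi> (presented_gen G S x) = g x"
proof -
  interpret A: unital_algebra A by fact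
  let ?l = "free_lift A g"
  let ?h = "\<lambda>x. rel_ideal G S +>\<^bsub>free_alg G\<^esub> x"
  have l: "?l \<in> alg_hom (free_alg G) A"
    by (rule A.free_lift_hom[OF g])
  interpret l: ring_hom_ring "free_alg G" A ?l
    using l F.ring_axioms A.ring_axioms by (auto simp: alg_hom_def intro: ring_hom_ringI2)
  have ker: "rel_ideal G S \<subseteq> a_kernel (free_alg G) A ?l"
    unfolding rel_ideal_def
  proof (rule F.genideal_minimal[OF l.kernel_is_ideal], clarify)
    fix u v assume uv: "(u, v) \<in> S"
    then have u: "u \<in> carrier (free_alg G)" and v: "v \<in> carrier (free_alg G)"
      using rels by blast+
    have "?l (u \<ominus>\<^bsub>free_alg G\<^esub> v) = ?l v \<ominus>\<^bsub>A\<^esub> ?l v"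
      using alg_hom_minus[OF l F.unital_algebra_axioms A u v] rel[OF uv] by metis
    also have "\<dots> = \<zero>\<^bsub>A\<^esub>"
      using alg_hom_closed[OF l v] A.minus_eq_zero_iff by blast
    finally show "u \<ominus>\<^bsub>free_alg G\<^esub> v \<in> a_kernel (free_alg G) A ?l"
      using F.minus_closed[OF u v] unfolding a_kernel_def' by blast
  qed
  \<comment> \<open>Elements of the quotient are cosets, so the map evaluates a chosen
    representative; the next step shows that any other choice gives the same value, because the
    kernel contains the ideal.\<close>
  define \<phi> where "\<phi> X = ?l (SOME x. x \<in> carrier (free_alg G) \<and> ?h x = X)" for X
  have \<phi>: "\<phi> (?h x) = ?l x" if x: "x \<in> carrier (free_alg G)" for x
  proof -
    define y where "y = (SOME y. y \<in> carrier (free_alg G) \<and> ?h y = ?h x)"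
    have y: "y \<in> carrier (free_alg G) \<and> ?h y = ?h x"
      unfolding y_def using x by (rule someI[of _ x, OF conjI]) (rule refl)
    then have "y \<ominus>\<^bsub>free_alg G\<^esub> x \<in> rel_ideal G S"
      using F.quotient_eq_iff_same_a_r_cos[OF rel_ideal] x by blast
    then have "?l (y \<ominus>\<^bsub>free_alg G\<^esub> x) = \<zero>\<^bsub>A\<^esub>"
      using ker unfolding a_kernel_def' by blast
    then have "?l y \<ominus>\<^bsub>A\<^esub> ?l x = \<zero>\<^bsub>A\<^esub>"
      using alg_hom_minus[OF l F.unital_algebra_axioms A] x y by metis
    then have "?l y = ?l x"
      using x y A.minus_eq_zero_iff alg_hom_closed[OF l] by metis
    then show ?thesis
      by (simp add: \<phi>_def y_def)
  qed
  note p = presented_proj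
  have "\<phi> \<in> alg_hom (presented_alg G S) A"
  proof (rule alg_homI)
    show "\<phi> x \<in> carrier A" if "x \<in> carrier (presented_alg G S)" for x
      using that by (auto simp: presented_carrier \<phi> l.hom_closed)
    show "\<phi> (x \<oplus>\<^bsub>presented_alg G S\<^esub> y) = \<phi> x \<oplus>\<^bsub>A\<^esub> \<phi> y"
      if "x \<in> carrier (presented_alg G S)" "y \<in> carrier (presented_alg G S)" for x y
      using that by (auto simp: presented_carrier \<phi> alg_hom_add[OF p, symmetric]
          alg_hom_add[OF l] simp del: free_alg_simps)
    show "\<phi> (x \<otimes>\<^bsub>presented_alg G S\<^esub> y) = \<phi> x \<otimes>\<^bsub>A\<^esub> \<phi> y"
      if "x \<in> carrier (presented_alg G S)" "y \<in> carrier (presented_alg G S)" for x y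
      using that by (auto simp: presented_carrier \<phi> alg_hom_mult[OF p, symmetric]
          alg_hom_mult[OF l] simp del: free_alg_simps)
    show "\<phi> (c \<odot>\<^bsub>presented_alg G S\<^esub> x) = c \<odot>\<^bsub>A\<^esub> \<phi> x"
      if "x \<in> carrier (presented_alg G S)" for c x
      using that by (auto simp: presented_carrier \<phi> alg_hom_smult[OF p, symmetric]
          alg_hom_smult[OF l] simp del: free_alg_simps)
    show "\<phi> \<one>\<^bsub>presented_alg G S\<^esub> = \<one>\<^bsub>A\<^esub>"
      using \<phi>[OF F.one_closed] by (simp add: alg_hom_one[OF p] alg_hom_one[OF l] del: free_alg_simps)
  qed
  moreover have "\<phi> (presented_gen G S x) = g x" if "x \<in> G" for x
    using that g unfolding presented_gen_def
    by (simp add: \<phi> free_gen_carrier A.free_lift_gen Pi_def)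
  ultimately show thesis
    using that by blast
qed

end

section \<open>Products and endomorphisms\<close>

lemmas (in lin_space) lin_simps = a_closed zero_closed a_assoc l_zero a_comm smult_closed
  smult_l_distr smult_r_distr smult_assoc smult_one

lemmas (in unital_algebra) alg_simps = lin_simps m_closed one_closed m_assoc l_one r_one
  l_distr r_distr

text \<open>Negatives are produced as \<open>(- 1) \<odot> x\<close>; the premise
  \<open>0 \<odot> x = \<zero>\<close> is there for this purpose.\<close>

lemma lin_spaceI:
  fixes V (structure)
  assumes "\<And>x y. x \<in> carrier V \<Longrightarrow> y \<in> carrier V \<Longrightarrow> x \<oplus> y \<in> carrier V"
    and "\<zero> \<in> carrier V"
    and "\<And>c x. x \<in> carrier V \<Longrightarrow> c \<odot> x \<in> carrier V"
    and "\<And>x y z. x \<in> carrier V \<Longrightarrow> y \<in> carrier V \<Longrightarrow> z \<in> carrier V \<Longrightarrow> (x \<oplus> y) \<oplus> z = x \<oplus> (y \<oplus> z)"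
    and "\<And>x y. x \<in> carrier V \<Longrightarrow> y \<in> carrier V \<Longrightarrow> x \<oplus> y = y \<oplus> x"
    and "\<And>x. x \<in> carrier V \<Longrightarrow> \<zero> \<oplus> x = x"
    and "\<And>x. x \<in> carrier V \<Longrightarrow> 0 \<odot> x = \<zero>"
    and "\<And>c d x. x \<in> carrier V \<Longrightarrow> (c + d) \<odot> x = c \<odot> x \<oplus> d \<odot> x"
    and "\<And>c x y. x \<in> carrier V \<Longrightarrow> y \<in> carrier V \<Longrightarrow> c \<odot> (x \<oplus> y) = c \<odot> x \<oplus> c \<odot> y"
    and "\<And>c d x. x \<in> carrier V \<Longrightarrow> (c * d) \<odot> x = c \<odot> (d \<odot> x)"
    and "\<And>x. x \<in> carrier V \<Longrightarrow> 1 \<odot> x = x"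
  shows "lin_space V"
proof (intro lin_space.intro lin_space_axioms.intro abelian_groupI)
  show "\<exists>y\<in>carrier V. y \<oplus> x = \<zero>" if x: "x \<in> carrier V" for x
    using assms(3)[OF x, of "- 1"] assms(8)[OF x, of "- 1" 1] assms(7,11)[OF x] by auto
qed (use assms in simp_all)

lemma unital_algebraI:
  fixes A (structure)
  assumes "lin_space A"
    and "\<And>x y. x \<in> carrier A \<Longrightarrow> y \<in> carrier A \<Longrightarrow> x \<otimes> y \<in> carrier A"
    and "\<one> \<in> carrier A"
    and "\<And>x y z. x \<in> carrier A \<Longrightarrow> y \<in> carrier A \<Longrightarrow> z \<in> carrier A \<Longrightarrow> (x \<otimes> y) \<otimes> z = x \<otimes> (y \<otimes> z)"
    and "\<And>x. x \<in> carrier A \<Longrightarrow> \<one> \<otimes> x = x"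
    and "\<And>x. x \<in> carrier A \<Longrightarrow> x \<otimes> \<one> = x"
    and "\<And>x y z. x \<in> carrier A \<Longrightarrow> y \<in> carrier A \<Longrightarrow> z \<in> carrier A \<Longrightarrow> (x \<oplus> y) \<otimes> z = x \<otimes> z \<oplus> y \<otimes> z"
    and "\<And>x y z. x \<in> carrier A \<Longrightarrow> y \<in> carrier A \<Longrightarrow> z \<in> carrier A \<Longrightarrow> z \<otimes> (x \<oplus> y) = z \<otimes> x \<oplus> z \<otimes> y"
    and "\<And>c x y. x \<in> carrier A \<Longrightarrow> y \<in> carrier A \<Longrightarrow> c \<odot> (x \<otimes> y) = (c \<odot> x) \<otimes> y"
    and "\<And>c x y. x \<in> carrier A \<Longrightarrow> y \<in> carrier A \<Longrightarrow> c \<odot> (x \<otimes> y) = x \<otimes> (c \<odot> y)"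
  shows "unital_algebra A"
  using assms(1) lin_space.axioms(1)[OF assms(1)]
  by (intro unital_algebra.intro unital_algebra_axioms.intro ringI monoidI) (use assms in simp_all)

section \<open>Products of algebras\<close>

lemma prod_alg_simps:
  "carrier (prod_alg I A) = (\<Pi>\<^sub>E i\<in>I. carrier (A i))"
  "mult (prod_alg I A) = (\<lambda>x y. \<lambda>i\<in>I. x i \<otimes>\<^bsub>A i\<^esub> y i)"
  "one (prod_alg I A) = (\<lambda>i\<in>I. \<one>\<^bsub>A i\<^esub>)"
  "zero (prod_alg I A) = (\<lambda>i\<in>I. \<zero>\<^bsub>A i\<^esub>)"
  "add (prod_alg I A) = (\<lambda>x y. \<lambda>i\<in>I. x i \<oplus>\<^bsub>A i\<^esub> y i)"
  "smult (prod_alg I A) = (\<lambda>c x. \<lambda>i\<in>I. c \<odot>\<^bsub>A i\<^esub> x i)"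
  by (simp_all add: prod_alg_def)

lemma prod_alg_lin_space:
  assumes A: "\<And>i. i \<in> I \<Longrightarrow> lin_space (A i)"
  shows "lin_space (prod_alg I A)"
  using lin_space.lin_simps[OF A] lin_space.smult_zero_left[OF A]
  by (intro lin_spaceI) (auto simp: prod_alg_simps PiE_iff fun_eq_iff extensional_def)

lemma prod_alg_unital:
  assumes A: "\<And>i. i \<in> I \<Longrightarrow> unital_algebra (A i)"
  shows "unital_algebra (prod_alg I A)"
proof (intro unital_algebraI prod_alg_lin_space)
  fix c x y
  assume "x \<in> carrier (prod_alg I A)" "y \<in> carrier (prod_alg I A)"
  then show "c \<odot>\<^bsub>prod_alg I A\<^esub> (x \<otimes>\<^bsub>prod_alg I A\<^esub> y) = (c \<odot>\<^bsub>prod_alg I A\<^esub> x) \<otimes>\<^bsub>prod_alg I A\<^esub> y"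
    using unital_algebra.smult_mult_left[OF A] by (auto simp: prod_alg_simps PiE_iff fun_eq_iff)
next
  fix c x y
  assume "x \<in> carrier (prod_alg I A)" "y \<in> carrier (prod_alg I A)"
  then show "c \<odot>\<^bsub>prod_alg I A\<^esub> (x \<otimes>\<^bsub>prod_alg I A\<^esub> y) = x \<otimes>\<^bsub>prod_alg I A\<^esub> (c \<odot>\<^bsub>prod_alg I A\<^esub> y)"
    using unital_algebra.smult_mult_right[OF A] by (auto simp: prod_alg_simps PiE_iff fun_eq_iff)
qed (use A[unfolded unital_algebra_def] unital_algebra.alg_simps(11-)[OF A] in
    \<open>auto simp: prod_alg_simps PiE_iff fun_eq_iff extensional_def\<close>)

lemma prod_alg_component:
  "i \<in> I \<Longrightarrow> (\<lambda>x. x i) \<in> alg_hom (prod_alg I A) (A i)"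
  by (rule alg_homI) (auto simp: prod_alg_simps)

text \<open>Endomorphisms are restricted to the carrier of \<open>V\<close>, so that two elements of
  this algebra are equal as soon as they agree on \<open>V\<close>.\<close>

definition end_alg :: "('f::field, 'v) module \<Rightarrow> ('f, 'v \<Rightarrow> 'v) module"
  where "end_alg V =
    \<lparr>carrier = {f \<in> carrier V \<rightarrow>\<^sub>E carrier V.
        (\<forall>x\<in>carrier V. \<forall>y\<in>carrier V. f (x \<oplus>\<^bsub>V\<^esub> y) = f x \<oplus>\<^bsub>V\<^esub> f y) \<and>
        (\<forall>c. \<forall>x\<in>carrier V. f (c \<odot>\<^bsub>V\<^esub> x) = c \<odot>\<^bsub>V\<^esub> f x)},
     mult = (\<lambda>f g. \<lambda>v\<in>carrier V. f (g v)),
     one = (\<lambda>v\<in>carrier V. v),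
     zero = (\<lambda>v\<in>carrier V. \<zero>\<^bsub>V\<^esub>),
     add = (\<lambda>f g. \<lambda>v\<in>carrier V. f v \<oplus>\<^bsub>V\<^esub> g v),
     smult = (\<lambda>c f. \<lambda>v\<in>carrier V. c \<odot>\<^bsub>V\<^esub> f v)\<rparr>"

lemma end_alg_simps:
  "mult (end_alg V) = (\<lambda>f g. \<lambda>v\<in>carrier V. f (g v))"
  "one (end_alg V) = (\<lambda>v\<in>carrier V. v)"
  "zero (end_alg V) = (\<lambda>v\<in>carrier V. \<zero>\<^bsub>V\<^esub>)"
  "add (end_alg V) = (\<lambda>f g. \<lambda>v\<in>carrier V. f v \<oplus>\<^bsub>V\<^esub> g v)"
  "smult (end_alg V) = (\<lambda>c f. \<lambda>v\<in>carrier V. c \<odot>\<^bsub>V\<^esub> f v)"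
  by (simp_all add: end_alg_def)

text \<open>This is where the field is used as a commutative ring: it makes a scalar multiple of an
  endomorphism linear again.\<close>

lemma (in lin_space) smult_commute: "x \<in> carrier V \<Longrightarrow> c \<odot> (d \<odot> x) = d \<odot> (c \<odot> x)"
  using smult_assoc[of x c d] smult_assoc[of x d c] by (simp add: mult.commute)

lemma end_alg_unital:
  assumes "lin_space V"
  shows "unital_algebra (end_alg V)"
proof -
  interpret lin_space V by fact
  have "lin_space (end_alg V)"
    by (rule lin_spaceI) (auto simp: end_alg_def PiE_iff fun_eq_iff extensional_def a_ac
        smult_l_distr smult_r_distr smult_assoc smult_commute)
  then show ?thesis
    by (rule unital_algebraI) (auto simp: end_alg_def PiE_iff fun_eq_iff extensional_def)
qed

lemma end_alg_mem:
  assumes "f \<in> carrier (end_alg V)"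
  shows "v \<in> carrier V \<Longrightarrow> f v \<in> carrier V"
  using assms by (auto simp: end_alg_def)

lemma end_alg_finsum:
  assumes "lin_space V" "finite J" "f \<in> J \<rightarrow> carrier (end_alg V)" "v \<in> carrier V"
  shows "finsum (end_alg V) f J v = finsum V (\<lambda>j. f j v) J"
proof -
  interpret V: lin_space V by fact
  interpret E: unital_algebra "end_alg V" by (rule end_alg_unital) fact
  show ?thesis
    using assms(2,3)
  proof (induction J)
    case empty
    then show ?case using assms(4) by (simp add: end_alg_simps)
  next
    case (insert j J)
    then have "f \<in> J \<rightarrow> carrier (end_alg V)" "f j \<in> carrier (end_alg V)"
      by auto
    moreover from this have "(\<lambda>j. f j v) \<in> J \<rightarrow> carrier V" "f j v \<in> carrier V"
      using end_alg_mem[OF _ assms(4)] by (simp_all add: Pi_iff)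
    ultimately show ?case
      using insert assms(4) by (simp add: V.finsum_insert E.finsum_insert end_alg_simps)
  qed
qed

section \<open>Families satisfying the quiver Hecke relations\<close>

text \<open>Apart from one singleton, \<open>klr_relations\<close> is a union of comprehensions in
  two variables. This lemma and the four after it process such a comprehension as a whole; being
  contained in \<open>Id\<close> means that the relations hold.\<close>

lemma subset_Id_compr:
  "{(f a i, g a i) | a i. P a i} \<subseteq> Id \<longleftrightarrow> (\<forall>a i. P a i \<longrightarrow> f a i = g a i)"
  by auto

lemma all_imp_cong2:
  "(\<And>a i. P a i \<Longrightarrow> Q a i = R a i) \<Longrightarrow> (\<forall>a i. P a i \<longrightarrow> Q a i) = (\<forall>a i. P a i \<longrightarrow> R a i)"
  by blast

lemma subset_Times_compr:
  "{(f a i, g a i) | a i. P a i} \<subseteq> C \<times> C \<longleftrightarrow> (\<forall>a i. P a i \<longrightarrow> f a i \<in> C \<and> g a i \<in> C)"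
  by auto

lemma image_compr2:
  "map_prod h h ` {(f a i, g a i) | a i. P a i} = {(h (f a i), h (g a i)) | a i. P a i}"
  by (auto simp: image_iff)

lemma compr_cong2:
  assumes "\<And>a i. P a i \<Longrightarrow> f a i = f' a i" "\<And>a i. P a i \<Longrightarrow> g a i = g' a i"
  shows "{(f a i, g a i) | a i. P a i} = {(f' a i, g' a i) | a i. P a i}"
  using assms by (metis (no_types, lifting))

text \<open>Asks for membership only, so that it covers the free algebra, where the relations are
  written down, as well as the algebras in which they hold.\<close>

locale klr_elems = unital_algebra A
  for A :: "('f::field, 'a) module" (structure)
    and \<Gamma> :: "'k rel" and n :: nat and I :: "'i set" and rep :: "'i \<Rightarrow> nat \<Rightarrow> 'k"
    and act :: "nat \<Rightarrow> 'i \<Rightarrow> 'i" and e :: "'i \<Rightarrow> 'a" and y :: "nat \<Rightarrow> 'a" and psi :: "nat \<Rightarrow> 'a" +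
  assumes finite_index: "finite I"
    and act_closed: "a \<in> {1..<n} \<Longrightarrow> i \<in> I \<Longrightarrow> act a i \<in> I"
    and e_closed: "i \<in> I \<Longrightarrow> e i \<in> carrier A"
    and y_closed: "a \<in> {1..n} \<Longrightarrow> y a \<in> carrier A"
    and psi_closed: "a \<in> {1..<n} \<Longrightarrow> psi a \<in> carrier A"
begin

text \<open>The factors that multiply \<open>e i\<close> on the right-hand sides of the relations for
  \<open>\<psi>\<^sub>a y\<^sub>a\<^sub>+\<^sub>1\<close>, \<open>\<psi>\<^sub>a\<^sup>2\<close> and \<open>\<psi>\<^sub>a\<^sub>+\<^sub>1 \<psi>\<^sub>a \<psi>\<^sub>a\<^sub>+\<^sub>1\<close>.\<close>

definition delta :: "nat \<Rightarrow> (nat \<Rightarrow> 'k) \<Rightarrow> 'a"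
  where "delta a r = (if r a = r (a + 1) then \<one> else \<zero>)"

definition square :: "nat \<Rightarrow> (nat \<Rightarrow> 'k) \<Rightarrow> 'a"
  where "square a r =
    (if r a = r (a + 1) then \<zero>
     else if q_none \<Gamma> (r a) (r (a + 1)) then \<one>
     else if q_to \<Gamma> (r a) (r (a + 1)) then y (a + 1) \<ominus> y a
     else if q_to \<Gamma> (r (a + 1)) (r a) then y a \<ominus> y (a + 1)
     else (y (a + 1) \<ominus> y a) \<otimes> (y a \<ominus> y (a + 1)))"

definition braid :: "nat \<Rightarrow> (nat \<Rightarrow> 'k) \<Rightarrow> 'a"
  where "braid a r =
    (if r (a + 2) = r a \<and> q_to \<Gamma> (r a) (r (a + 1)) then \<ominus> \<one>
     else if r (a + 2) = r a \<and> q_to \<Gamma> (r (a + 1)) (r a) then \<one>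
     else if r (a + 2) = r a \<and> q_both \<Gamma> (r a) (r (a + 1))
       then 2 \<odot> y (a + 1) \<ominus> y a \<ominus> y (a + 2)
     else \<zero>)"

lemma delta_closed: "delta a r \<in> carrier A"
  by (simp add: delta_def)

lemma square_closed: "a \<in> {1..<n} \<Longrightarrow> square a r \<in> carrier A"
  using y_closed[of a] y_closed[of "a + 1"] by (simp add: square_def)

lemma braid_closed: "1 \<le> a \<Longrightarrow> a + 2 \<le> n \<Longrightarrow> braid a r \<in> carrier A"
  using y_closed[of a] y_closed[of "a + 1"] y_closed[of "a + 2"] by (simp add: braid_def)

text \<open>Every case distinction is collected in a single coefficient in front of
  \<open>e i\<close>. From here on the relations can be handled without splitting into the shapes of
  the quiver.\<close>

lemma klr_relations_subset_Id:
  "klr_relations A \<Gamma> n I rep act e y psi \<subseteq> Id \<longleftrightarrow>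
    (\<Oplus>i\<in>I. e i) = \<one> \<and>
    (\<forall>i j. i \<in> I \<and> j \<in> I \<longrightarrow> e i \<otimes> e j = (if i = j then e i else \<zero>)) \<and>
    (\<forall>a i. a \<in> {1..n} \<and> i \<in> I \<longrightarrow> y a \<otimes> e i = e i \<otimes> y a) \<and>
    (\<forall>a i. a \<in> {1..<n} \<and> i \<in> I \<longrightarrow> psi a \<otimes> e i = e (act a i) \<otimes> psi a) \<and>
    (\<forall>a b. a \<in> {1..n} \<and> b \<in> {1..n} \<longrightarrow> y a \<otimes> y b = y b \<otimes> y a) \<and>
    (\<forall>a b. a \<in> {1..<n} \<and> b \<in> {1..n} \<and> b \<noteq> a \<and> b \<noteq> a + 1 \<longrightarrow> psi a \<otimes> y b = y b \<otimes> psi a) \<and>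
    (\<forall>a b. a \<in> {1..<n} \<and> b \<in> {1..<n} \<and> \<bar>int a - int b\<bar> > 1 \<longrightarrow> psi a \<otimes> psi b = psi b \<otimes> psi a) \<and>
    (\<forall>a i. a \<in> {1..<n} \<and> i \<in> I \<longrightarrow>
      psi a \<otimes> y (a + 1) \<otimes> e i = (y a \<otimes> psi a \<oplus> delta a (rep i)) \<otimes> e i) \<and>
    (\<forall>a i. a \<in> {1..<n} \<and> i \<in> I \<longrightarrow>
      y (a + 1) \<otimes> psi a \<otimes> e i = (psi a \<otimes> y a \<oplus> delta a (rep i)) \<otimes> e i) \<and>
    (\<forall>a i. a \<in> {1..<n} \<and> i \<in> I \<longrightarrow> psi a \<otimes> psi a \<otimes> e i = square a (rep i) \<otimes> e i) \<and>
    (\<forall>a i. 1 \<le> a \<and> a + 2 \<le> n \<and> i \<in> I \<longrightarrow>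
      psi (a + 1) \<otimes> psi a \<otimes> psi (a + 1) \<otimes> e i =
      (psi a \<otimes> psi (a + 1) \<otimes> psi a \<oplus> braid a (rep i)) \<otimes> e i)"
  unfolding klr_relations_def Un_subset_iff subset_Id_compr conj_assoc
proof (intro conj_cong all_imp_cong2)
  show "({(\<Oplus>i\<in>I. e i, \<one>)} \<subseteq> Id) = ((\<Oplus>i\<in>I. e i) = \<one>)"
    by simp
next
  fix a i assume ai: "a \<in> {1..<n} \<and> i \<in> I"
  note c = y_closed[of a] y_closed[of "a + 1"] psi_closed[of a] e_closed[of i]
  have "(if rep i a = rep i (a + 1) then y a \<otimes> psi a \<oplus> \<one> else y a \<otimes> psi a) =
      y a \<otimes> psi a \<oplus> delta a (rep i)"
    using ai c by (simp add: delta_def)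
  then show "(psi a \<otimes> y (a + 1) \<otimes> e i =
      (if rep i a = rep i (a + 1) then y a \<otimes> psi a \<oplus> \<one> else y a \<otimes> psi a) \<otimes> e i) =
      (psi a \<otimes> y (a + 1) \<otimes> e i = (y a \<otimes> psi a \<oplus> delta a (rep i)) \<otimes> e i)"
    by simp
  have "(if rep i a = rep i (a + 1) then psi a \<otimes> y a \<oplus> \<one> else psi a \<otimes> y a) =
      psi a \<otimes> y a \<oplus> delta a (rep i)"
    using ai c by (simp add: delta_def)
  then show "(y (a + 1) \<otimes> psi a \<otimes> e i =
      (if rep i a = rep i (a + 1) then psi a \<otimes> y a \<oplus> \<one> else psi a \<otimes> y a) \<otimes> e i) =
      (y (a + 1) \<otimes> psi a \<otimes> e i = (psi a \<otimes> y a \<oplus> delta a (rep i)) \<otimes> e i)"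
    by simp
  show "(psi a \<otimes> psi a \<otimes> e i =
      (if rep i a = rep i (a + 1) then \<zero>
      else if q_none \<Gamma> (rep i a) (rep i (a + 1)) then e i
      else if q_to \<Gamma> (rep i a) (rep i (a + 1)) then (y (a + 1) \<ominus> y a) \<otimes> e i
      else if q_to \<Gamma> (rep i (a + 1)) (rep i a) then (y a \<ominus> y (a + 1)) \<otimes> e i
      else (y (a + 1) \<ominus> y a) \<otimes> (y a \<ominus> y (a + 1)) \<otimes> e i)) =
      (psi a \<otimes> psi a \<otimes> e i = square a (rep i) \<otimes> e i)"
    using ai c by (simp add: square_def)
next
  fix a i assume ai: "1 \<le> a \<and> a + 2 \<le> n \<and> i \<in> I"
  note c = psi_closed[of a] psi_closed[of "a + 1"]
  have "(if rep i (a + 2) = rep i a \<and> q_to \<Gamma> (rep i a) (rep i (a + 1))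
         then psi a \<otimes> psi (a + 1) \<otimes> psi a \<ominus> \<one>
       else if rep i (a + 2) = rep i a \<and> q_to \<Gamma> (rep i (a + 1)) (rep i a)
         then psi a \<otimes> psi (a + 1) \<otimes> psi a \<oplus> \<one>
       else if rep i (a + 2) = rep i a \<and> q_both \<Gamma> (rep i a) (rep i (a + 1))
         then psi a \<otimes> psi (a + 1) \<otimes> psi a \<oplus> (2 \<odot> y (a + 1) \<ominus> y a \<ominus> y (a + 2))
       else psi a \<otimes> psi (a + 1) \<otimes> psi a) = psi a \<otimes> psi (a + 1) \<otimes> psi a \<oplus> braid a (rep i)"
    using ai c by (simp add: braid_def a_minus_def)
  then show "(psi (a + 1) \<otimes> psi a \<otimes> psi (a + 1) \<otimes> e i =
      (if rep i (a + 2) = rep i a \<and> q_to \<Gamma> (rep i a) (rep i (a + 1))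
         then psi a \<otimes> psi (a + 1) \<otimes> psi a \<ominus> \<one>
       else if rep i (a + 2) = rep i a \<and> q_to \<Gamma> (rep i (a + 1)) (rep i a)
         then psi a \<otimes> psi (a + 1) \<otimes> psi a \<oplus> \<one>
       else if rep i (a + 2) = rep i a \<and> q_both \<Gamma> (rep i a) (rep i (a + 1))
         then psi a \<otimes> psi (a + 1) \<otimes> psi a \<oplus> (2 \<odot> y (a + 1) \<ominus> y a \<ominus> y (a + 2))
       else psi a \<otimes> psi (a + 1) \<otimes> psi a) \<otimes> e i) =
      (psi (a + 1) \<otimes> psi a \<otimes> psi (a + 1) \<otimes> e i =
      (psi a \<otimes> psi (a + 1) \<otimes> psi a \<oplus> braid a (rep i)) \<otimes> e i)"
    by simp
qed (rule refl)+

lemma klr_relations_carrier: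
  "klr_relations A \<Gamma> n I rep act e y psi \<subseteq> carrier A \<times> carrier A"
  unfolding klr_relations_def Un_subset_iff subset_Times_compr
  by (intro conjI allI impI)
    (simp_all add: y_closed psi_closed e_closed act_closed finsum_closed Pi_def)

end

text \<open>Both sides of every relation are built by algebra operations and case distinctions on
  indices. Hence relations in the free algebra can be transported to a quotient or along an
  evaluation.\<close>

lemma (in klr_elems) klr_relations_hom:
  assumes h: "h \<in> alg_hom A B" and B: "unital_algebra B"
  shows "klr_relations B \<Gamma> n I rep act (\<lambda>i. h (e i)) (\<lambda>a. h (y a)) (\<lambda>a. h (psi a)) =
    map_prod h h ` klr_relations A \<Gamma> n I rep act e y psi"
proof -
  note hs = alg_hom_add[OF h] alg_hom_mult[OF h] alg_hom_one[OF h] alg_hom_smult[OF h]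
    alg_hom_zero[OF h unital_algebra_axioms B] alg_hom_minus[OF h unital_algebra_axioms B]
    y_closed psi_closed e_closed act_closed
  have s: "(\<Oplus>\<^bsub>B\<^esub>i\<in>I. h (e i)) = h (\<Oplus>i\<in>I. e i)"
    by (rule alg_hom_finsum[OF h unital_algebra_axioms B finite_index, symmetric])
      (use e_closed in auto)
  show ?thesis
    unfolding klr_relations_def image_Un image_compr2
    by (intro arg_cong2[of _ _ _ _ "(\<union>)"] compr_cong2) (simp_all add: s hs)
qed

text \<open>Only admissible indices occur in the relations. This matters for evaluations, whose
  values are known on actual generators only.\<close>

lemma (in klr_elems) klr_relations_cong:
  assumes "\<And>i. i \<in> I \<Longrightarrow> e' i = e i" "\<And>a. a \<in> {1..n} \<Longrightarrow> y' a = y a"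
    and "\<And>a. a \<in> {1..<n} \<Longrightarrow> psi' a = psi a"
  shows "klr_relations A \<Gamma> n I rep act e' y' psi' = klr_relations A \<Gamma> n I rep act e y psi"
proof -
  have s: "(\<Oplus>i\<in>I. e' i) = (\<Oplus>i\<in>I. e i)"
    using assms e_closed by (intro finsum_cong') auto
  show ?thesis
    unfolding klr_relations_def
    by (intro arg_cong2[of _ _ _ _ "(\<union>)"] compr_cong2)
      (simp_all add: s assms act_closed cong: if_cong)
qed

locale klr_family = klr_elems +
  assumes klr_rels: "klr_relations A \<Gamma> n I rep act e y psi \<subseteq> Id"
begin

lemmas klr_rel = klr_rels[unfolded klr_relations_subset_Id]

lemma sum_e: "(\<Oplus>i\<in>I. e i) = \<one>"
  and e_e: "i \<in> I \<Longrightarrow> j \<in> I \<Longrightarrow> e i \<otimes> e j = (if i = j then e i else \<zero>)"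
  and y_e: "a \<in> {1..n} \<Longrightarrow> i \<in> I \<Longrightarrow> y a \<otimes> e i = e i \<otimes> y a"
  and psi_e: "a \<in> {1..<n} \<Longrightarrow> i \<in> I \<Longrightarrow> psi a \<otimes> e i = e (act a i) \<otimes> psi a"
  and y_y: "a \<in> {1..n} \<Longrightarrow> b \<in> {1..n} \<Longrightarrow> y a \<otimes> y b = y b \<otimes> y a"
  and psi_y: "a \<in> {1..<n} \<Longrightarrow> b \<in> {1..n} \<Longrightarrow> b \<noteq> a \<Longrightarrow> b \<noteq> a + 1 \<Longrightarrow>
    psi a \<otimes> y b = y b \<otimes> psi a"
  and psi_psi: "a \<in> {1..<n} \<Longrightarrow> b \<in> {1..<n} \<Longrightarrow> \<bar>int a - int b\<bar> > 1 \<Longrightarrow>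
    psi a \<otimes> psi b = psi b \<otimes> psi a"
  and psi_y_e: "a \<in> {1..<n} \<Longrightarrow> i \<in> I \<Longrightarrow>
    psi a \<otimes> y (a + 1) \<otimes> e i = (y a \<otimes> psi a \<oplus> delta a (rep i)) \<otimes> e i"
  and y_psi_e: "a \<in> {1..<n} \<Longrightarrow> i \<in> I \<Longrightarrow>
    y (a + 1) \<otimes> psi a \<otimes> e i = (psi a \<otimes> y a \<oplus> delta a (rep i)) \<otimes> e i"
  and psi_sq_e: "a \<in> {1..<n} \<Longrightarrow> i \<in> I \<Longrightarrow> psi a \<otimes> psi a \<otimes> e i = square a (rep i) \<otimes> e i"
  and psi_braid_e: "1 \<le> a \<Longrightarrow> a + 2 \<le> n \<Longrightarrow> i \<in> I \<Longrightarrow>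
    psi (a + 1) \<otimes> psi a \<otimes> psi (a + 1) \<otimes> e i =
    (psi a \<otimes> psi (a + 1) \<otimes> psi a \<oplus> braid a (rep i)) \<otimes> e i"
  using klr_rel by blast+

end

section \<open>The universal property of the quiver Hecke presentation\<close>

locale klr_index =
  fixes n :: nat and I :: "'i set" and act :: "nat \<Rightarrow> 'i \<Rightarrow> 'i"
  assumes finite_index: "finite I"
    and act_closed: "a \<in> {1..<n} \<Longrightarrow> i \<in> I \<Longrightarrow> act a i \<in> I"
begin

lemma free_klr_elems:
  "klr_elems (free_alg (klr_gens n I)) n I act
    (\<lambda>i. free_gen (E_gen i)) (\<lambda>a. free_gen (Y_gen a)) (\<lambda>a. free_gen (Psi_gen a))"
  by (intro klr_elems.intro free_alg_unital klr_elems_axioms.intro finite_index act_closed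
      free_gen_carrier) (auto simp: klr_gens_def)

lemma klr_presentation: "presentation (klr_gens n I) (klr_free_relations \<Gamma> n I rep act)"
  unfolding klr_free_relations_def
  by (rule presentation.intro) (rule klr_elems.klr_relations_carrier[OF free_klr_elems])

lemma klr_presented_family:
  fixes \<Gamma> :: "'k rel" and rep :: "'i \<Rightarrow> nat \<Rightarrow> 'k"
  defines "G \<equiv> klr_gens n I"
  defines "S \<equiv> klr_free_relations \<Gamma> n I rep act :: (('i klr_gen list \<Rightarrow> 'f::field) \<times> _) set"
  shows "klr_family (presented_alg G S) \<Gamma> n I rep act (\<lambda>i. presented_gen G S (E_gen i))
    (\<lambda>a. presented_gen G S (Y_gen a)) (\<lambda>a. presented_gen G S (Psi_gen a))"
proof -
  interpret presentation G S
    unfolding G_def S_def by (rule klr_presentation)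
  let ?h = "\<lambda>x. rel_ideal G S +>\<^bsub>free_alg G\<^esub> x"
  interpret F: klr_elems "free_alg G" \<Gamma> n I rep act "\<lambda>i. free_gen (E_gen i)"
    "\<lambda>a. free_gen (Y_gen a)" "\<lambda>a. free_gen (Psi_gen a)"
    unfolding G_def by (rule free_klr_elems)
  have "klr_elems (presented_alg G S) n I act (\<lambda>i. presented_gen G S (E_gen i))
    (\<lambda>a. presented_gen G S (Y_gen a)) (\<lambda>a. presented_gen G S (Psi_gen a))"
    by (intro klr_elems.intro presented_unital klr_elems_axioms.intro finite_index act_closed
        presented_gen_closed) (auto simp: G_def klr_gens_def)
  moreover have "klr_relations (presented_alg G S) \<Gamma> n I rep act (\<lambda>i. presented_gen G S (E_gen i))
    (\<lambda>a. presented_gen G S (Y_gen a)) (\<lambda>a. presented_gen G S (Psi_gen a)) \<subseteq> Id"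
    unfolding presented_gen_def F.klr_relations_hom[OF presented_proj presented_unital]
    using presented_relation by (auto simp: S_def klr_free_relations_def G_def)
  ultimately show ?thesis
    by (intro klr_family.intro klr_family_axioms.intro)
qed

text \<open>A homomorphism out of the presented algebra amounts to a family in the target that
  satisfies the relations. It supplies the comparison maps between presented algebras and the action
  on families.\<close>

lemma klr_universal:
  fixes \<Gamma> :: "'k rel" and rep :: "'i \<Rightarrow> nat \<Rightarrow> 'k"
  defines "G \<equiv> klr_gens n I"
  defines "S \<equiv> klr_free_relations \<Gamma> n I rep act"
  assumes A: "klr_family A \<Gamma> n I rep act e y psi"
  obtains \<phi> where "\<phi> \<in> alg_hom (presented_alg G S) A"
    and "\<And>i. i \<in> I \<Longrightarrow> \<phi> (presented_gen G S (E_gen i)) = e i"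
    and "\<And>a. a \<in> {1..n} \<Longrightarrow> \<phi> (presented_gen G S (Y_gen a)) = y a"
    and "\<And>a. a \<in> {1..<n} \<Longrightarrow> \<phi> (presented_gen G S (Psi_gen a)) = psi a"
proof -
  interpret A: klr_family A \<Gamma> n I rep act e y psi by fact
  interpret presentation G S
    unfolding G_def S_def by (rule klr_presentation)
  interpret F: klr_elems "free_alg G" \<Gamma> n I rep act "\<lambda>i. free_gen (E_gen i)"
    "\<lambda>a. free_gen (Y_gen a)" "\<lambda>a. free_gen (Psi_gen a)"
    unfolding G_def by (rule free_klr_elems)
  define g where "g x = (case x of E_gen i \<Rightarrow> e i | Y_gen a \<Rightarrow> y a | Psi_gen a \<Rightarrow> psi a)" for x
  have g: "g \<in> G \<rightarrow> carrier A"
    using A.e_closed A.y_closed A.psi_closed by (auto simp: g_def G_def klr_gens_def)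
  let ?l = "free_lift A g"
  have lgen: "?l (free_gen x) = g x" if "x \<in> G" for x
    using g that by (auto intro: A.free_lift_gen)
  \<comment> \<open>The evaluated relations are the relations among the evaluated generators, and
    these hold in \<open>A\<close>.\<close>
  have "map_prod ?l ?l ` S \<subseteq> Id"
    unfolding S_def klr_free_relations_def G_def[symmetric]
      F.klr_relations_hom[OF A.free_lift_hom[OF g] A.unital_algebra_axioms, symmetric]
    using A.klr_rels lgen
    by (subst A.klr_relations_cong) (auto simp: g_def G_def klr_gens_def)
  then have "?l u = ?l v" if "(u, v) \<in> S" for u v
    using that by auto
  then obtain \<phi> where \<phi>: "\<phi> \<in> alg_hom (presented_alg G S) A"
      "\<And>x. x \<in> G \<Longrightarrow> \<phi> (presented_gen G S x) = g x"
    using presented_universal[OF A.unital_algebra_axioms g] by blast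
  show thesis
    using \<phi> by (intro that[of \<phi>]) (auto simp: g_def G_def klr_gens_def)
qed

end

section \<open>Coverings of index sets\<close>

lemma swap_at_swap_at [simp]: "swap_at a (swap_at a k) = k"
  by (simp add: swap_at_def comp_assoc)

lemma swap_at_commute:
  assumes "\<bar>int a - int b\<bar> > 1"
  shows "swap_at a (swap_at b k) = swap_at b (swap_at a k)"
  using assms by (auto simp: swap_at_def fun_eq_iff transpose_def)

lemma swap_at_braid:
  "swap_at (a + 1) (swap_at a (swap_at (a + 1) k)) = swap_at a (swap_at (a + 1) (swap_at a k))"
  by (auto simp: swap_at_def fun_eq_iff transpose_def)

text \<open>\<open>delta a k\<close> vanishes unless the premise holds, so it contributes only where
  the two sides of the relation between \<psi> and y lead to the same tuple.\<close>

lemma swap_at_fixed: "k a = k (a + 1) \<Longrightarrow> swap_at a k = k"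
  by (auto simp: swap_at_def fun_eq_iff transpose_def)

text \<open>The product of the three place permutations is the transposition of \<open>a\<close> and
  \<open>a + 2\<close>. \<open>braid a k\<close> vanishes unless the premise holds, so it too
  contributes only at tuples fixed by the permutation of the main terms.\<close>

lemma swap_at_conj_fixed:
  "k (a + 2) = k a \<Longrightarrow> swap_at a (swap_at (a + 1) (swap_at a k)) = k"
  by (auto simp: swap_at_def fun_eq_iff transpose_def)

text \<open>\<open>q\<close> carries tuples to the indices of another presentation. The last two
  assumptions say that the tuple \<open>rep (q k)\<close>, through which the cases at
  \<open>q k\<close> are decided, decides them as \<open>k\<close> itself does.\<close>

locale klr_cover =
  fixes \<Gamma> :: "'k rel" and n :: nat and T :: "(nat \<Rightarrow> 'k) set" and J :: "'j set"
    and rep :: "'j \<Rightarrow> nat \<Rightarrow> 'k" and act :: "nat \<Rightarrow> 'j \<Rightarrow> 'j" and q :: "(nat \<Rightarrow> 'k) \<Rightarrow> 'j"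
  assumes finite_T: "finite T" and finite_J: "finite J"
    and swap_T: "a \<in> {1..<n} \<Longrightarrow> k \<in> T \<Longrightarrow> swap_at a k \<in> T"
    and act_J: "a \<in> {1..<n} \<Longrightarrow> j \<in> J \<Longrightarrow> act a j \<in> J"
    and act_act: "a \<in> {1..<n} \<Longrightarrow> j \<in> J \<Longrightarrow> act a (act a j) = j"
    and q_J: "k \<in> T \<Longrightarrow> q k \<in> J"
    and q_swap: "a \<in> {1..<n} \<Longrightarrow> k \<in> T \<Longrightarrow> q (swap_at a k) = act a (q k)"
    and rep_eq: "k \<in> T \<Longrightarrow> a \<in> {1..n} \<Longrightarrow> b \<in> {1..n} \<Longrightarrow> rep (q k) a = rep (q k) b \<longleftrightarrow> k a = k b"
    and rep_edge: "k \<in> T \<Longrightarrow> a \<in> {1..n} \<Longrightarrow> b \<in> {1..n} \<Longrightarrow>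
      (rep (q k) a, rep (q k) b) \<in> \<Gamma> \<longleftrightarrow> (k a, k b) \<in> \<Gamma>"
begin

text \<open>The cases compare entries only for equality and for edges, which \<open>q\<close>
  respects. The family is arbitrary because the lemma serves families indexed by \<open>T\<close> as
  well as by \<open>J\<close>.\<close>

lemma coefficients_rep:
  assumes A: "klr_elems A n I act' e y psi" and k: "k \<in> T"
  shows "a \<in> {1..<n} \<Longrightarrow> klr_elems.delta A a (rep (q k)) = klr_elems.delta A a k"
    and "a \<in> {1..<n} \<Longrightarrow> klr_elems.square A \<Gamma> y a (rep (q k)) = klr_elems.square A \<Gamma> y a k"
    and "1 \<le> a \<Longrightarrow> a + 2 \<le> n \<Longrightarrow>
      klr_elems.braid A \<Gamma> y a (rep (q k)) = klr_elems.braid A \<Gamma> y a k"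
proof -
  interpret A: klr_elems A \<Gamma> n I "\<lambda>_. undefined" act' e y psi by fact
  show "A.delta a (rep (q k)) = A.delta a k" if "a \<in> {1..<n}"
    using that rep_eq[OF k, of a "a + 1"] by (simp add: A.delta_def)
  show "A.square a (rep (q k)) = A.square a k" if "a \<in> {1..<n}"
    using that rep_eq[OF k, of a "a + 1"] rep_edge[OF k, of a "a + 1"] rep_edge[OF k, of "a + 1" a]
    by (simp add: A.square_def q_none_def q_to_def)
  show "A.braid a (rep (q k)) = A.braid a k" if "1 \<le> a" "a + 2 \<le> n"
    using that rep_eq[OF k, of "a + 2" a] rep_edge[OF k, of a "a + 1"] rep_edge[OF k, of "a + 1" a]
    by (simp add: A.braid_def q_both_def q_to_def)
qed

definition fibre :: "'j \<Rightarrow> (nat \<Rightarrow> 'k) set"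
  where "fibre j = {k \<in> T. q k = j}"

text \<open>Pushing a family forward along \<open>q\<close>. Combined with the universal property,
  it gives a homomorphism from the algebra presented over \<open>J\<close> to the one presented over
  \<open>T\<close>, in the direction opposite to \<open>q\<close>.\<close>

lemma klr_family_push:
  assumes A: "klr_family A \<Gamma> n T (\<lambda>k. k) swap_at e y psi"
  shows "klr_family A \<Gamma> n J rep act (\<lambda>j. finsum A e (fibre j)) y psi"
proof -
  interpret A: klr_family A \<Gamma> n T "\<lambda>k. k" swap_at e y psi by fact
  let ?e = "\<lambda>j. finsum A e (fibre j)"
  have fin: "finite (fibre j)" for j
    using finite_T by (simp add: fibre_def)
  have fib: "fibre j \<subseteq> T" for j
    by (auto simp: fibre_def)
  have e: "e \<in> fibre j \<rightarrow> carrier A" for j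
    using A.e_closed fib by auto
  have e_closed: "?e j \<in> carrier A" for j
    using e by (rule A.finsum_closed)
  note cl = A.y_closed A.psi_closed A.e_closed
  interpret E: klr_elems A \<Gamma> n J rep act ?e y psi
    by unfold_locales (use finite_J act_J e_closed cl in auto)
  text \<open>A relation between multiples of \<open>e k\<close> whose coefficients depend only on \<open>q k\<close> can be
    summed over the fibres of \<open>q\<close>.\<close>
  have sum: "x \<otimes>\<^bsub>A\<^esub> ?e j = z \<otimes>\<^bsub>A\<^esub> ?e j"
    if "x \<in> carrier A" "z \<in> carrier A" "\<And>k. k \<in> fibre j \<Longrightarrow> x \<otimes>\<^bsub>A\<^esub> e k = z \<otimes>\<^bsub>A\<^esub> e k" for x z j
  proof -
    have "x \<otimes>\<^bsub>A\<^esub> ?e j = (\<Oplus>\<^bsub>A\<^esub>k\<in>fibre j. x \<otimes>\<^bsub>A\<^esub> e k)"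
      using that fin e by (simp add: A.finsum_rdistr)
    also have "\<dots> = (\<Oplus>\<^bsub>A\<^esub>k\<in>fibre j. z \<otimes>\<^bsub>A\<^esub> e k)"
      using that e by (intro A.finsum_cong') auto
    also have "\<dots> = z \<otimes>\<^bsub>A\<^esub> ?e j"
      using that fin e by (simp add: A.finsum_rdistr)
    finally show ?thesis .
  qed
  have rels: "klr_relations A \<Gamma> n J rep act ?e y psi \<subseteq> Id"
    unfolding E.klr_relations_subset_Id
  proof (intro conjI allI impI)
    have "(\<Oplus>\<^bsub>A\<^esub>j\<in>J. ?e j) = finsum A e (\<Union>j\<in>J. fibre j)"
      using finite_J fin e by (intro A.add.finprod_UN_disjoint[symmetric])
        (auto simp: pairwise_def disjnt_def fibre_def)
    also have "(\<Union>j\<in>J. fibre j) = T"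
      using q_J by (auto simp: fibre_def)
    finally show "(\<Oplus>\<^bsub>A\<^esub>j\<in>J. ?e j) = \<one>\<^bsub>A\<^esub>"
      by (simp add: A.sum_e)
  next
    fix i j assume ij: "i \<in> J \<and> j \<in> J"
    \<comment> \<open>By orthogonality a single \<open>e k\<close> meets at most one summand of a
      fibre sum.\<close>
    have 1: "e k \<otimes>\<^bsub>A\<^esub> ?e j = (if q k = j then e k else \<zero>\<^bsub>A\<^esub>)" if k: "k \<in> T" for k
    proof -
      have "e k \<otimes>\<^bsub>A\<^esub> ?e j = (\<Oplus>\<^bsub>A\<^esub>l\<in>fibre j. e k \<otimes>\<^bsub>A\<^esub> e l)"
        using k fin e cl by (simp add: A.finsum_rdistr)
      also have "\<dots> = (\<Oplus>\<^bsub>A\<^esub>l\<in>fibre j. if k = l then e l else \<zero>\<^bsub>A\<^esub>)"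
        using k e cl A.e_e by (intro A.finsum_cong') (auto simp: fibre_def)
      also have "\<dots> = (if k \<in> fibre j then e k else \<zero>\<^bsub>A\<^esub>)"
        using A.finsum_singleton[OF _ fin e, of k j]
        by (auto intro!: A.add.finprod_one_eqI)
      finally show ?thesis
        using k by (simp add: fibre_def)
    qed
    have "?e i \<otimes>\<^bsub>A\<^esub> ?e j = (\<Oplus>\<^bsub>A\<^esub>k\<in>fibre i. e k \<otimes>\<^bsub>A\<^esub> ?e j)"
      using fin e e_closed by (simp add: A.finsum_ldistr)
    also have "\<dots> = (\<Oplus>\<^bsub>A\<^esub>k\<in>fibre i. if i = j then e k else \<zero>\<^bsub>A\<^esub>)"
      using 1 cl by (intro A.finsum_cong') (auto simp: fibre_def)
    also have "\<dots> = (if i = j then ?e i else \<zero>\<^bsub>A\<^esub>)"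
      by simp
    finally show "?e i \<otimes>\<^bsub>A\<^esub> ?e j = (if i = j then ?e i else \<zero>\<^bsub>A\<^esub>)" .
  next
    fix a j assume aj: "a \<in> {1..n} \<and> j \<in> J"
    have "y a \<otimes>\<^bsub>A\<^esub> ?e j = (\<Oplus>\<^bsub>A\<^esub>k\<in>fibre j. y a \<otimes>\<^bsub>A\<^esub> e k)"
      using aj cl fin e by (simp add: A.finsum_rdistr)
    also have "\<dots> = (\<Oplus>\<^bsub>A\<^esub>k\<in>fibre j. e k \<otimes>\<^bsub>A\<^esub> y a)"
      using aj A.y_e cl by (intro A.finsum_cong') (auto simp: fibre_def)
    also have "\<dots> = ?e j \<otimes>\<^bsub>A\<^esub> y a"
      using aj cl fin e by (simp add: A.finsum_ldistr)
    finally show "y a \<otimes>\<^bsub>A\<^esub> ?e j = ?e j \<otimes>\<^bsub>A\<^esub> y a" .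
  next
    fix a j assume aj: "a \<in> {1..<n} \<and> j \<in> J"
    then have a: "a \<in> {1..<n}" by blast
    \<comment> \<open>Both actions are involutions and \<open>q\<close> intertwines them, so
      \<open>swap_at a\<close> exchanges the fibres over \<open>j\<close> and over
      \<open>act a j\<close>.\<close>
    have img: "fibre (act a j) = swap_at a ` fibre j"
    proof (intro equalityI subsetI)
      fix k assume "k \<in> fibre (act a j)"
      then have "swap_at a k \<in> fibre j"
        using aj act_act swap_T q_swap by (auto simp: fibre_def)
      then show "k \<in> swap_at a ` fibre j"
        by (metis image_eqI swap_at_swap_at)
    qed (use a q_swap swap_T in \<open>auto simp: fibre_def\<close>)
    have inj: "inj_on (swap_at a) (fibre j)"
      by (metis inj_onI swap_at_swap_at)
    have "psi a \<otimes>\<^bsub>A\<^esub> ?e j = (\<Oplus>\<^bsub>A\<^esub>k\<in>fibre j. psi a \<otimes>\<^bsub>A\<^esub> e k)"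
      using aj cl fin e by (simp add: A.finsum_rdistr)
    also have "\<dots> = (\<Oplus>\<^bsub>A\<^esub>k\<in>fibre j. e (swap_at a k) \<otimes>\<^bsub>A\<^esub> psi a)"
      using a A.psi_e cl swap_T by (intro A.finsum_cong') (auto simp: fibre_def)
    also have "\<dots> = (\<Oplus>\<^bsub>A\<^esub>k\<in>fibre (act a j). e k \<otimes>\<^bsub>A\<^esub> psi a)"
      unfolding img using a cl fib[of j] swap_T
      by (intro A.finsum_reindex[symmetric] inj) auto
    also have "\<dots> = ?e (act a j) \<otimes>\<^bsub>A\<^esub> psi a"
      using a cl fin e by (simp add: A.finsum_ldistr)
    finally show "psi a \<otimes>\<^bsub>A\<^esub> ?e j = ?e (act a j) \<otimes>\<^bsub>A\<^esub> psi a" .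
  next
    fix a j assume aj: "a \<in> {1..<n} \<and> j \<in> J"
    then have a: "a \<in> {1..<n}" "a \<in> {1..n}" "a + 1 \<in> {1..n}" by auto
    note c = coefficients_rep[OF A.klr_elems_axioms]
    show "psi a \<otimes>\<^bsub>A\<^esub> y (a + 1) \<otimes>\<^bsub>A\<^esub> ?e j = (y a \<otimes>\<^bsub>A\<^esub> psi a \<oplus>\<^bsub>A\<^esub> A.delta a (rep j)) \<otimes>\<^bsub>A\<^esub> ?e j"
      by (rule sum) (use a cl A.delta_closed A.psi_y_e[OF a(1)] c(1)[OF _ a(1)] in
          \<open>auto simp: fibre_def simp del: One_nat_def add_Suc_right\<close>)
    show "y (a + 1) \<otimes>\<^bsub>A\<^esub> psi a \<otimes>\<^bsub>A\<^esub> ?e j = (psi a \<otimes>\<^bsub>A\<^esub> y a \<oplus>\<^bsub>A\<^esub> A.delta a (rep j)) \<otimes>\<^bsub>A\<^esub> ?e j"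
      by (rule sum) (use a cl A.delta_closed A.y_psi_e[OF a(1)] c(1)[OF _ a(1)] in
          \<open>auto simp: fibre_def simp del: One_nat_def add_Suc_right\<close>)
    show "psi a \<otimes>\<^bsub>A\<^esub> psi a \<otimes>\<^bsub>A\<^esub> ?e j = A.square a (rep j) \<otimes>\<^bsub>A\<^esub> ?e j"
      by (rule sum) (use a cl A.square_closed[OF a(1)] A.psi_sq_e[OF a(1)] c(2)[OF _ a(1)] in
          \<open>auto simp: fibre_def\<close>)
  next
    fix a j assume aj: "1 \<le> a \<and> a + 2 \<le> n \<and> j \<in> J"
    then have a: "1 \<le> a" "a + 2 \<le> n" "a \<in> {1..<n}" "a + 1 \<in> {1..<n}" by auto
    note c = coefficients_rep(3)[OF A.klr_elems_axioms _ a(1,2)]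
    show "psi (a + 1) \<otimes>\<^bsub>A\<^esub> psi a \<otimes>\<^bsub>A\<^esub> psi (a + 1) \<otimes>\<^bsub>A\<^esub> ?e j =
      (psi a \<otimes>\<^bsub>A\<^esub> psi (a + 1) \<otimes>\<^bsub>A\<^esub> psi a \<oplus>\<^bsub>A\<^esub> A.braid a (rep j)) \<otimes>\<^bsub>A\<^esub> ?e j"
      by (rule sum) (use a(3,4) cl A.braid_closed[OF a(1,2)] A.psi_braid_e[OF a(1,2)] c in
          \<open>auto simp: fibre_def simp del: One_nat_def add_Suc_right\<close>)
  qed (use A.y_y A.psi_y A.psi_psi in auto)
  show ?thesis
    by (intro klr_family.intro E.klr_elems_axioms klr_family_axioms.intro rels)
qed

end

lemma (in lin_space) minus_smult: "x \<in> carrier V \<Longrightarrow> y \<in> carrier V \<Longrightarrow> x \<ominus> y = x \<oplus> (- 1) \<odot> y"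
  by (simp add: a_minus_def smult_uminus_one)

section \<open>The representation attached to a covering\<close>

locale klr_cover_rep = klr_cover \<Gamma> n T J rep act q + B: klr_family B \<Gamma> n J rep act e y psi
  for \<Gamma> :: "'k rel" and n T and J :: "'j set" and rep act q
    and B :: "('f::field, 'b) module" (structure) and e y psi
begin

text \<open>Since \<open>e (q k)\<close> is idempotent, the condition says that \<open>v k\<close>
  lies in the right ideal generated by \<open>e (q k)\<close>. As a fixed-point equation it is
  visibly linear.\<close>

definition V :: "('f, (nat \<Rightarrow> 'k) \<Rightarrow> 'b) module"
  where "V = (prod_alg T (\<lambda>_. B))\<lparr>carrier := {v \<in> T \<rightarrow>\<^sub>E carrier B. \<forall>k\<in>T. e (q k) \<otimes> v k = v k}\<rparr>"

definition E :: "(nat \<Rightarrow> 'k) \<Rightarrow> ((nat \<Rightarrow> 'k) \<Rightarrow> 'b) \<Rightarrow> (nat \<Rightarrow> 'k) \<Rightarrow> 'b"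
  where "E k = (\<lambda>v\<in>carrier V. \<lambda>i\<in>T. if i = k then v i else \<zero>)"

definition Y :: "nat \<Rightarrow> ((nat \<Rightarrow> 'k) \<Rightarrow> 'b) \<Rightarrow> (nat \<Rightarrow> 'k) \<Rightarrow> 'b"
  where "Y a = (\<lambda>v\<in>carrier V. \<lambda>i\<in>T. y a \<otimes> v i)"

definition Psi :: "nat \<Rightarrow> ((nat \<Rightarrow> 'k) \<Rightarrow> 'b) \<Rightarrow> (nat \<Rightarrow> 'k) \<Rightarrow> 'b"
  where "Psi a = (\<lambda>v\<in>carrier V. \<lambda>i\<in>T. psi a \<otimes> v (swap_at a i))"

lemma V_simps:
  "carrier V = {v \<in> T \<rightarrow>\<^sub>E carrier B. \<forall>k\<in>T. e (q k) \<otimes> v k = v k}"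
  "zero V = (\<lambda>i\<in>T. \<zero>)"
  "add V = (\<lambda>v w. \<lambda>i\<in>T. v i \<oplus> w i)"
  "smult V = (\<lambda>c v. \<lambda>i\<in>T. c \<odot> v i)"
  by (simp_all add: V_def prod_alg_def)

lemma V_closed: "v \<in> carrier V \<Longrightarrow> i \<in> T \<Longrightarrow> v i \<in> carrier B"
  by (auto simp: V_simps)

lemma V_e: "v \<in> carrier V \<Longrightarrow> i \<in> T \<Longrightarrow> e (q i) \<otimes> v i = v i"
  by (auto simp: V_simps)

lemma eq_closed: "i \<in> T \<Longrightarrow> e (q i) \<in> carrier B"
  using B.e_closed q_J by blast

lemma V_lin_space: "lin_space V"
  using eq_closed B.smult_zero_left
  by (intro lin_spaceI)
    (auto simp: V_simps PiE_iff fun_eq_iff extensional_def B.r_distr B.smult_mult_right[symmetric]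
      B.a_ac B.lin_simps)

sublocale V: lin_space V by (rule V_lin_space)

sublocale M: unital_algebra "end_alg V" by (rule end_alg_unital) (rule V_lin_space)

lemma end_V_intro:
  assumes "\<And>v. v \<in> carrier V \<Longrightarrow> g v \<in> carrier V"
    and "\<And>v w. v \<in> carrier V \<Longrightarrow> w \<in> carrier V \<Longrightarrow> g (v \<oplus>\<^bsub>V\<^esub> w) = g v \<oplus>\<^bsub>V\<^esub> g w"
    and "\<And>c v. v \<in> carrier V \<Longrightarrow> g (c \<odot>\<^bsub>V\<^esub> v) = c \<odot>\<^bsub>V\<^esub> g v"
  shows "restrict g (carrier V) \<in> carrier (end_alg V)"
  using assms by (simp add: end_alg_def)

lemma E_closed: "k \<in> T \<Longrightarrow> E k \<in> carrier (end_alg V)"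
  unfolding E_def using eq_closed
  by (intro end_V_intro) (auto simp: V_simps PiE_iff fun_eq_iff)

lemma Y_closed: "a \<in> {1..n} \<Longrightarrow> Y a \<in> carrier (end_alg V)"
proof -
  assume a: "a \<in> {1..n}"
  have "e (q i) \<otimes> (y a \<otimes> x) = y a \<otimes> x"
    if "i \<in> T" "x \<in> carrier B" "e (q i) \<otimes> x = x" for i x
    using B.y_e[OF a q_J[OF that(1)]] that B.y_closed[OF a] eq_closed
    by (metis B.m_assoc)
  then show ?thesis
    unfolding Y_def using a B.y_closed[OF a]
    by (intro end_V_intro) (auto simp: V_simps PiE_iff fun_eq_iff B.r_distr B.smult_mult_right)
qed

text \<open>By \<open>psi_e\<close> and \<open>q_swap\<close>, left multiplication by
  \<open>psi a\<close> carries the right ideal of \<open>e (q (swap_at a i))\<close> into that of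
  \<open>e (q i)\<close>. This is why component \<open>i\<close> is fed from component
  \<open>swap_at a i\<close>.\<close>

lemma Psi_closed: "a \<in> {1..<n} \<Longrightarrow> Psi a \<in> carrier (end_alg V)"
proof -
  assume a: "a \<in> {1..<n}"
  have "e (q i) \<otimes> (psi a \<otimes> x) = psi a \<otimes> x"
    if "i \<in> T" "x \<in> carrier B" "e (q (swap_at a i)) \<otimes> x = x" for i x
  proof -
    have "psi a \<otimes> e (q (swap_at a i)) = e (q i) \<otimes> psi a"
      using B.psi_e[OF a q_J[OF swap_T[OF a that(1)]]] q_swap[OF a swap_T[OF a that(1)]] by simp
    then show ?thesis
      using that B.psi_closed[OF a] eq_closed swap_T[OF a] by (metis B.m_assoc)
  qed
  then show ?thesis
    unfolding Psi_def using B.psi_closed[OF a] swap_T[OF a]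
    by (intro end_V_intro) (auto simp: V_simps PiE_iff fun_eq_iff B.r_distr B.smult_mult_right)
qed

lemma V_finsum:
  assumes "finite S" "f \<in> S \<rightarrow> carrier V" "i \<in> T"
  shows "finsum V f S i = (\<Oplus>s\<in>S. f s i)"
  using assms
proof (induction S)
  case empty
  then show ?case by (simp add: V_simps)
next
  case (insert s S)
  then have "f \<in> S \<rightarrow> carrier V" "f s \<in> carrier V"
    by auto
  moreover from this have "(\<lambda>s. f s i) \<in> S \<rightarrow> carrier B" "f s i \<in> carrier B"
    using V_closed insert.prems(2) by (auto simp: Pi_iff)
  ultimately show ?case
    using insert by (simp add: V.finsum_insert B.finsum_insert) (simp add: V_simps)
qed

lemma E_apply: "v \<in> carrier V \<Longrightarrow> i \<in> T \<Longrightarrow> E k v i = (if i = k then v i else \<zero>)"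
  and Y_apply: "v \<in> carrier V \<Longrightarrow> i \<in> T \<Longrightarrow> Y a v i = y a \<otimes> v i"
  and Psi_apply: "v \<in> carrier V \<Longrightarrow> i \<in> T \<Longrightarrow> Psi a v i = psi a \<otimes> v (swap_at a i)"
  by (simp_all add: E_def Y_def Psi_def)

lemma end_V_apply:
  "v \<in> carrier V \<Longrightarrow> (f \<otimes>\<^bsub>end_alg V\<^esub> g) v = f (g v)"
  "v \<in> carrier V \<Longrightarrow> i \<in> T \<Longrightarrow> (f \<oplus>\<^bsub>end_alg V\<^esub> g) v i = f v i \<oplus> g v i"
  "v \<in> carrier V \<Longrightarrow> i \<in> T \<Longrightarrow> (c \<odot>\<^bsub>end_alg V\<^esub> f) v i = c \<odot> f v i"
  "v \<in> carrier V \<Longrightarrow> i \<in> T \<Longrightarrow> \<zero>\<^bsub>end_alg V\<^esub> v i = \<zero>"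
  "v \<in> carrier V \<Longrightarrow> \<one>\<^bsub>end_alg V\<^esub> v = v"
  by (simp_all add: end_alg_simps V_simps)

lemma end_V_minus:
  "f \<in> carrier (end_alg V) \<Longrightarrow> g \<in> carrier (end_alg V) \<Longrightarrow> v \<in> carrier V \<Longrightarrow> i \<in> T \<Longrightarrow>
    (f \<ominus>\<^bsub>end_alg V\<^esub> g) v i = f v i \<ominus> g v i"
  using end_alg_mem[THEN V_closed] by (simp add: M.minus_smult B.minus_smult end_V_apply)

text \<open>Operators are extensional on \<open>V\<close> and families are extensional on
  \<open>T\<close>; with both layers removed, an identity of operators is checked one component at a
  time.\<close>

lemma end_V_ext:
  assumes "f \<in> carrier (end_alg V)" "g \<in> carrier (end_alg V)"
    and "\<And>v i. v \<in> carrier V \<Longrightarrow> i \<in> T \<Longrightarrow> f v i = g v i"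
  shows "f = g"
proof (rule extensionalityI)
  show "f \<in> extensional (carrier V)" "g \<in> extensional (carrier V)"
    using assms(1,2) by (auto simp: end_alg_def PiE_iff)
  fix v assume v: "v \<in> carrier V"
  have "f v \<in> carrier V" "g v \<in> carrier V"
    using assms(1,2) v by (auto simp: end_alg_def)
  then have "f v \<in> extensional T" "g v \<in> extensional T"
    by (auto simp: V_simps PiE_iff)
  then show "f v = g v"
    using assms(3)[OF v] by (rule extensionalityI)
qed

sublocale R: klr_elems "end_alg V" \<Gamma> n T "\<lambda>k. k" swap_at E Y Psi
  by unfold_locales (use finite_T swap_T E_closed Y_closed Psi_closed in auto)

text \<open>The coefficients are polynomials in the y, which act componentwise. So the operator
  version of a coefficient is, on each component, left multiplication by its version in
  \<open>B\<close>; likewise for \<open>square\<close> and \<open>braid\<close>.\<close>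

lemma delta_apply: "v \<in> carrier V \<Longrightarrow> i \<in> T \<Longrightarrow> R.delta a r v i = B.delta a r \<otimes> v i"
  using V_closed by (simp add: R.delta_def B.delta_def end_V_apply)

lemma square_apply:
  assumes v: "v \<in> carrier V" and i: "i \<in> T" and a: "a \<in> {1..<n}"
  shows "R.square a r v i = B.square a r \<otimes> v i"
proof -
  have yc: "y a \<in> carrier B" "y (a + 1) \<in> carrier B" "Y a \<in> carrier (end_alg V)"
      "Y (a + 1) \<in> carrier (end_alg V)"
    using a B.y_closed Y_closed by auto
  have minus: "(Y b \<ominus>\<^bsub>end_alg V\<^esub> Y c) w i = (y b \<ominus> y c) \<otimes> w i"
    if "w \<in> carrier V" "b \<in> {a, a + 1}" "c \<in> {a, a + 1}" for w b c
    using that i yc V_closed[OF that(1) i]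
    by (auto simp: end_V_minus Y_apply B.minus_smult B.l_distr B.smult_mult_left simp del: add_Suc_right)
  have "(Y a \<ominus>\<^bsub>end_alg V\<^esub> Y (a + 1)) v \<in> carrier V"
    using end_alg_mem[OF M.minus_closed[OF yc(3,4)] v] .
  then show ?thesis
    using minus v i yc V_closed[OF v i]
    by (simp add: R.square_def B.square_def end_V_apply B.m_assoc del: add_Suc_right)
qed

lemma braid_apply:
  assumes v: "v \<in> carrier V" and i: "i \<in> T" and a: "1 \<le> a" "a + 2 \<le> n"
  shows "R.braid a r v i = B.braid a r \<otimes> v i"
proof -
  have yc: "y a \<in> carrier B" "y (a + 1) \<in> carrier B" "y (a + 2) \<in> carrier B"
      "Y a \<in> carrier (end_alg V)" "Y (a + 1) \<in> carrier (end_alg V)" "Y (a + 2) \<in> carrier (end_alg V)"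
    using a B.y_closed Y_closed by auto
  have one: "(\<ominus>\<^bsub>end_alg V\<^esub> \<one>\<^bsub>end_alg V\<^esub>) v i = \<ominus> \<one> \<otimes> v i"
    using v i V_closed[OF v i]
    by (simp add: M.smult_uminus_one[symmetric] B.smult_uminus_one[symmetric] end_V_apply
        B.smult_mult_left[symmetric])
  have "(2 \<odot>\<^bsub>end_alg V\<^esub> Y (a + 1) \<ominus>\<^bsub>end_alg V\<^esub> Y a \<ominus>\<^bsub>end_alg V\<^esub> Y (a + 2)) v i =
      (2 \<odot> y (a + 1) \<ominus> y a \<ominus> y (a + 2)) \<otimes> v i"
    using v i yc V_closed[OF v i]
    by (simp add: end_V_minus end_V_apply Y_apply B.minus_smult B.l_distr B.smult_mult_left
        del: add_Suc_right)
  then show ?thesis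
    using one v i V_closed[OF v i] by (simp add: R.braid_def B.braid_def end_V_apply)
qed

text \<open>The bridge from relations to modules: as \<open>v k = e (q k) \<otimes> v k\<close>, an
  identity that holds in front of \<open>e (q k)\<close> may be applied to
  \<open>v k\<close>.\<close>

lemma V_relation:
  assumes "x \<otimes> e (q k) = z \<otimes> e (q k)" "x \<in> carrier B" "z \<in> carrier B" "v \<in> carrier V" "k \<in> T"
  shows "x \<otimes> v k = z \<otimes> v k"
  using assms V_e[OF assms(4,5)] V_closed[OF assms(4,5)] eq_closed[OF assms(5)]
  by (metis B.m_assoc)

text \<open>After \<open>E k\<close> only the component \<open>v k\<close> survives. The main terms
  of a relation deposit it at a permuted tuple, the correction term leaves it at \<open>k\<close>;
  the coefficient of the correction is zero whenever these places differ. Where they agree, the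
  identity is a relation of \<open>B\<close> applied to \<open>v k\<close>.\<close>

lemma klr_family_rep: "klr_family (end_alg V) \<Gamma> n T (\<lambda>k. k) swap_at E Y Psi"
proof (intro klr_family.intro R.klr_elems_axioms klr_family_axioms.intro)
  note cl = B.y_closed B.psi_closed E_closed Y_closed Psi_closed V_closed swap_T
  note mem = E_closed[THEN end_alg_mem] Y_closed[THEN end_alg_mem] Psi_closed[THEN end_alg_mem]
  note ap = end_V_apply E_apply Y_apply Psi_apply delta_apply square_apply braid_apply
  show "klr_relations (end_alg V) \<Gamma> n T (\<lambda>k. k) swap_at E Y Psi \<subseteq> Id"
    unfolding R.klr_relations_subset_Id
  proof (intro conjI allI impI; (elim conjE)?)
    show "(\<Oplus>\<^bsub>end_alg V\<^esub>k\<in>T. E k) = \<one>\<^bsub>end_alg V\<^esub>"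
    proof (rule end_V_ext)
      fix v i assume v: "v \<in> carrier V" and i: "i \<in> T"
      have "(\<Oplus>\<^bsub>end_alg V\<^esub>k\<in>T. E k) v = (\<Oplus>\<^bsub>V\<^esub>k\<in>T. E k v)"
        using v E_closed by (intro end_alg_finsum V_lin_space finite_T) auto
      then have "(\<Oplus>\<^bsub>end_alg V\<^esub>k\<in>T. E k) v i = (\<Oplus>k\<in>T. E k v i)"
        using V_finsum[OF finite_T _ i, of "\<lambda>k. E k v"] mem(1) v by (simp add: Pi_iff)
      also have "\<dots> = (\<Oplus>k\<in>T. if i = k then v k else \<zero>)"
        using v i V_closed by (intro B.finsum_cong') (auto simp: E_apply)
      also have "\<dots> = v i"
        using v i V_closed finite_T by (intro B.finsum_singleton) auto
      finally show "(\<Oplus>\<^bsub>end_alg V\<^esub>k\<in>T. E k) v i = \<one>\<^bsub>end_alg V\<^esub> v i"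
        using v by (simp add: end_V_apply)
    qed (use E_closed in \<open>auto intro!: M.finsum_closed\<close>)
  next
    fix k l assume "k \<in> T" "l \<in> T"
    then show "E k \<otimes>\<^bsub>end_alg V\<^esub> E l = (if k = l then E k else \<zero>\<^bsub>end_alg V\<^esub>)"
      by (intro end_V_ext) (auto simp: ap mem E_closed)
  next
    fix a k assume "a \<in> {1..n}" "k \<in> T"
    then show "Y a \<otimes>\<^bsub>end_alg V\<^esub> E k = E k \<otimes>\<^bsub>end_alg V\<^esub> Y a"
      using cl by (intro end_V_ext) (auto simp: ap mem)
  next
    fix a k assume a: "a \<in> {1..<n}" and k: "k \<in> T"
    show "Psi a \<otimes>\<^bsub>end_alg V\<^esub> E k = E (swap_at a k) \<otimes>\<^bsub>end_alg V\<^esub> Psi a"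
    proof (rule end_V_ext)
      fix v i assume v: "v \<in> carrier V" and i: "i \<in> T"
      have "swap_at a i = k \<longleftrightarrow> i = swap_at a k"
        by auto
      then show "(Psi a \<otimes>\<^bsub>end_alg V\<^esub> E k) v i = (E (swap_at a k) \<otimes>\<^bsub>end_alg V\<^esub> Psi a) v i"
        using v i a k cl by (auto simp: ap mem)
    qed (use a k cl in auto)
  next
    fix a b assume "a \<in> {1..n}" "b \<in> {1..n}"
    then show "Y a \<otimes>\<^bsub>end_alg V\<^esub> Y b = Y b \<otimes>\<^bsub>end_alg V\<^esub> Y a"
      using cl B.y_y[of a b] by (intro end_V_ext) (auto simp: ap mem B.m_assoc[symmetric])
  next
    fix a b assume "a \<in> {1..<n}" "b \<in> {1..n}" "b \<noteq> a" "b \<noteq> a + 1"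
    then show "Psi a \<otimes>\<^bsub>end_alg V\<^esub> Y b = Y b \<otimes>\<^bsub>end_alg V\<^esub> Psi a"
      using cl B.psi_y[of a b] by (intro end_V_ext) (auto simp: ap mem B.m_assoc[symmetric])
  next
    fix a b assume a: "a \<in> {1..<n}" and b: "b \<in> {1..<n}" and ab: "1 < \<bar>int a - int b\<bar>"
    show "Psi a \<otimes>\<^bsub>end_alg V\<^esub> Psi b = Psi b \<otimes>\<^bsub>end_alg V\<^esub> Psi a"
    proof (rule end_V_ext)
      fix v i assume v: "v \<in> carrier V" and i: "i \<in> T"
      have T: "swap_at a i \<in> T" "swap_at b i \<in> T" "swap_at b (swap_at a i) \<in> T"
        using swap_T a b i by auto
      have "(Psi a \<otimes>\<^bsub>end_alg V\<^esub> Psi b) v i = psi a \<otimes> psi b \<otimes> v (swap_at b (swap_at a i))"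
        using v i T a b by (simp add: ap mem B.m_assoc cl)
      also have "\<dots> = psi b \<otimes> psi a \<otimes> v (swap_at a (swap_at b i))"
        by (simp only: B.psi_psi[OF a b ab] swap_at_commute[OF ab])
      also have "\<dots> = (Psi b \<otimes>\<^bsub>end_alg V\<^esub> Psi a) v i"
        using v i T a b swap_T by (simp add: ap mem B.m_assoc cl)
      finally show "(Psi a \<otimes>\<^bsub>end_alg V\<^esub> Psi b) v i = (Psi b \<otimes>\<^bsub>end_alg V\<^esub> Psi a) v i" .
    qed (use a b cl in auto)
  next
    fix a k assume a: "a \<in> {1..<n}" and k: "k \<in> T"
    have a': "a \<in> {1..n}" "a + 1 \<in> {1..n}"
      using a by auto
    note rel = B.psi_y_e[OF a q_J[OF k]] B.y_psi_e[OF a q_J[OF k]] B.psi_sq_e[OF a q_J[OF k]]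
    note c = coefficients_rep[OF B.klr_elems_axioms k]
    have swap: "swap_at a i = k \<longleftrightarrow> i = swap_at a k" for i
      by auto
    have sk: "swap_at a k \<in> T"
      using swap_T a k .
    \<comment> \<open>If \<psi> moves \<open>k\<close>, the correction must not leave anything at
      \<open>k\<close>.\<close>
    have delta: "B.delta a k = \<zero>" if "swap_at a k \<noteq> k"
      using that swap_at_fixed[of k a] by (auto simp: B.delta_def)
    show "Psi a \<otimes>\<^bsub>end_alg V\<^esub> Y (a + 1) \<otimes>\<^bsub>end_alg V\<^esub> E k =
        (Y a \<otimes>\<^bsub>end_alg V\<^esub> Psi a \<oplus>\<^bsub>end_alg V\<^esub> R.delta a k) \<otimes>\<^bsub>end_alg V\<^esub> E k"
    proof (rule end_V_ext)
      fix v i assume v: "v \<in> carrier V" and i: "i \<in> T"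
      have "psi a \<otimes> y (a + 1) \<otimes> v k = (y a \<otimes> psi a \<oplus> B.delta a k) \<otimes> v k"
        using rel(1) c(1)[OF a] a a' k v
          by - (rule V_relation,
            auto simp: cl B.delta_closed simp del: add_Suc_right One_nat_def)
      \<comment> \<open>The component \<open>i\<close> may be the target of the main terms
        (\<open>i = swap_at a k\<close>), of the correction (\<open>i = k\<close>), of both, or of
        neither.\<close>
      then show "(Psi a \<otimes>\<^bsub>end_alg V\<^esub> Y (a + 1) \<otimes>\<^bsub>end_alg V\<^esub> E k) v i =
        ((Y a \<otimes>\<^bsub>end_alg V\<^esub> Psi a \<oplus>\<^bsub>end_alg V\<^esub> R.delta a k) \<otimes>\<^bsub>end_alg V\<^esub> E k) v i"
        using v i a a' k sk swap_T[OF a i] V_closed[OF v k] delta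
        by (cases "i = k"; cases "i = swap_at a k")
          (simp_all add: ap mem cl B.delta_closed swap B.m_assoc B.l_distr del: add_Suc_right One_nat_def)
    qed (use a a' k cl R.delta_closed in \<open>auto simp del: add_Suc_right One_nat_def\<close>)
    show "Y (a + 1) \<otimes>\<^bsub>end_alg V\<^esub> Psi a \<otimes>\<^bsub>end_alg V\<^esub> E k =
        (Psi a \<otimes>\<^bsub>end_alg V\<^esub> Y a \<oplus>\<^bsub>end_alg V\<^esub> R.delta a k) \<otimes>\<^bsub>end_alg V\<^esub> E k"
    proof (rule end_V_ext)
      fix v i assume v: "v \<in> carrier V" and i: "i \<in> T"
      have "y (a + 1) \<otimes> psi a \<otimes> v k = (psi a \<otimes> y a \<oplus> B.delta a k) \<otimes> v k"
        using rel(2) c(1)[OF a] a a' k v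
          by - (rule V_relation,
            auto simp: cl B.delta_closed simp del: add_Suc_right One_nat_def)
      then show "(Y (a + 1) \<otimes>\<^bsub>end_alg V\<^esub> Psi a \<otimes>\<^bsub>end_alg V\<^esub> E k) v i =
        ((Psi a \<otimes>\<^bsub>end_alg V\<^esub> Y a \<oplus>\<^bsub>end_alg V\<^esub> R.delta a k) \<otimes>\<^bsub>end_alg V\<^esub> E k) v i"
        using v i a a' k sk swap_T[OF a i] V_closed[OF v k] delta
        by (cases "i = k"; cases "i = swap_at a k")
          (simp_all add: ap mem cl B.delta_closed swap B.m_assoc B.l_distr del: add_Suc_right One_nat_def)
    qed (use a a' k cl R.delta_closed in \<open>auto simp del: add_Suc_right One_nat_def\<close>)
    show "Psi a \<otimes>\<^bsub>end_alg V\<^esub> Psi a \<otimes>\<^bsub>end_alg V\<^esub> E k = R.square a k \<otimes>\<^bsub>end_alg V\<^esub> E k"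
    proof (rule end_V_ext)
      fix v i assume v: "v \<in> carrier V" and i: "i \<in> T"
      have "psi a \<otimes> psi a \<otimes> v k = B.square a k \<otimes> v k"
        using rel(3) c(2)[OF a] a k v by - (rule V_relation, auto simp: cl B.square_closed)
      then show "(Psi a \<otimes>\<^bsub>end_alg V\<^esub> Psi a \<otimes>\<^bsub>end_alg V\<^esub> E k) v i =
        (R.square a k \<otimes>\<^bsub>end_alg V\<^esub> E k) v i"
        using v i a k swap_T[OF a i] V_closed[OF v k]
        by (simp add: ap mem cl B.square_closed B.m_assoc)
    qed (use a k cl R.square_closed[OF a] in auto)
  next
    fix a k assume a: "1 \<le> a" "a + 2 \<le> n" and k: "k \<in> T"
    have a': "a \<in> {1..<n}" "a + 1 \<in> {1..<n}"
      using a by auto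
    let ?s = "\<lambda>i. swap_at a (swap_at (a + 1) (swap_at a i))"
    show "Psi (a + 1) \<otimes>\<^bsub>end_alg V\<^esub> Psi a \<otimes>\<^bsub>end_alg V\<^esub> Psi (a + 1) \<otimes>\<^bsub>end_alg V\<^esub> E k =
        (Psi a \<otimes>\<^bsub>end_alg V\<^esub> Psi (a + 1) \<otimes>\<^bsub>end_alg V\<^esub> Psi a \<oplus>\<^bsub>end_alg V\<^esub> R.braid a k) \<otimes>\<^bsub>end_alg V\<^esub> E k"
    proof (rule end_V_ext)
      fix v i assume v: "v \<in> carrier V" and i: "i \<in> T"
      have s: "?s i = k \<longleftrightarrow> i = ?s k"
        by (metis swap_at_swap_at)
      \<comment> \<open>The analogue of the vanishing of \<open>delta\<close>: a nonzero correction
        forces the entries at \<open>a\<close> and \<open>a + 2\<close> to agree, and then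
        \<open>?s\<close> fixes \<open>k\<close>.\<close>
      have braid: "B.braid a k = \<zero>" if "?s k \<noteq> k"
        using that swap_at_conj_fixed[of k a] by (auto simp: B.braid_def)
      have rel: "psi (a + 1) \<otimes> psi a \<otimes> psi (a + 1) \<otimes> v k =
          (psi a \<otimes> psi (a + 1) \<otimes> psi a \<oplus> B.braid a k) \<otimes> v k"
        using B.psi_braid_e[OF a q_J[OF k]] coefficients_rep(3)[OF B.klr_elems_axioms k a]
          B.braid_closed[OF a] a' k v
        by - (rule V_relation, auto simp: cl simp del: add_Suc_right One_nat_def)
      have T: "swap_at a i \<in> T" "swap_at (a + 1) i \<in> T" "swap_at (a + 1) (swap_at a i) \<in> T"
          "swap_at a (swap_at (a + 1) i) \<in> T" "?s i \<in> T"
        using swap_T a' i by (auto simp del: add_Suc_right One_nat_def)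
      have Ev: "E k v \<in> carrier V"
        using mem(1) k v .
      \<comment> \<open>The operators read the place permutations in the order opposite to their
        product; \<open>swap_at_braid\<close> shows that both cubic products read the same component
        \<open>?s i\<close>.\<close>
      have "(Psi (a + 1) \<otimes>\<^bsub>end_alg V\<^esub> Psi a \<otimes>\<^bsub>end_alg V\<^esub> Psi (a + 1) \<otimes>\<^bsub>end_alg V\<^esub> E k) v i =
          psi (a + 1) \<otimes> psi a \<otimes> psi (a + 1) \<otimes> E k v (?s i)"
        using v i T a' Ev V_closed[OF Ev T(5)]
        by (simp add: end_V_apply Psi_apply mem cl B.m_assoc swap_at_braid del: add_Suc_right One_nat_def)
      moreover have "((Psi a \<otimes>\<^bsub>end_alg V\<^esub> Psi (a + 1) \<otimes>\<^bsub>end_alg V\<^esub> Psi a \<oplus>\<^bsub>end_alg V\<^esub> R.braid a k)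
          \<otimes>\<^bsub>end_alg V\<^esub> E k) v i =
          psi a \<otimes> psi (a + 1) \<otimes> psi a \<otimes> E k v (?s i) \<oplus> B.braid a k \<otimes> E k v i"
        using v i T a a' Ev V_closed[OF Ev T(5)]
        by (simp add: end_V_apply Psi_apply braid_apply mem cl B.m_assoc del: add_Suc_right One_nat_def)
      moreover have "psi (a + 1) \<otimes> psi a \<otimes> psi (a + 1) \<otimes> E k v (?s i) =
          psi a \<otimes> psi (a + 1) \<otimes> psi a \<otimes> E k v (?s i) \<oplus> B.braid a k \<otimes> E k v i"
        using rel s braid v i T a' V_closed[OF v k] B.braid_closed[OF a, of k]
        by (cases "i = k"; cases "i = ?s k")
          (simp_all add: E_apply cl B.l_distr del: add_Suc_right One_nat_def)
      ultimately show "(Psi (a + 1) \<otimes>\<^bsub>end_alg V\<^esub> Psi a \<otimes>\<^bsub>end_alg V\<^esub> Psi (a + 1) \<otimes>\<^bsub>end_alg V\<^esub> E k) v i =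
        ((Psi a \<otimes>\<^bsub>end_alg V\<^esub> Psi (a + 1) \<otimes>\<^bsub>end_alg V\<^esub> Psi a \<oplus>\<^bsub>end_alg V\<^esub> R.braid a k) \<otimes>\<^bsub>end_alg V\<^esub> E k) v i"
        by simp
    qed (use a' k cl R.braid_closed[OF a] in \<open>auto simp del: add_Suc_right One_nat_def\<close>)
  qed
qed

section \<open>Summing the components of a family\<close>

definition total :: "((nat \<Rightarrow> 'k) \<Rightarrow> 'b) \<Rightarrow> 'b"
  where "total v = (\<Oplus>i\<in>T. v i)"

lemma total_closed: "v \<in> carrier V \<Longrightarrow> total v \<in> carrier B"
  unfolding total_def using V_closed by (intro B.finsum_closed) auto

lemma total_add: "v \<in> carrier V \<Longrightarrow> w \<in> carrier V \<Longrightarrow> total (v \<oplus>\<^bsub>V\<^esub> w) = total v \<oplus> total w"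
proof -
  assume vw: "v \<in> carrier V" "w \<in> carrier V"
  have "total (v \<oplus>\<^bsub>V\<^esub> w) = (\<Oplus>i\<in>T. v i \<oplus> w i)"
    unfolding total_def using vw V_closed by (intro B.finsum_cong') (auto simp: V_simps)
  also have "\<dots> = total v \<oplus> total w"
    unfolding total_def using vw V_closed by (intro B.finsum_addf) auto
  finally show ?thesis .
qed

lemma total_smult: "v \<in> carrier V \<Longrightarrow> total (c \<odot>\<^bsub>V\<^esub> v) = c \<odot> total v"
proof -
  assume v: "v \<in> carrier V"
  have "total (c \<odot>\<^bsub>V\<^esub> v) = (\<Oplus>i\<in>T. c \<odot> v i)"
    unfolding total_def using v V_closed by (intro B.finsum_cong') (auto simp: V_simps)
  also have "\<dots> = c \<odot> total v"
    unfolding total_def using v V_closed finite_T by (subst B.smult_finsum) auto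
  finally show ?thesis .
qed

lemma total_mult:
  assumes "x \<in> carrier B" "v \<in> carrier V" "\<And>i. i \<in> T \<Longrightarrow> w i = x \<otimes> v i"
  shows "total w = x \<otimes> total v"
proof -
  have "total w = (\<Oplus>i\<in>T. x \<otimes> v i)"
    unfolding total_def using assms V_closed by (intro B.finsum_cong') auto
  also have "\<dots> = x \<otimes> total v"
    unfolding total_def using assms V_closed finite_T by (subst B.finsum_rdistr) auto
  finally show ?thesis .
qed

lemma total_Y: "a \<in> {1..n} \<Longrightarrow> v \<in> carrier V \<Longrightarrow> total (Y a v) = y a \<otimes> total v"
  using B.y_closed Y_apply by (intro total_mult) auto

text \<open>\<open>Psi a\<close> multiplies by \<open>psi a\<close> and permutes the components by
  an involution of \<open>T\<close>; the permutation disappears in the sum.\<close>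

lemma total_Psi: "a \<in> {1..<n} \<Longrightarrow> v \<in> carrier V \<Longrightarrow> total (Psi a v) = psi a \<otimes> total v"
proof -
  assume a: "a \<in> {1..<n}" and v: "v \<in> carrier V"
  have img: "T = swap_at a ` T"
    using swap_T[OF a] by (force simp: image_iff intro: swap_at_swap_at[symmetric])
  have inj: "inj_on (swap_at a) T"
    by (metis inj_onI swap_at_swap_at)
  have "total (Psi a v) = (\<Oplus>i\<in>T. psi a \<otimes> v (swap_at a i))"
    unfolding total_def using v a V_closed swap_T[OF a] B.psi_closed
    by (intro B.finsum_cong') (auto simp: Psi_apply)
  also have "\<dots> = (\<Oplus>i\<in>swap_at a ` T. psi a \<otimes> v i)"
    using v a V_closed swap_T[OF a] B.psi_closed
    by (intro B.finsum_reindex[symmetric] inj) auto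
  also have "\<dots> = psi a \<otimes> total v"
    unfolding img[symmetric] total_def using v a V_closed finite_T B.psi_closed
    by (subst B.finsum_rdistr) auto
  finally show ?thesis .
qed

text \<open>\<open>v i\<close> lies in the right ideal of \<open>e (q i)\<close>. So left
  multiplication by \<open>e j\<close> keeps exactly the components over \<open>j\<close>, which is
  what the sum of the projections \<open>E k\<close> over the fibre does.\<close>

lemma total_E:
  assumes j: "j \<in> J" and v: "v \<in> carrier V"
  shows "total (finsum (end_alg V) E (fibre j) v) = e j \<otimes> total v"
proof (rule total_mult)
  fix i assume i: "i \<in> T"
  have fin: "finite (fibre j)"
    using finite_T by (simp add: fibre_def)
  have E: "E \<in> fibre j \<rightarrow> carrier (end_alg V)"
    using E_closed by (auto simp: fibre_def)
  have Ev: "(\<lambda>k. E k v) \<in> fibre j \<rightarrow> carrier V"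
    using E_closed end_alg_mem[OF _ v] by (auto simp: fibre_def)
  have "finsum (end_alg V) E (fibre j) v i = (\<Oplus>k\<in>fibre j. E k v i)"
    using end_alg_finsum[OF V_lin_space fin E v] V_finsum[OF fin Ev i] by simp
  also have "\<dots> = (\<Oplus>k\<in>fibre j. if i = k then v i else \<zero>)"
    using v i V_closed by (intro B.finsum_cong') (auto simp: E_apply)
  also have "\<dots> = (if i \<in> fibre j then v i else \<zero>)"
    using B.finsum_singleton[OF _ fin, of i "\<lambda>_. v i"] V_closed[OF v i]
    by (auto intro!: B.add.finprod_one_eqI)
  also have "\<dots> = e j \<otimes> e (q i) \<otimes> v i"
    using i V_e[OF v i] V_closed[OF v i] B.e_e[OF j q_J[OF i]] by (auto simp: fibre_def)
  also have "\<dots> = e j \<otimes> (e (q i) \<otimes> v i)"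
    using V_closed[OF v i] B.e_closed[OF j] eq_closed[OF i] by (simp add: B.m_assoc)
  finally show "finsum (end_alg V) E (fibre j) v i = e j \<otimes> v i"
    using V_e[OF v i] by simp
qed (use j v B.e_closed in auto)

text \<open>The test family is \<open>e (q k)\<close> at \<open>k\<close> and zero elsewhere; it
  belongs to \<open>V\<close> because \<open>e (q k)\<close> is idempotent, and its total is
  \<open>e (q k)\<close>.\<close>

lemma mult_e_eq_zero:
  assumes \<Theta>: "\<Theta> = \<zero>\<^bsub>end_alg V\<^esub>" and k: "k \<in> T" and x: "x \<in> carrier B"
    and total: "\<And>v. v \<in> carrier V \<Longrightarrow> total (\<Theta> v) = x \<otimes> total v"
  shows "x \<otimes> e (q k) = \<zero>"
proof -
  let ?v = "\<lambda>i\<in>T. if i = k then e (q k) else \<zero>"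
  have v: "?v \<in> carrier V"
    using k eq_closed B.e_e[OF q_J[OF k] q_J[OF k]] by (auto simp: V_simps)
  have "total ?v = (\<Oplus>i\<in>T. if k = i then e (q k) else \<zero>)"
    unfolding total_def using k eq_closed by (intro B.finsum_cong') auto
  also have "\<dots> = e (q k)"
    using k eq_closed finite_T by (intro B.finsum_singleton) auto
  finally have "x \<otimes> e (q k) = total (\<Theta> ?v)"
    using total[OF v] by simp
  also have "\<dots> = (\<Oplus>i\<in>T. \<zero>)"
    unfolding total_def using v by (intro B.finsum_cong') (auto simp: \<Theta> end_alg_simps V_simps)
  finally show ?thesis
    by simp
qed

end

context klr_cover
begin

sublocale T: klr_index n T swap_at
  by unfold_locales (use finite_T swap_T in auto)

sublocale J: klr_index n J act
  by unfold_locales (use finite_J act_J in auto)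

text \<open>The families have entries in \<open>A\<close> itself. Hence \<open>R\<close> acts on
  them, and the operator obtained from \<open>x\<close> through \<open>\<phi>\<close> can be
  compared with multiplication by \<open>x\<close> in \<open>A\<close>: the operator is zero, so the
  multiplication vanishes on totals.\<close>

lemma push_kernel:
  fixes rels_J :: "(('j klr_gen list \<Rightarrow> 'f::field) \<times> _) set"
    and rels_T :: "(((nat \<Rightarrow> 'k) klr_gen list \<Rightarrow> 'f) \<times> _) set"
  defines "rels_J \<equiv> klr_free_relations \<Gamma> n J rep act"
    and "rels_T \<equiv> klr_free_relations \<Gamma> n T (\<lambda>k. k) swap_at"
  defines "A \<equiv> presented_alg (klr_gens n J) rels_J"
    and "R \<equiv> presented_alg (klr_gens n T) rels_T"
    and "gA \<equiv> presented_gen (klr_gens n J) rels_J"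
    and "gR \<equiv> presented_gen (klr_gens n T) rels_T"
  assumes \<phi>: "\<phi> \<in> alg_hom A R"
    and \<phi>_E: "\<And>j. j \<in> J \<Longrightarrow> \<phi> (gA (E_gen j)) = finsum R (\<lambda>k. gR (E_gen k)) (fibre j)"
    and \<phi>_Y: "\<And>a. a \<in> {1..n} \<Longrightarrow> \<phi> (gA (Y_gen a)) = gR (Y_gen a)"
    and \<phi>_Psi: "\<And>a. a \<in> {1..<n} \<Longrightarrow> \<phi> (gA (Psi_gen a)) = gR (Psi_gen a)"
    and x: "x \<in> carrier A" "\<phi> x = \<zero>\<^bsub>R\<^esub>" and k: "k \<in> T"
  shows "x \<otimes>\<^bsub>A\<^esub> gA (E_gen (q k)) = \<zero>\<^bsub>A\<^esub>"
proof -
  interpret A: klr_family A \<Gamma> n J rep act "\<lambda>j. gA (E_gen j)" "\<lambda>a. gA (Y_gen a)"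
    "\<lambda>a. gA (Psi_gen a)"
    unfolding A_def gA_def rels_J_def by (rule J.klr_presented_family)
  interpret R: klr_family R \<Gamma> n T "\<lambda>k. k" swap_at "\<lambda>k. gR (E_gen k)" "\<lambda>a. gR (Y_gen a)"
    "\<lambda>a. gR (Psi_gen a)"
    unfolding R_def gR_def rels_T_def by (rule T.klr_presented_family)
  interpret C: klr_cover_rep \<Gamma> n T J rep act q A "\<lambda>j. gA (E_gen j)" "\<lambda>a. gA (Y_gen a)"
    "\<lambda>a. gA (Psi_gen a)"
    by unfold_locales
  interpret P: presentation "klr_gens n J" rels_J
    unfolding rels_J_def by (rule J.klr_presentation)
  obtain \<theta> where \<theta>: "\<theta> \<in> alg_hom R (end_alg C.V)"
      and \<theta>_E: "\<And>k. k \<in> T \<Longrightarrow> \<theta> (gR (E_gen k)) = C.E k"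
      and \<theta>_Y: "\<And>a. a \<in> {1..n} \<Longrightarrow> \<theta> (gR (Y_gen a)) = C.Y a"
      and \<theta>_Psi: "\<And>a. a \<in> {1..<n} \<Longrightarrow> \<theta> (gR (Psi_gen a)) = C.Psi a"
    using T.klr_universal[OF C.klr_family_rep] unfolding R_def gR_def rels_T_def by metis
  let ?h = "\<lambda>x. \<theta> (\<phi> x)"
  have h: "?h \<in> alg_hom A (end_alg C.V)"
    using alg_hom_comp[OF \<phi> \<theta>] .
  have h_V: "?h z v \<in> carrier C.V" if "z \<in> carrier A" "v \<in> carrier C.V" for z v
    using end_alg_mem[OF alg_hom_closed[OF h that(1)] that(2)] .
  have h_E: "?h (gA (E_gen j)) = finsum (end_alg C.V) C.E (fibre j)" if j: "j \<in> J" for j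
  proof -
    have fib: "(\<lambda>k. gR (E_gen k)) \<in> fibre j \<rightarrow> carrier R"
      using R.e_closed by (auto simp: fibre_def)
    have "?h (gA (E_gen j)) = finsum (end_alg C.V) (\<lambda>k. \<theta> (gR (E_gen k))) (fibre j)"
      unfolding \<phi>_E[OF j] using finite_T
      by (intro alg_hom_finsum[OF \<theta> R.unital_algebra_axioms C.M.unital_algebra_axioms _ fib])
        (simp add: fibre_def)
    also have "\<dots> = finsum (end_alg C.V) C.E (fibre j)"
      using \<theta>_E C.E_closed by (intro C.M.finsum_cong') (auto simp: fibre_def)
    finally show ?thesis .
  qed
  \<comment> \<open>Induction by left multiplication with generators; \<open>total_E\<close>,
    \<open>total_Y\<close> and \<open>total_Psi\<close> are the generator cases, applied to the
    family already transformed by the rest of the word.\<close>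
  have total: "\<forall>v\<in>carrier C.V. C.total (?h z v) = z \<otimes>\<^bsub>A\<^esub> C.total v" if "z \<in> carrier A" for z
    using that
  proof (induction z rule: P.presented_induct[folded A_def gA_def, consumes 1,
        case_names one add smult gen])
    case one
    then show ?case
      using alg_hom_one[OF h] C.total_closed by (simp add: C.end_V_apply)
  next
    case (add f g)
    have "?h (f \<oplus>\<^bsub>A\<^esub> g) v = ?h f v \<oplus>\<^bsub>C.V\<^esub> ?h g v" if "v \<in> carrier C.V" for v
      using that alg_hom_add[OF h add(1,2)] by (simp add: end_alg_simps)
    then show ?case
      using add C.total_closed C.total_add h_V by (simp add: A.l_distr)
  next
    case (smult c f)
    have "?h (c \<odot>\<^bsub>A\<^esub> f) v = c \<odot>\<^bsub>C.V\<^esub> ?h f v" if "v \<in> carrier C.V" for v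
      using that alg_hom_smult[OF h smult(1)] by (simp add: end_alg_simps)
    then show ?case
      using smult C.total_closed C.total_smult h_V by (simp add: A.smult_mult_left)
  next
    case (gen g f)
    have g: "gA g \<in> carrier A"
      using gen(1) A.e_closed A.y_closed A.psi_closed by (auto simp: klr_gens_def)
    have hg: "C.total (?h (gA g) v) = gA g \<otimes>\<^bsub>A\<^esub> C.total v" if "v \<in> carrier C.V" for v
      using gen(1) h_E \<phi>_Y \<phi>_Psi \<theta>_Y \<theta>_Psi that
      by (auto simp: klr_gens_def C.total_E C.total_Y C.total_Psi)
    have "?h (gA g \<otimes>\<^bsub>A\<^esub> f) v = ?h (gA g) (?h f v)" if "v \<in> carrier C.V" for v
      using that alg_hom_mult[OF h g gen(2)] by (simp add: end_alg_simps)
    then show ?case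
      using gen hg g h_V C.total_closed by (simp add: A.m_assoc)
  qed
  show ?thesis
  proof (rule C.mult_e_eq_zero[OF _ k x(1)])
    show "?h x = \<zero>\<^bsub>end_alg C.V\<^esub>"
      using x(2) alg_hom_zero[OF \<theta> R.unital_algebra_axioms C.M.unital_algebra_axioms] by simp
  qed (use total[OF x(1)] in blast)
qed

end

section \<open>Orbits of tuples\<close>

lemma cyc_orbit_self: "x \<in> cyc_orbit f x"
  unfolding cyc_orbit_def by (rule range_eqI[of _ _ 0]) simp

lemma cyc_orbit_step: "y \<in> cyc_orbit f x \<Longrightarrow> f y \<in> cyc_orbit f x"
  unfolding cyc_orbit_def by (auto intro: range_eqI[of _ _ "Suc _"])

lemma funpow_mult_fixed: "(f ^^ p) x = x \<Longrightarrow> (f ^^ (j * p)) x = x"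
  by (induction j) (simp_all add: funpow_add)

lemma cyc_orbit_trans: "y \<in> cyc_orbit f x \<Longrightarrow> z \<in> cyc_orbit f y \<Longrightarrow> z \<in> cyc_orbit f x"
  unfolding cyc_orbit_def by (auto simp flip: funpow_add[unfolded o_def, THEN fun_cong])

text \<open>The orbit is made of forward iterates, but on a point of period \<open>p\<close> the
  iterate \<open>j * (p - 1)\<close> undoes the iterate \<open>j\<close>, since the exponents add up
  to \<open>j * p\<close>.\<close>

lemma cyc_orbit_sym:
  assumes p: "p \<ge> 1" "(f ^^ p) x = x" and y: "y \<in> cyc_orbit f x"
  shows "x \<in> cyc_orbit f y"
proof -
  obtain j where j: "y = (f ^^ j) x"
    using y by (auto simp: cyc_orbit_def)
  have "j * (p - 1) + j = j * p"
    using p(1) by (cases p) auto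
  then have "(f ^^ (j * (p - 1))) y = x"
    unfolding j using funpow_mult_fixed[OF p(2), of j] by (metis comp_apply funpow_add)
  then show ?thesis
    unfolding cyc_orbit_def by (metis rangeI)
qed

lemma cyc_orbit_eq:
  assumes "p \<ge> 1" "(f ^^ p) x = x" "y \<in> cyc_orbit f x"
  shows "cyc_orbit f y = cyc_orbit f x"
  using cyc_orbit_sym[OF assms] cyc_orbit_trans assms(3) by (metis subsetI subset_antisym)

lemma cyc_orbit_finite:
  assumes p: "p \<ge> 1" "(f ^^ p) x = x"
  shows "finite (cyc_orbit f x)"
proof -
  have "(f ^^ j) x = (f ^^ (j mod p)) x" for j
  proof -
    have "(f ^^ j) x = (f ^^ (j mod p + (j div p) * p)) x"
      by simp
    also have "\<dots> = (f ^^ (j mod p)) x"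
      using funpow_mult_fixed[OF p(2), of "j div p"] by (simp only: funpow_add o_apply)
    finally show ?thesis .
  qed
  then have "cyc_orbit f x \<subseteq> (\<lambda>j. (f ^^ j) x) ` {..<p}"
    using p(1) unfolding cyc_orbit_def by (force simp: image_iff)
  then show ?thesis
    by (rule finite_subset) simp
qed

lemma orbit_rep_in: "k \<in> \<gamma> \<Longrightarrow> orbit_rep \<gamma> \<in> \<gamma>"
  unfolding orbit_rep_def by (rule someI)

section \<open>Tuples of given content, place permutations and entrywise maps\<close>

lemma tuples_extensional: "k \<in> tuples n \<beta> \<Longrightarrow> k \<in> extensional {1..n}"
  by (auto simp: tuples_def PiE_iff)

lemma tuples_disjoint: "k \<in> tuples n \<beta> \<Longrightarrow> k \<in> tuples n \<beta>' \<Longrightarrow> \<beta> = \<beta>'"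
  by (auto simp: tuples_def fun_eq_iff)

text \<open>Each entry of a tuple occurs at least once, so it lies in the finite support of
  \<open>\<beta>\<close>.\<close>

lemma finite_tuples:
  assumes "finite {x. \<beta> x \<noteq> 0}"
  shows "finite (tuples n \<beta>)"
proof (rule finite_subset)
  show "tuples n \<beta> \<subseteq> {1..n} \<rightarrow>\<^sub>E {x. \<beta> x \<noteq> 0}"
  proof
    fix k assume k: "k \<in> tuples n \<beta>"
    have "\<beta> (k a) \<noteq> 0" if a: "a \<in> {1..n}" for a
    proof -
      have "card {b \<in> {1..n}. k b = k a} = \<beta> (k a)"
        using k by (simp add: tuples_def)
      moreover have "card {b \<in> {1..n}. k b = k a} \<noteq> 0"
        using a by auto
      ultimately show ?thesis
        by simp
    qed
    then show "k \<in> {1..n} \<rightarrow>\<^sub>E {x. \<beta> x \<noteq> 0}"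
      using k by (auto simp: tuples_def PiE_iff)
  qed
  show "finite ({1..n} \<rightarrow>\<^sub>E {x. \<beta> x \<noteq> 0})"
    using assms by (intro finite_PiE) auto
qed

lemma swap_at_tuples:
  assumes a: "a \<in> {1..<n}" and k: "k \<in> tuples n \<beta>"
  shows "swap_at a k \<in> tuples n \<beta>"
proof -
  let ?t = "transpose a (a + 1)"
  \<comment> \<open>As \<open>a\<close> is less than \<open>n\<close>, both \<open>a\<close> and
    \<open>a + 1\<close> are places, so the transposition preserves the set of places.\<close>
  have t: "?t b \<in> {1..n} \<longleftrightarrow> b \<in> {1..n}" for b
    using a by (auto simp: transpose_def)
  have "{b \<in> {1..n}. swap_at a k b = x} = ?t ` {b \<in> {1..n}. k b = x}" for x
  proof (intro equalityI subsetI)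
    fix b assume "b \<in> {b \<in> {1..n}. swap_at a k b = x}"
    then show "b \<in> ?t ` {b \<in> {1..n}. k b = x}"
      using t by (intro image_eqI[of _ _ "?t b"]) (auto simp: swap_at_def)
  next
    fix b assume "b \<in> ?t ` {b \<in> {1..n}. k b = x}"
    then obtain c where c: "b = ?t c" "c \<in> {1..n}" "k c = x"
      by blast
    then show "b \<in> {b \<in> {1..n}. swap_at a k b = x}"
      using t[of c] by (simp add: swap_at_def)
  qed
  moreover have "card (?t ` S) = card S" for S
    by (intro card_image inj_on_subset[OF inj_transpose]) simp
  moreover have "swap_at a k \<in> extensional {1..n}"
    using a tuples_extensional[OF k] by (auto simp: swap_at_def extensional_def transpose_def)
  ultimately show ?thesis
    using k by (simp add: tuples_def PiE_iff)
qed

text \<open>The places where the image has entry \<open>x\<close> are those where \<open>k\<close>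
  has the entry sent to \<open>x\<close> by \<sigma>. The composition
  \<open>\<beta> \<circ> \<sigma>\<close> is the one that the action of \<sigma> carries to
  \<open>\<beta>\<close>.\<close>

lemma tuple_map_tuples:
  assumes \<sigma>: "bij \<sigma>" and k: "k \<in> tuples n (\<beta> \<circ> \<sigma>)"
  shows "tuple_map n \<sigma> k \<in> tuples n \<beta>"
proof -
  have "{b \<in> {1..n}. tuple_map n \<sigma> k b = x} = {b \<in> {1..n}. k b = inv_into UNIV \<sigma> x}" for x
    using \<sigma> by (auto simp: tuple_map_def bij_inv_eq_iff bij_is_inj bij_is_surj surj_f_inv_f)
  moreover have "(\<beta> \<circ> \<sigma>) (inv_into UNIV \<sigma> x) = \<beta> x" for x
    using \<sigma> by (simp add: bij_is_surj surj_f_inv_f)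
  ultimately show ?thesis
    using k by (simp add: tuples_def) (simp add: tuple_map_def)
qed

lemma tuple_map_swap_at:
  "a \<in> {1..<n} \<Longrightarrow> tuple_map n \<sigma> (swap_at a k) = swap_at a (tuple_map n \<sigma> k)"
  by (auto simp: fun_eq_iff tuple_map_def swap_at_def transpose_def)

lemma tuple_map_comp:
  "tuple_map n f (tuple_map n g k) = tuple_map n (f \<circ> g) k"
  by (simp add: fun_eq_iff tuple_map_def)

lemma tuple_map_id: "k \<in> extensional {1..n} \<Longrightarrow> tuple_map n (\<lambda>x. x) k = k"
  by (auto simp: fun_eq_iff tuple_map_def extensional_def)

lemma funpow_tuple_map:
  "k \<in> extensional {1..n} \<Longrightarrow> (tuple_map n \<sigma> ^^ j) k = tuple_map n (\<sigma> ^^ j) k"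
  by (induction j) (simp_all add: tuple_map_comp tuple_map_id id_def)

section \<open>The orbits of \<sigma> on compositions and tuples, and the coverings they
  give\<close>

locale klr_orbit =
  fixes n p :: nat and \<Gamma> :: "'k rel" and \<sigma> :: "'k \<Rightarrow> 'k" and \<alpha> :: "'k \<Rightarrow> nat"
  assumes p: "p \<ge> 1"
    and bij: "bij \<sigma>"
    and edge: "(k, k') \<in> \<Gamma> \<Longrightarrow> (\<sigma> k, \<sigma> k') \<in> \<Gamma>"
    and period: "(\<sigma> ^^ p) k = k"
    and finite_support: "finite {k. \<alpha> k \<noteq> 0}"
begin

abbreviation "orb \<equiv> comp_orbit \<sigma> \<alpha>"
abbreviation "mp \<equiv> tuple_map n \<sigma>"
abbreviation "J \<equiv> tuple_orbits n \<sigma> \<alpha>"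

lemma edge_funpow: "(k, k') \<in> \<Gamma> \<Longrightarrow> ((\<sigma> ^^ j) k, (\<sigma> ^^ j) k') \<in> \<Gamma>"
  by (induction j) (auto intro: edge)

text \<open>Edges are reflected as well as preserved, because by periodicity the inverse of a power
  of \<sigma> is again a power of \<sigma>.\<close>

lemma edge_iff: "((\<sigma> ^^ j) k, (\<sigma> ^^ j) k') \<in> \<Gamma> \<longleftrightarrow> (k, k') \<in> \<Gamma>"
proof
  assume "((\<sigma> ^^ j) k, (\<sigma> ^^ j) k') \<in> \<Gamma>"
  then have "((\<sigma> ^^ (j * (p - 1))) ((\<sigma> ^^ j) k), (\<sigma> ^^ (j * (p - 1))) ((\<sigma> ^^ j) k')) \<in> \<Gamma>"
    by (rule edge_funpow)
  moreover have "j * (p - 1) + j = j * p"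
    using p by (cases p) auto
  then have "(\<sigma> ^^ (j * (p - 1))) ((\<sigma> ^^ j) x) = x" for x
    using funpow_mult_fixed[OF period[of x], of j] by (metis comp_apply funpow_add)
  ultimately show "(k, k') \<in> \<Gamma>"
    by simp
qed (rule edge_funpow)

lemma inv_edge_iff: "(inv_into UNIV \<sigma> k, inv_into UNIV \<sigma> k') \<in> \<Gamma> \<longleftrightarrow> (k, k') \<in> \<Gamma>"
  using edge_iff[of 1 "inv_into UNIV \<sigma> k" "inv_into UNIV \<sigma> k'"] bij by (simp add: bij_is_surj surj_f_inv_f)

lemma \<sigma>_inv: "\<sigma> \<circ> inv_into UNIV \<sigma> = (\<lambda>x. x)" "inv_into UNIV \<sigma> \<circ> \<sigma> = (\<lambda>x. x)"
  using bij by (simp_all add: fun_eq_iff bij_is_surj surj_f_inv_f bij_is_inj)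

lemma comp_period: "((\<lambda>\<beta>. \<beta> \<circ> inv_into UNIV \<sigma>) ^^ p) \<beta> = \<beta>"
proof -
  \<comment> \<open>Each step composes with the inverse of \<sigma> on the right, so composing with
    \<open>\<sigma> ^^ j\<close> cancels \<open>j\<close> steps. For \<open>j = p\<close> the
    cancelling factor is the identity.\<close>
  have "((\<lambda>\<beta>. \<beta> \<circ> inv_into UNIV \<sigma>) ^^ j) \<beta> \<circ> (\<sigma> ^^ j) = \<beta>" for j
  proof (induction j)
    case (Suc j)
    have "((\<lambda>\<beta>. \<beta> \<circ> inv_into UNIV \<sigma>) ^^ Suc j) \<beta> \<circ> (\<sigma> ^^ Suc j) =
        ((\<lambda>\<beta>. \<beta> \<circ> inv_into UNIV \<sigma>) ^^ j) \<beta> \<circ> ((inv_into UNIV \<sigma> \<circ> \<sigma>) \<circ> (\<sigma> ^^ j))"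
      by (simp add: comp_assoc)
    also have "\<dots> = \<beta>"
      unfolding \<sigma>_inv using Suc by (simp add: o_def)
    finally show ?case .
  qed simp
  from this[of p] show ?thesis
    using period by (simp add: fun_eq_iff)
qed

lemma orb_finite: "finite orb"
  unfolding comp_orbit_def by (rule cyc_orbit_finite[OF p comp_period])

lemma orb_inv: "\<beta> \<in> orb \<Longrightarrow> \<beta> \<circ> inv_into UNIV \<sigma> \<in> orb"
  unfolding comp_orbit_def by (rule cyc_orbit_step)

text \<open>\<open>\<beta> \<circ> \<sigma>\<close> is the predecessor of \<open>\<beta>\<close>
  under the action; periodicity puts it among the forward iterates.\<close>

lemma orb_shift:
  assumes "\<beta> \<in> orb"
  shows "\<beta> \<circ> \<sigma> \<in> orb"
proof -
  let ?f = "\<lambda>\<beta>. \<beta> \<circ> inv_into UNIV \<sigma>"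
  have "(\<beta> \<circ> \<sigma>) \<circ> inv_into UNIV \<sigma> = \<beta>"
    by (simp add: comp_assoc \<sigma>_inv) (simp add: o_def)
  then have "\<beta> \<in> cyc_orbit ?f (\<beta> \<circ> \<sigma>)"
    using cyc_orbit_step[OF cyc_orbit_self, of ?f "\<beta> \<circ> \<sigma>"] by simp
  then have "\<beta> \<circ> \<sigma> \<in> cyc_orbit ?f \<beta>"
    by (rule cyc_orbit_sym[OF p comp_period])
  then show ?thesis
    using assms unfolding comp_orbit_def by (rule cyc_orbit_trans[rotated])
qed

lemma orb_finite_support: "\<beta> \<in> orb \<Longrightarrow> finite {x. \<beta> x \<noteq> 0}"
proof -
  have "finite {x. ((\<lambda>\<beta>. \<beta> \<circ> inv_into UNIV \<sigma>) ^^ j) \<alpha> x \<noteq> 0}" for j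
  proof (induction j)
    case (Suc j)
    have "{x. ((\<lambda>\<beta>. \<beta> \<circ> inv_into UNIV \<sigma>) ^^ Suc j) \<alpha> x \<noteq> 0} =
        inv_into UNIV \<sigma> -` {x. ((\<lambda>\<beta>. \<beta> \<circ> inv_into UNIV \<sigma>) ^^ j) \<alpha> x \<noteq> 0}"
      by auto
    then show ?case
      using finite_vimageI[OF Suc bij_is_inj[OF bij_imp_bij_inv[OF bij]]] by simp
  qed (use finite_support in simp)
  then show "\<beta> \<in> orb \<Longrightarrow> finite {x. \<beta> x \<noteq> 0}"
    by (auto simp: comp_orbit_def cyc_orbit_def)
qed

lemma tuples_finite: "\<beta> \<in> orb \<Longrightarrow> finite (tuples n \<beta>)"
  by (intro finite_tuples orb_finite_support)

lemma tuple_period: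
  assumes "k \<in> extensional {1..n}"
  shows "(mp ^^ p) k = k"
proof -
  have "\<sigma> ^^ p = (\<lambda>x. x)"
    using period by (rule ext)
  then show ?thesis
    using funpow_tuple_map[OF assms, of p \<sigma>] tuple_map_id[OF assms] by simp
qed

lemma orbit_tuples_extensional: "k \<in> orbit_tuples n \<sigma> \<alpha> \<Longrightarrow> k \<in> extensional {1..n}"
  unfolding orbit_tuples_def using tuples_extensional by blast

lemma mp_tuples_iff:
  assumes "k \<in> extensional {1..n}"
  shows "mp k \<in> tuples n \<beta> \<longleftrightarrow> k \<in> tuples n (\<beta> \<circ> \<sigma>)"
proof
  assume "mp k \<in> tuples n \<beta>"
  moreover have "\<beta> = (\<beta> \<circ> \<sigma>) \<circ> inv_into UNIV \<sigma>"
    by (simp add: comp_assoc \<sigma>_inv) (simp add: o_def)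
  ultimately have "tuple_map n (inv_into UNIV \<sigma>) (mp k) \<in> tuples n (\<beta> \<circ> \<sigma>)"
    using bij_imp_bij_inv[OF bij] by (metis tuple_map_tuples)
  then show "k \<in> tuples n (\<beta> \<circ> \<sigma>)"
    using assms by (simp add: tuple_map_comp \<sigma>_inv tuple_map_id)
qed (rule tuple_map_tuples[OF bij])

lemma mp_orbit_tuples:
  assumes "k \<in> orbit_tuples n \<sigma> \<alpha>"
  shows "mp k \<in> orbit_tuples n \<sigma> \<alpha>"
proof -
  obtain \<beta> where \<beta>: "\<beta> \<in> orb" "k \<in> tuples n \<beta>"
    using assms by (auto simp: orbit_tuples_def)
  have "\<beta> = (\<beta> \<circ> inv_into UNIV \<sigma>) \<circ> \<sigma>"
    by (simp add: comp_assoc \<sigma>_inv) (simp add: o_def)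
  then have "mp k \<in> tuples n (\<beta> \<circ> inv_into UNIV \<sigma>)"
    using \<beta>(2) mp_tuples_iff[OF tuples_extensional[OF \<beta>(2)], of "\<beta> \<circ> inv_into UNIV \<sigma>"] by simp
  then show ?thesis
    using orb_inv[OF \<beta>(1)] by (auto simp: orbit_tuples_def)
qed

lemma cyc_orbit_tuples:
  assumes "k \<in> orbit_tuples n \<sigma> \<alpha>"
  shows "cyc_orbit mp k \<subseteq> orbit_tuples n \<sigma> \<alpha>"
proof -
  have "(mp ^^ j) k \<in> orbit_tuples n \<sigma> \<alpha>" for j
    by (induction j) (auto intro: assms mp_orbit_tuples)
  then show ?thesis
    by (auto simp: cyc_orbit_def)
qed

lemma orbit_tuples_finite: "finite (orbit_tuples n \<sigma> \<alpha>)"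
  unfolding orbit_tuples_def using orb_finite tuples_finite by blast

lemma J_finite: "finite J"
  unfolding tuple_orbits_def using orbit_tuples_finite by simp

lemma J_eq:
  assumes "\<gamma> \<in> J" "k \<in> \<gamma>"
  shows "k \<in> orbit_tuples n \<sigma> \<alpha>" "\<gamma> = cyc_orbit mp k"
proof -
  obtain l where l: "l \<in> orbit_tuples n \<sigma> \<alpha>" "\<gamma> = cyc_orbit mp l"
    using assms(1) by (auto simp: tuple_orbits_def)
  show "k \<in> orbit_tuples n \<sigma> \<alpha>"
    using cyc_orbit_tuples[OF l(1)] l(2) assms(2) by blast
  show "\<gamma> = cyc_orbit mp k"
    using cyc_orbit_eq[OF p tuple_period[OF orbit_tuples_extensional[OF l(1)]]] l(2) assms(2) by metis
qed

lemma J_nonempty: "\<gamma> \<in> J \<Longrightarrow> \<exists>k. k \<in> \<gamma>"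
  by (auto simp: tuple_orbits_def intro: cyc_orbit_self)

lemma swap_at_cyc_orbit:
  assumes "a \<in> {1..<n}" "l \<in> cyc_orbit mp k"
  shows "swap_at a l \<in> cyc_orbit mp (swap_at a k)"
proof -
  have "(mp ^^ j) (swap_at a k) = swap_at a ((mp ^^ j) k)" for j
    by (induction j) (simp_all add: tuple_map_swap_at[OF assms(1)])
  then show ?thesis
    using assms(2) by (auto simp: cyc_orbit_def)
qed

lemma swap_at_orbit_tuples:
  "a \<in> {1..<n} \<Longrightarrow> k \<in> orbit_tuples n \<sigma> \<alpha> \<Longrightarrow> swap_at a k \<in> orbit_tuples n \<sigma> \<alpha>"
  unfolding orbit_tuples_def using swap_at_tuples by blast

text \<open>\<open>orbit_swap\<close> is computed on a chosen representative. Place permutations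
  commute with entrywise maps, so every other representative yields the same orbit.\<close>

lemma orbit_swap_eq:
  assumes a: "a \<in> {1..<n}" and k: "k \<in> orbit_tuples n \<sigma> \<alpha>"
  shows "orbit_swap n \<sigma> a (cyc_orbit mp k) = cyc_orbit mp (swap_at a k)"
proof -
  have "orbit_rep (cyc_orbit mp k) \<in> cyc_orbit mp k"
    by (rule orbit_rep_in[OF cyc_orbit_self])
  then have "swap_at a (orbit_rep (cyc_orbit mp k)) \<in> cyc_orbit mp (swap_at a k)"
    by (rule swap_at_cyc_orbit[OF a])
  then show ?thesis
    unfolding orbit_swap_def
    using cyc_orbit_eq[OF p tuple_period] orbit_tuples_extensional swap_at_orbit_tuples[OF a k] by blast
qed

text \<open>The chosen representative of the orbit of \<open>k\<close> is the image of
  \<open>k\<close> under a power of \<sigma>, which is injective and preserves and reflects edges.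
  Distinct tuples of one composition may well share an orbit.\<close>

lemma cover_orbits:
  assumes \<beta>: "\<beta> \<in> orb"
  shows "klr_cover \<Gamma> n (tuples n \<beta>) J orbit_rep (orbit_swap n \<sigma>) (cyc_orbit mp)"
proof -
  have sub: "k \<in> orbit_tuples n \<sigma> \<alpha>" if "k \<in> tuples n \<beta>" for k
    using that \<beta> by (auto simp: orbit_tuples_def)
  have rep: "\<exists>j. \<forall>a\<in>{1..n}. orbit_rep (cyc_orbit mp k) a = (\<sigma> ^^ j) (k a)"
    if k: "k \<in> tuples n \<beta>" for k
  proof -
    have "orbit_rep (cyc_orbit mp k) \<in> cyc_orbit mp k"
      by (rule orbit_rep_in[OF cyc_orbit_self])
    then obtain j where "orbit_rep (cyc_orbit mp k) = (mp ^^ j) k"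
      by (auto simp: cyc_orbit_def)
    then show ?thesis
      using tuples_extensional[OF k] by (auto simp: funpow_tuple_map tuple_map_def)
  qed
  have inj: "(\<sigma> ^^ j) x = (\<sigma> ^^ j) y \<longleftrightarrow> x = y" for j x y
    using bij by (simp add: bij_is_inj inj_fn inj_eq)
  show ?thesis
  proof
    fix a \<gamma> assume a: "a \<in> {1..<n}" and \<gamma>: "\<gamma> \<in> J"
    obtain k where k: "k \<in> orbit_tuples n \<sigma> \<alpha>" "\<gamma> = cyc_orbit mp k"
      using \<gamma> by (auto simp: tuple_orbits_def)
    then show "orbit_swap n \<sigma> a \<gamma> \<in> J"
      using orbit_swap_eq[OF a k(1)] swap_at_orbit_tuples[OF a k(1)] by (auto simp: tuple_orbits_def)
    show "orbit_swap n \<sigma> a (orbit_swap n \<sigma> a \<gamma>) = \<gamma>"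
      using k orbit_swap_eq[OF a] swap_at_orbit_tuples[OF a k(1)] by simp
  next
    fix k a b assume k: "k \<in> tuples n \<beta>" and ab: "a \<in> {1..n}" "b \<in> {1..n}"
    obtain j where j: "\<forall>a\<in>{1..n}. orbit_rep (cyc_orbit mp k) a = (\<sigma> ^^ j) (k a)"
      using rep[OF k] by blast
    show "(orbit_rep (cyc_orbit mp k) a = orbit_rep (cyc_orbit mp k) b) = (k a = k b)"
      using j ab inj by simp
    show "((orbit_rep (cyc_orbit mp k) a, orbit_rep (cyc_orbit mp k) b) \<in> \<Gamma>) = ((k a, k b) \<in> \<Gamma>)"
      using j ab edge_iff by simp
  next
    fix a k assume a: "a \<in> {1..<n}" and k: "k \<in> tuples n \<beta>"
    show "swap_at a k \<in> tuples n \<beta>"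
      using a k by (rule swap_at_tuples)
    show "cyc_orbit mp (swap_at a k) = orbit_swap n \<sigma> a (cyc_orbit mp k)"
      using orbit_swap_eq[OF a sub[OF k]] by simp
  qed (use tuples_finite[OF \<beta>] J_finite sub in \<open>auto simp: tuple_orbits_def\<close>)
qed

text \<open>A covering with singleton fibres. Pushing forward along the inverse of \<sigma> sends
  the idempotent of \<open>k\<close> to that of its image under \<sigma>, which gives the
  automorphism one summand at a time.\<close>

lemma cover_shift:
  assumes \<beta>: "\<beta> \<in> orb"
  shows "klr_cover \<Gamma> n (tuples n \<beta>) (tuples n (\<beta> \<circ> \<sigma>)) (\<lambda>k. k) swap_at (tuple_map n (inv_into UNIV \<sigma>))"
proof
  show "finite (tuples n \<beta>)" "finite (tuples n (\<beta> \<circ> \<sigma>))"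
    using \<beta> orb_shift tuples_finite by blast+
  show "tuple_map n (inv_into UNIV \<sigma>) k \<in> tuples n (\<beta> \<circ> \<sigma>)" if k: "k \<in> tuples n \<beta>" for k
  proof -
    have "\<beta> = (\<beta> \<circ> \<sigma>) \<circ> inv_into UNIV \<sigma>"
      by (simp add: comp_assoc \<sigma>_inv) (simp add: o_def)
    then show ?thesis
      using tuple_map_tuples[OF bij_imp_bij_inv[OF bij], of k n "\<beta> \<circ> \<sigma>"] k by simp
  qed
  fix k a b assume "k \<in> tuples n \<beta>" and ab: "a \<in> {1..n}" "b \<in> {1..n}"
  show "(tuple_map n (inv_into UNIV \<sigma>) k a = tuple_map n (inv_into UNIV \<sigma>) k b) = (k a = k b)"
    using ab bij_is_inj[OF bij_imp_bij_inv[OF bij]] by (simp add: tuple_map_def inj_eq)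
  show "((tuple_map n (inv_into UNIV \<sigma>) k a, tuple_map n (inv_into UNIV \<sigma>) k b) \<in> \<Gamma>) = ((k a, k b) \<in> \<Gamma>)"
    using ab inv_edge_iff by (simp add: tuple_map_def)
qed (auto simp: swap_at_tuples tuple_map_swap_at)

end

section \<open>The algebra of an orbit of compositions and its automorphism\<close>

lemma alg_hom_funpow: "h \<in> alg_hom A A \<Longrightarrow> (h ^^ j) \<in> alg_hom A A"
proof (induction j)
  case 0
  show ?case by (rule alg_homI) simp_all
next
  case (Suc j)
  then show ?case using alg_hom_comp[of "h ^^ j" A A h A] by (simp add: o_def)
qed

context klr_orbit
begin

section \<open>Components and generators of the direct sum\<close>

lemma tuples_index: "\<beta> \<in> orb \<Longrightarrow> klr_index n (tuples n \<beta>) swap_at"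
  by unfold_locales (auto simp: tuples_finite swap_at_tuples)

lemma klr_alg_family:
  "\<beta> \<in> orb \<Longrightarrow> klr_family (klr_alg \<Gamma> n \<beta>) \<Gamma> n (tuples n \<beta>) (\<lambda>k. k) swap_at
    (\<lambda>k. klr_alg_gen \<Gamma> n \<beta> (E_gen k)) (\<lambda>a. klr_alg_gen \<Gamma> n \<beta> (Y_gen a))
    (\<lambda>a. klr_alg_gen \<Gamma> n \<beta> (Psi_gen a))"
  unfolding klr_alg_def klr_alg_gen_def by (rule klr_index.klr_presented_family[OF tuples_index])

lemma klr_alg_elems:
  assumes "\<beta> \<in> orb"
  shows "unital_algebra (klr_alg \<Gamma> n \<beta>)"
    and "k \<in> tuples n \<beta> \<Longrightarrow> klr_alg_gen \<Gamma> n \<beta> (E_gen k) \<in> carrier (klr_alg \<Gamma> n \<beta>)"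
    and "a \<in> {1..n} \<Longrightarrow> klr_alg_gen \<Gamma> n \<beta> (Y_gen a) \<in> carrier (klr_alg \<Gamma> n \<beta>)"
    and "a \<in> {1..<n} \<Longrightarrow> klr_alg_gen \<Gamma> n \<beta> (Psi_gen a) \<in> carrier (klr_alg \<Gamma> n \<beta>)"
proof -
  interpret D: klr_family "klr_alg \<Gamma> n \<beta>" \<Gamma> n "tuples n \<beta>" "\<lambda>k. k" swap_at
    "\<lambda>k. klr_alg_gen \<Gamma> n \<beta> (E_gen k)" "\<lambda>a. klr_alg_gen \<Gamma> n \<beta> (Y_gen a)"
    "\<lambda>a. klr_alg_gen \<Gamma> n \<beta> (Psi_gen a)"
    using assms by (rule klr_alg_family)
  show "unital_algebra (klr_alg \<Gamma> n \<beta>)"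
    by (rule D.unital_algebra_axioms)
  show "k \<in> tuples n \<beta> \<Longrightarrow> klr_alg_gen \<Gamma> n \<beta> (E_gen k) \<in> carrier (klr_alg \<Gamma> n \<beta>)"
    by (rule D.e_closed)
  show "a \<in> {1..n} \<Longrightarrow> klr_alg_gen \<Gamma> n \<beta> (Y_gen a) \<in> carrier (klr_alg \<Gamma> n \<beta>)"
    by (rule D.y_closed)
  show "a \<in> {1..<n} \<Longrightarrow> klr_alg_gen \<Gamma> n \<beta> (Psi_gen a) \<in> carrier (klr_alg \<Gamma> n \<beta>)"
    by (rule D.psi_closed)
qed

abbreviation "R \<equiv> orbit_klr_alg \<Gamma> n \<sigma> \<alpha>"
abbreviation "eR \<equiv> klr_e \<Gamma> n \<sigma> \<alpha>"
abbreviation "yR \<equiv> klr_y \<Gamma> n \<sigma> \<alpha>"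
abbreviation "psiR \<equiv> klr_psi \<Gamma> n \<sigma> \<alpha>"
abbreviation "I \<equiv> orbit_tuples n \<sigma> \<alpha>"

lemma R_simps:
  "carrier R = (\<Pi>\<^sub>E \<beta>\<in>orb. carrier (klr_alg \<Gamma> n \<beta>))"
  "mult R = (\<lambda>x y. \<lambda>\<beta>\<in>orb. x \<beta> \<otimes>\<^bsub>klr_alg \<Gamma> n \<beta>\<^esub> y \<beta>)"
  "one R = (\<lambda>\<beta>\<in>orb. \<one>\<^bsub>klr_alg \<Gamma> n \<beta>\<^esub>)"
  "zero R = (\<lambda>\<beta>\<in>orb. \<zero>\<^bsub>klr_alg \<Gamma> n \<beta>\<^esub>)"
  "add R = (\<lambda>x y. \<lambda>\<beta>\<in>orb. x \<beta> \<oplus>\<^bsub>klr_alg \<Gamma> n \<beta>\<^esub> y \<beta>)"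
  "smult R = (\<lambda>c x. \<lambda>\<beta>\<in>orb. c \<odot>\<^bsub>klr_alg \<Gamma> n \<beta>\<^esub> x \<beta>)"
  by (simp_all add: orbit_klr_alg_def prod_alg_simps)

lemma R_unital: "unital_algebra (R :: ('f::field, ('f, 'k) orbit_klr_elem) module)"
  unfolding orbit_klr_alg_def by (rule prod_alg_unital) (rule klr_alg_elems)

lemma R_component:
  "\<beta> \<in> orb \<Longrightarrow> (\<lambda>x. x \<beta>) \<in> alg_hom R (klr_alg \<Gamma> n \<beta>)"
  unfolding orbit_klr_alg_def by (rule prod_alg_component)

lemma R_finsum:
  "\<beta> \<in> orb \<Longrightarrow> finite S \<Longrightarrow> f \<in> S \<rightarrow> carrier R \<Longrightarrow>
    finsum R f S \<beta> = finsum (klr_alg \<Gamma> n \<beta>) (\<lambda>s. f s \<beta>) S"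
  by (rule alg_hom_finsum[OF R_component R_unital klr_alg_elems(1)])

lemma R_ext:
  "x \<in> carrier R \<Longrightarrow> z \<in> carrier R \<Longrightarrow> (\<And>\<beta>. \<beta> \<in> orb \<Longrightarrow> x \<beta> = z \<beta>) \<Longrightarrow> x = z"
  unfolding R_simps by (rule PiE_ext)

lemma zero_klr_alg: "\<beta> \<in> orb \<Longrightarrow> \<zero>\<^bsub>klr_alg \<Gamma> n \<beta>\<^esub> \<in> carrier (klr_alg \<Gamma> n \<beta>)"
proof -
  assume "\<beta> \<in> orb"
  then interpret unital_algebra "klr_alg \<Gamma> n \<beta>" by (rule klr_alg_elems)
  show ?thesis by (rule zero_closed)
qed

lemma eR_closed: "eR k \<in> carrier R"
  by (auto simp: R_simps klr_e_def klr_alg_elems zero_klr_alg)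

lemma yR_closed: "a \<in> {1..n} \<Longrightarrow> yR a \<in> carrier R"
  by (auto simp: R_simps klr_y_def intro: klr_alg_elems(3))

lemma psiR_closed: "a \<in> {1..<n} \<Longrightarrow> psiR a \<in> carrier R"
  by (auto simp: R_simps klr_psi_def intro: klr_alg_elems(4))

text \<open>The y and \<psi> spread over all summands, yet together with the e(k) they generate: the
  e(k) with \<open>k\<close> in \<open>tuples n \<beta>\<close> add up to the unit of the summand
  \<open>\<beta>\<close>, and multiplying by it cuts everything else off.\<close>

lemma R_induct [consumes 1, case_names one e y psi add mult smult]:
  fixes x :: "('f::field, 'k) orbit_klr_elem"
  assumes x: "x \<in> carrier R"
    and one: "P \<one>\<^bsub>R\<^esub>"
    and e: "\<And>k. k \<in> I \<Longrightarrow> P (eR k)"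
    and y: "\<And>a. a \<in> {1..n} \<Longrightarrow> P (yR a)"
    and psi: "\<And>a. a \<in> {1..<n} \<Longrightarrow> P (psiR a)"
    and add: "\<And>x z. x \<in> carrier R \<Longrightarrow> z \<in> carrier R \<Longrightarrow> P x \<Longrightarrow> P z \<Longrightarrow> P (x \<oplus>\<^bsub>R\<^esub> z)"
    and mult: "\<And>x z. x \<in> carrier R \<Longrightarrow> z \<in> carrier R \<Longrightarrow> P x \<Longrightarrow> P z \<Longrightarrow> P (x \<otimes>\<^bsub>R\<^esub> z)"
    and smult: "\<And>c x. x \<in> carrier R \<Longrightarrow> P x \<Longrightarrow> P (c \<odot>\<^bsub>R\<^esub> x)"
  shows "P x"
proof -
  let ?R = "R :: ('f, ('f, 'k) orbit_klr_elem) module"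
  interpret R: unital_algebra ?R by (rule R_unital)
  have zero: "P \<zero>\<^bsub>R\<^esub>"
    using smult[OF R.one_closed one, of 0] by simp
  have sum: "P (finsum R f S)" if "finite S" "f \<in> S \<rightarrow> carrier R" "\<And>s. s \<in> S \<Longrightarrow> P (f s)"
    for f :: "'s \<Rightarrow> ('f, 'k) orbit_klr_elem" and S
    using that
  proof (induction S)
    case (insert s S)
    then have "f \<in> S \<rightarrow> carrier R" "f s \<in> carrier R" "P (f s)" "P (finsum R f S)"
      by auto
    then show ?case
      using insert add by (simp add: R.finsum_insert)
  qed (simp add: zero)
  define emb where "emb \<beta> r = (\<lambda>\<beta>'\<in>orb. if \<beta>' = \<beta> then r else \<zero>\<^bsub>klr_alg \<Gamma> n \<beta>'\<^esub>)"
    for \<beta> and r :: "('f, 'k) klr_elem"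
  have emb_closed: "emb \<beta> r \<in> carrier R"
    if "\<beta> \<in> orb" "r \<in> carrier (klr_alg \<Gamma> n \<beta>)" for \<beta> r
    using that zero_klr_alg by (auto simp: emb_def R_simps)
  have emb: "P (emb \<beta> r)" if \<beta>: "\<beta> \<in> orb" and r: "r \<in> carrier (klr_alg \<Gamma> n \<beta>)" for \<beta> r
  proof -
    let ?g = "klr_alg_gen \<Gamma> n \<beta> :: _ \<Rightarrow> ('f, 'k) klr_elem"
    let ?D = "klr_alg \<Gamma> n \<beta> :: ('f, ('f, 'k) klr_elem) module"
    interpret D: klr_family ?D \<Gamma> n "tuples n \<beta>" "\<lambda>k. k" swap_at
      "\<lambda>k. ?g (E_gen k)" "\<lambda>a. ?g (Y_gen a)" "\<lambda>a. ?g (Psi_gen a)"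
      using \<beta> by (rule klr_alg_family)
    have other: "z \<otimes>\<^bsub>klr_alg \<Gamma> n \<beta>'\<^esub> \<zero>\<^bsub>klr_alg \<Gamma> n \<beta>'\<^esub> = \<zero>\<^bsub>klr_alg \<Gamma> n \<beta>'\<^esub>"
        "c \<odot>\<^bsub>klr_alg \<Gamma> n \<beta>'\<^esub> \<zero>\<^bsub>klr_alg \<Gamma> n \<beta>'\<^esub> = (\<zero>\<^bsub>klr_alg \<Gamma> n \<beta>'\<^esub> :: ('f, 'k) klr_elem)"
        "\<zero>\<^bsub>klr_alg \<Gamma> n \<beta>'\<^esub> \<oplus>\<^bsub>klr_alg \<Gamma> n \<beta>'\<^esub> \<zero>\<^bsub>klr_alg \<Gamma> n \<beta>'\<^esub> =
          (\<zero>\<^bsub>klr_alg \<Gamma> n \<beta>'\<^esub> :: ('f, 'k) klr_elem)"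
      if "\<beta>' \<in> orb" "z \<in> carrier (klr_alg \<Gamma> n \<beta>')" for \<beta>' c and z :: "('f, 'k) klr_elem"
    proof -
      interpret D': unital_algebra "klr_alg \<Gamma> n \<beta>' :: ('f, ('f, 'k) klr_elem) module"
        using that(1) by (rule klr_alg_elems)
      show "z \<otimes>\<^bsub>klr_alg \<Gamma> n \<beta>'\<^esub> \<zero>\<^bsub>klr_alg \<Gamma> n \<beta>'\<^esub> = \<zero>\<^bsub>klr_alg \<Gamma> n \<beta>'\<^esub>"
          "c \<odot>\<^bsub>klr_alg \<Gamma> n \<beta>'\<^esub> \<zero>\<^bsub>klr_alg \<Gamma> n \<beta>'\<^esub> = (\<zero>\<^bsub>klr_alg \<Gamma> n \<beta>'\<^esub> :: ('f, 'k) klr_elem)"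
          "\<zero>\<^bsub>klr_alg \<Gamma> n \<beta>'\<^esub> \<oplus>\<^bsub>klr_alg \<Gamma> n \<beta>'\<^esub> \<zero>\<^bsub>klr_alg \<Gamma> n \<beta>'\<^esub> =
            (\<zero>\<^bsub>klr_alg \<Gamma> n \<beta>'\<^esub> :: ('f, 'k) klr_elem)"
        using that(2) by simp_all
    qed
    \<comment> \<open>Multiplying an element concentrated in one summand only uses the component of
      \<open>z\<close> there. A generator of the summand may therefore be replaced by any element of
      the direct sum with this component.\<close>
    have emb_mult: "emb \<beta> (z \<beta> \<otimes>\<^bsub>?D\<^esub> r) = z \<otimes>\<^bsub>R\<^esub> emb \<beta> r" if "z \<in> carrier R" for z r
      using that \<beta> by (auto simp: emb_def R_simps other(1) PiE_iff intro!: restrict_ext)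
    have emb_add: "emb \<beta> (r \<oplus>\<^bsub>?D\<^esub> s) = emb \<beta> r \<oplus>\<^bsub>R\<^esub> emb \<beta> s" for r s
      using \<beta> other(3)[OF _ zero_klr_alg] by (auto simp: emb_def R_simps intro!: restrict_ext)
    have emb_smult: "emb \<beta> (c \<odot>\<^bsub>?D\<^esub> r) = c \<odot>\<^bsub>R\<^esub> emb \<beta> r" for c r
      using \<beta> other(2)[OF _ zero_klr_alg] by (auto simp: emb_def R_simps intro!: restrict_ext)
    have sub: "k \<in> I" if "k \<in> tuples n \<beta>" for k
      using that \<beta> by (auto simp: orbit_tuples_def)
    interpret P: presentation "klr_gens n (tuples n \<beta>)"
      "klr_free_relations \<Gamma> n (tuples n \<beta>) (\<lambda>k. k) swap_at"
      by (rule klr_index.klr_presentation[OF tuples_index[OF \<beta>]])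
    show ?thesis
      using r
    proof (induction r rule: P.presented_induct[folded klr_alg_def klr_alg_gen_def, consumes 1,
          case_names one add smult gen])
      case one
      \<comment> \<open>In the summand \<open>\<beta>\<close> the sum of the idempotents is the
        unit; in another summand all of them vanish, since a tuple determines its
        composition.\<close>
      have "emb \<beta> \<one>\<^bsub>?D\<^esub> = finsum ?R eR (tuples n \<beta>)"
      proof (rule R_ext)
        fix \<beta>'
        let ?D' = "klr_alg \<Gamma> n \<beta>' :: ('f, ('f, 'k) klr_elem) module"
        assume \<beta>': "\<beta>' \<in> orb"
        interpret D': klr_family ?D' \<Gamma> n "tuples n \<beta>'" "\<lambda>k. k" swap_at
          "\<lambda>k. klr_alg_gen \<Gamma> n \<beta>' (E_gen k)"
          "\<lambda>a. klr_alg_gen \<Gamma> n \<beta>' (Y_gen a)" "\<lambda>a. klr_alg_gen \<Gamma> n \<beta>' (Psi_gen a)"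
          using \<beta>' by (rule klr_alg_family)
        have "finsum ?R eR (tuples n \<beta>) \<beta>' = finsum ?D' (\<lambda>k. eR k \<beta>') (tuples n \<beta>)"
          using \<beta>' tuples_finite[OF \<beta>] eR_closed by (intro R_finsum) auto
        also have "\<dots> = (if \<beta>' = \<beta> then \<one>\<^bsub>?D'\<^esub> else \<zero>\<^bsub>?D'\<^esub>)"
        proof (cases "\<beta>' = \<beta>")
          case True
          have "finsum ?D' (\<lambda>k. eR k \<beta>') (tuples n \<beta>) =
              finsum ?D' (\<lambda>k. klr_alg_gen \<Gamma> n \<beta>' (E_gen k)) (tuples n \<beta>')"
            using \<beta>' D'.e_closed True by (intro D'.finsum_cong') (auto simp: klr_e_def)
          then show ?thesis
            using D'.sum_e True by simp
        next
          case False
          then have "k \<notin> tuples n \<beta>'" if "k \<in> tuples n \<beta>" for k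
            using tuples_disjoint[OF that] by blast
          then have "finsum ?D' (\<lambda>k. eR k \<beta>') (tuples n \<beta>) = \<zero>\<^bsub>?D'\<^esub>"
            using \<beta>' by (intro D'.add.finprod_one_eqI) (simp add: klr_e_def)
          then show ?thesis
            using False by simp
        qed
        finally show "emb \<beta> \<one>\<^bsub>?D\<^esub> \<beta>' = finsum ?R eR (tuples n \<beta>) \<beta>'"
          using \<beta>' by (simp add: emb_def)
      qed (use emb_closed[OF \<beta> D.one_closed] eR_closed in \<open>auto intro!: R.finsum_closed\<close>)
      moreover have "P (finsum ?R eR (tuples n \<beta>))"
        using tuples_finite[OF \<beta>] eR_closed e sub by (intro sum) auto
      ultimately show ?case
        by simp
    next
      case (add f h)
      then show ?case
        using emb_closed[OF \<beta>] assms(6) by (simp add: emb_add)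
    next
      case (smult c f)
      then show ?case
        using emb_closed[OF \<beta>] assms(8) by (simp add: emb_smult)
    next
      case (gen x f)
      from gen(1) consider (E) k where "x = E_gen k" "k \<in> tuples n \<beta>"
        | (Y) a where "x = Y_gen a" "a \<in> {1..n}" | (Psi) a where "x = Psi_gen a" "a \<in> {1..<n}"
        by (auto simp: klr_gens_def)
      \<comment> \<open>The lift of a generator of the summand: an idempotent, a y or a \<psi> of
        the direct sum, for which \<open>P\<close> is known.\<close>
      then obtain z where "z \<in> carrier R" "P z" "z \<beta> = ?g x"
      proof cases
        case E
        show ?thesis
          by (rule that[of "eR k"]) (use E \<beta> eR_closed e[OF sub] in \<open>auto simp: klr_e_def\<close>)
      next
        case Y
        show ?thesis
          by (rule that[of "yR a"]) (use Y \<beta> yR_closed y in \<open>auto simp: klr_y_def\<close>)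
      next
        case Psi
        show ?thesis
          by (rule that[of "psiR a"]) (use Psi \<beta> psiR_closed psi in \<open>auto simp: klr_psi_def\<close>)
      qed
      then show ?case
        using emb_mult[of z f] mult[OF _ emb_closed[OF \<beta> gen(2)] _ gen(3), of z] by simp
    qed
  qed
  have xb: "x \<beta> \<in> carrier (klr_alg \<Gamma> n \<beta>)" if "\<beta> \<in> orb" for \<beta>
    using x that by (auto simp: R_simps)
  have "x = (\<Oplus>\<^bsub>R\<^esub>\<beta>\<in>orb. emb \<beta> (x \<beta>))"
  proof (rule R_ext)
    fix \<beta>' assume \<beta>': "\<beta>' \<in> orb"
    interpret D: unital_algebra "klr_alg \<Gamma> n \<beta>' :: ('f, ('f, 'k) klr_elem) module"
      using \<beta>' by (rule klr_alg_elems)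
    have "(\<Oplus>\<^bsub>R\<^esub>\<beta>\<in>orb. emb \<beta> (x \<beta>)) \<beta>' = finsum (klr_alg \<Gamma> n \<beta>') (\<lambda>\<beta>. emb \<beta> (x \<beta>) \<beta>') orb"
      using \<beta>' orb_finite emb_closed xb by (intro R_finsum) auto
    also have "\<dots> = finsum (klr_alg \<Gamma> n \<beta>') (\<lambda>\<beta>. if \<beta>' = \<beta> then x \<beta> else \<zero>\<^bsub>klr_alg \<Gamma> n \<beta>'\<^esub>) orb"
      using \<beta>' xb by (intro D.finsum_cong') (auto simp: emb_def)
    also have "\<dots> = finsum (klr_alg \<Gamma> n \<beta>') (\<lambda>\<beta>. if \<beta>' = \<beta> then x \<beta>' else \<zero>\<^bsub>klr_alg \<Gamma> n \<beta>'\<^esub>) orb"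
      using \<beta>' xb by (intro D.finsum_cong') auto
    also have "\<dots> = x \<beta>'"
      using \<beta>' xb orb_finite by (intro D.finsum_singleton) auto
    finally show "x \<beta>' = (\<Oplus>\<^bsub>R\<^esub>\<beta>\<in>orb. emb \<beta> (x \<beta>)) \<beta>'"
      by simp
  qed (use x emb_closed xb in \<open>auto intro!: R.finsum_closed\<close>)
  moreover have "P (\<Oplus>\<^bsub>R\<^esub>\<beta>\<in>orb. emb \<beta> (x \<beta>))"
    using orb_finite emb_closed emb xb by (intro sum) auto
  ultimately show ?thesis
    by simp
qed

lemma R_hom_eq:
  assumes h: "h \<in> alg_hom R B" and h': "h' \<in> alg_hom R B"
    and e: "\<And>k. k \<in> I \<Longrightarrow> h (eR k) = h' (eR k)"
    and y: "\<And>a. a \<in> {1..n} \<Longrightarrow> h (yR a) = h' (yR a)"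
    and psi: "\<And>a. a \<in> {1..<n} \<Longrightarrow> h (psiR a) = h' (psiR a)"
    and x: "x \<in> carrier R"
  shows "h x = h' x"
  using x
  by (induction x rule: R_induct)
    (simp_all add: e y psi alg_hom_one[OF h] alg_hom_one[OF h'] alg_hom_add[OF h] alg_hom_add[OF h']
      alg_hom_mult[OF h] alg_hom_mult[OF h'] alg_hom_smult[OF h] alg_hom_smult[OF h'])

text \<open>The map leads from the summand \<open>\<beta> \<circ> \<sigma>\<close> to the summand
  \<open>\<beta>\<close>, in accordance with the effect of \<sigma> on tuples.\<close>

lemma klr_alg_shift:
  assumes \<beta>: "\<beta> \<in> orb"
  obtains t :: "('f::field, 'k) klr_elem \<Rightarrow> ('f, 'k) klr_elem"
  where "t \<in> alg_hom (klr_alg \<Gamma> n (\<beta> \<circ> \<sigma>)) (klr_alg \<Gamma> n \<beta>)"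
    and "\<And>k. k \<in> tuples n (\<beta> \<circ> \<sigma>) \<Longrightarrow>
      t (klr_alg_gen \<Gamma> n (\<beta> \<circ> \<sigma>) (E_gen k)) = klr_alg_gen \<Gamma> n \<beta> (E_gen (mp k))"
    and "\<And>a. a \<in> {1..n} \<Longrightarrow>
      t (klr_alg_gen \<Gamma> n (\<beta> \<circ> \<sigma>) (Y_gen a)) = klr_alg_gen \<Gamma> n \<beta> (Y_gen a)"
    and "\<And>a. a \<in> {1..<n} \<Longrightarrow>
      t (klr_alg_gen \<Gamma> n (\<beta> \<circ> \<sigma>) (Psi_gen a)) = klr_alg_gen \<Gamma> n \<beta> (Psi_gen a)"
proof -
  interpret C: klr_cover \<Gamma> n "tuples n \<beta>" "tuples n (\<beta> \<circ> \<sigma>)" "\<lambda>k. k" swap_at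
    "tuple_map n (inv_into UNIV \<sigma>)"
    using \<beta> by (rule cover_shift)
  interpret D: klr_family "klr_alg \<Gamma> n \<beta> :: ('f, ('f, 'k) klr_elem) module" \<Gamma> n
    "tuples n \<beta>" "\<lambda>k. k" swap_at "\<lambda>k. klr_alg_gen \<Gamma> n \<beta> (E_gen k)"
    "\<lambda>a. klr_alg_gen \<Gamma> n \<beta> (Y_gen a)" "\<lambda>a. klr_alg_gen \<Gamma> n \<beta> (Psi_gen a)"
    using \<beta> by (rule klr_alg_family)
  have fib: "C.fibre k = {mp k}" if k: "k \<in> tuples n (\<beta> \<circ> \<sigma>)" for k
  proof -
    have "l = mp (tuple_map n (inv_into UNIV \<sigma>) l)" if "l \<in> tuples n \<beta>" for l
      using tuples_extensional[OF that] by (simp add: tuple_map_comp \<sigma>_inv tuple_map_id)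
    moreover have "tuple_map n (inv_into UNIV \<sigma>) (mp k) = k"
      using tuples_extensional[OF k] by (simp add: tuple_map_comp \<sigma>_inv tuple_map_id)
    ultimately show ?thesis
      using tuple_map_tuples[OF bij k] unfolding C.fibre_def by blast
  qed
  obtain t :: "('f, 'k) klr_elem \<Rightarrow> ('f, 'k) klr_elem"
    where t: "t \<in> alg_hom (klr_alg \<Gamma> n (\<beta> \<circ> \<sigma>)) (klr_alg \<Gamma> n \<beta>)"
      "\<And>k. k \<in> tuples n (\<beta> \<circ> \<sigma>) \<Longrightarrow> t (klr_alg_gen \<Gamma> n (\<beta> \<circ> \<sigma>) (E_gen k)) =
        finsum (klr_alg \<Gamma> n \<beta>) (\<lambda>k. klr_alg_gen \<Gamma> n \<beta> (E_gen k)) (C.fibre k)"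
      "\<And>a. a \<in> {1..n} \<Longrightarrow>
        t (klr_alg_gen \<Gamma> n (\<beta> \<circ> \<sigma>) (Y_gen a)) = klr_alg_gen \<Gamma> n \<beta> (Y_gen a)"
      "\<And>a. a \<in> {1..<n} \<Longrightarrow>
        t (klr_alg_gen \<Gamma> n (\<beta> \<circ> \<sigma>) (Psi_gen a)) = klr_alg_gen \<Gamma> n \<beta> (Psi_gen a)"
    using C.J.klr_universal[OF C.klr_family_push[OF D.klr_family_axioms],
        folded klr_alg_def klr_alg_gen_def] by blast
  have "t (klr_alg_gen \<Gamma> n (\<beta> \<circ> \<sigma>) (E_gen k)) = klr_alg_gen \<Gamma> n \<beta> (E_gen (mp k))"
    if k: "k \<in> tuples n (\<beta> \<circ> \<sigma>)" for k
    using t(2)[OF k] D.e_closed[OF tuple_map_tuples[OF bij k]] by (simp add: fib[OF k] D.finsum_insert)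
  then show thesis
    using that t by blast
qed

text \<open>The shifts between summands assemble to an endomorphism. Its bijectivity needs no
  separate construction of an inverse, since it has finite order.\<close>

lemma klr_sigma_exists:
  "\<exists>\<tau> :: ('f::field, 'k) orbit_klr_elem \<Rightarrow> ('f, 'k) orbit_klr_elem. is_klr_sigma \<Gamma> n \<sigma> \<alpha> \<tau>"
proof -
  let ?R = "R :: ('f, ('f, 'k) orbit_klr_elem) module"
  let ?D = "\<lambda>\<beta>. klr_alg \<Gamma> n \<beta> :: ('f, ('f, 'k) klr_elem) module"
  have "\<forall>\<beta>\<in>orb. \<exists>t. t \<in> alg_hom (?D (\<beta> \<circ> \<sigma>)) (?D \<beta>) \<and>
      (\<forall>k\<in>tuples n (\<beta> \<circ> \<sigma>).
        t (klr_alg_gen \<Gamma> n (\<beta> \<circ> \<sigma>) (E_gen k)) = klr_alg_gen \<Gamma> n \<beta> (E_gen (mp k))) \<and>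
      (\<forall>a\<in>{1..n}. t (klr_alg_gen \<Gamma> n (\<beta> \<circ> \<sigma>) (Y_gen a)) = klr_alg_gen \<Gamma> n \<beta> (Y_gen a)) \<and>
      (\<forall>a\<in>{1..<n}. t (klr_alg_gen \<Gamma> n (\<beta> \<circ> \<sigma>) (Psi_gen a)) = klr_alg_gen \<Gamma> n \<beta> (Psi_gen a))"
  proof
    fix \<beta> assume "\<beta> \<in> orb"
    then show "\<exists>t. t \<in> alg_hom (?D (\<beta> \<circ> \<sigma>)) (?D \<beta>) \<and>
      (\<forall>k\<in>tuples n (\<beta> \<circ> \<sigma>).
        t (klr_alg_gen \<Gamma> n (\<beta> \<circ> \<sigma>) (E_gen k)) = klr_alg_gen \<Gamma> n \<beta> (E_gen (mp k))) \<and>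
      (\<forall>a\<in>{1..n}. t (klr_alg_gen \<Gamma> n (\<beta> \<circ> \<sigma>) (Y_gen a)) = klr_alg_gen \<Gamma> n \<beta> (Y_gen a)) \<and>
      (\<forall>a\<in>{1..<n}. t (klr_alg_gen \<Gamma> n (\<beta> \<circ> \<sigma>) (Psi_gen a)) = klr_alg_gen \<Gamma> n \<beta> (Psi_gen a))"
      by (rule klr_alg_shift) blast
  qed
  from bchoice[OF this] obtain t where t:
      "\<And>\<beta>. \<beta> \<in> orb \<Longrightarrow> t \<beta> \<in> alg_hom (?D (\<beta> \<circ> \<sigma>)) (?D \<beta>)"
    and t_E: "\<And>\<beta> k. \<beta> \<in> orb \<Longrightarrow> k \<in> tuples n (\<beta> \<circ> \<sigma>) \<Longrightarrow>
        t \<beta> (klr_alg_gen \<Gamma> n (\<beta> \<circ> \<sigma>) (E_gen k)) = klr_alg_gen \<Gamma> n \<beta> (E_gen (mp k))"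
    and t_Y: "\<And>\<beta> a. \<beta> \<in> orb \<Longrightarrow> a \<in> {1..n} \<Longrightarrow>
        t \<beta> (klr_alg_gen \<Gamma> n (\<beta> \<circ> \<sigma>) (Y_gen a)) = klr_alg_gen \<Gamma> n \<beta> (Y_gen a)"
    and t_Psi: "\<And>\<beta> a. \<beta> \<in> orb \<Longrightarrow> a \<in> {1..<n} \<Longrightarrow>
        t \<beta> (klr_alg_gen \<Gamma> n (\<beta> \<circ> \<sigma>) (Psi_gen a)) = klr_alg_gen \<Gamma> n \<beta> (Psi_gen a)"
    by blast
  define \<tau> where "\<tau> = (\<lambda>x\<in>carrier ?R. \<lambda>\<beta>\<in>orb. t \<beta> (x (\<beta> \<circ> \<sigma>)))"
  have comp: "x (\<beta> \<circ> \<sigma>) \<in> carrier (?D (\<beta> \<circ> \<sigma>))" if "x \<in> carrier ?R" "\<beta> \<in> orb" for x \<beta>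
    using that orb_shift by (auto simp: R_simps)
  interpret R: unital_algebra ?R by (rule R_unital)
  have hom: "\<tau> \<in> alg_hom ?R ?R"
  proof (rule alg_homI)
    fix x assume x: "x \<in> carrier ?R"
    show "\<tau> x \<in> carrier ?R"
      using x comp alg_hom_closed[OF t] by (auto simp: \<tau>_def R_simps(1))
    fix z assume z: "z \<in> carrier ?R"
    have "x \<oplus>\<^bsub>?R\<^esub> z \<in> carrier ?R" "x \<otimes>\<^bsub>?R\<^esub> z \<in> carrier ?R"
      using x z by simp_all
    then show "\<tau> (x \<oplus>\<^bsub>?R\<^esub> z) = \<tau> x \<oplus>\<^bsub>?R\<^esub> \<tau> z" "\<tau> (x \<otimes>\<^bsub>?R\<^esub> z) = \<tau> x \<otimes>\<^bsub>?R\<^esub> \<tau> z"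
      using x z comp orb_shift alg_hom_add[OF t] alg_hom_mult[OF t]
      by (simp_all add: \<tau>_def R_simps(2,5) cong: restrict_cong)
  next
    show "\<tau> \<one>\<^bsub>?R\<^esub> = \<one>\<^bsub>?R\<^esub>"
      using R.one_closed orb_shift alg_hom_one[OF t] by (simp add: \<tau>_def R_simps(3) cong: restrict_cong)
  next
    fix c x assume x: "x \<in> carrier ?R"
    then have "c \<odot>\<^bsub>?R\<^esub> x \<in> carrier ?R"
      by simp
    then show "\<tau> (c \<odot>\<^bsub>?R\<^esub> x) = c \<odot>\<^bsub>?R\<^esub> \<tau> x"
      using x comp orb_shift alg_hom_smult[OF t] by (simp add: \<tau>_def R_simps(6) cong: restrict_cong)
  qed
  have \<tau>_e: "\<tau> (eR k) = eR (mp k)" if k: "k \<in> I" for k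
  proof (rule R_ext[OF alg_hom_closed[OF hom eR_closed] eR_closed])
    fix \<beta> assume \<beta>: "\<beta> \<in> orb"
    \<comment> \<open>Covers the summands in which e(k) has component zero; by
      \<open>mp_tuples_iff\<close> these correspond on the two sides.\<close>
    have "t \<beta> \<zero>\<^bsub>?D (\<beta> \<circ> \<sigma>)\<^esub> = \<zero>\<^bsub>?D \<beta>\<^esub>"
      using alg_hom_zero[OF t] klr_alg_elems(1) orb_shift \<beta> by blast
    then show "\<tau> (eR k) \<beta> = eR (mp k) \<beta>"
      using \<beta> orb_shift[OF \<beta>] t_E[OF \<beta>] mp_tuples_iff[OF orbit_tuples_extensional[OF k]]
      by (simp add: \<tau>_def eR_closed) (simp add: klr_e_def)
  qed
  have \<tau>_y: "\<tau> (yR a) = yR a" if a: "a \<in> {1..n}" for a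
    using t_Y[OF _ a] orb_shift
    by (simp add: \<tau>_def yR_closed[OF a]) (simp add: klr_y_def cong: restrict_cong)
  have \<tau>_psi: "\<tau> (psiR a) = psiR a" if a: "a \<in> {1..<n}" for a
    using t_Psi[OF _ a] orb_shift
    by (simp add: \<tau>_def psiR_closed[OF a]) (simp add: klr_psi_def cong: restrict_cong)
  \<comment> \<open>The power fixes y and \<psi>, and it fixes e(k) because \<sigma> has period
    \<open>p\<close> on tuples; homomorphisms that agree on generators are equal. As
    \<open>p\<close> is positive, \<open>\<tau> ^^ (p - 1)\<close> is then the inverse.\<close>
  have pow: "(\<tau> ^^ p) x = x" if "x \<in> carrier ?R" for x
  proof (rule R_hom_eq[OF alg_hom_funpow[OF hom] _ _ _ _ that])
    show "(\<lambda>x. x) \<in> alg_hom ?R ?R"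
      by (rule alg_homI) simp_all
    show "(\<tau> ^^ p) (eR k) = eR k" if k: "k \<in> I" for k
    proof -
      have "(\<tau> ^^ j) (eR k) = eR ((mp ^^ j) k) \<and> (mp ^^ j) k \<in> I" for j
        using k by (induction j) (auto simp: \<tau>_e mp_orbit_tuples)
      then show ?thesis
        using tuple_period[OF orbit_tuples_extensional[OF k]] by simp
    qed
    show "(\<tau> ^^ p) (yR a) = yR a" if a: "a \<in> {1..n}" for a
      by (induction p) (simp_all add: \<tau>_y[OF a])
    show "(\<tau> ^^ p) (psiR a) = psiR a" if a: "a \<in> {1..<n}" for a
      by (induction p) (simp_all add: \<tau>_psi[OF a])
  qed
  have "bij_betw \<tau> (carrier ?R) (carrier ?R)"
  proof (rule bij_betw_byWitness[of _ "\<tau> ^^ (p - 1)"])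
    have "\<tau> ^^ p = \<tau> ^^ (p - 1) \<circ> \<tau>" "\<tau> ^^ p = \<tau> \<circ> \<tau> ^^ (p - 1)"
      using p funpow_Suc_right[of "p - 1" \<tau>] funpow.simps(2)[of "p - 1" \<tau>] by simp_all
    then show "\<forall>x\<in>carrier ?R. (\<tau> ^^ (p - 1)) (\<tau> x) = x" "\<forall>x\<in>carrier ?R. \<tau> ((\<tau> ^^ (p - 1)) x) = x"
      using pow by (metis comp_apply)+
  qed (use alg_hom_closed[OF hom] alg_hom_closed[OF alg_hom_funpow[OF hom]] in blast)+
  then have "is_klr_sigma \<Gamma> n \<sigma> \<alpha> \<tau>"
    unfolding is_klr_sigma_def alg_iso_def using hom \<tau>_e \<tau>_y \<tau>_psi by (simp add: \<tau>_def)
  then show ?thesis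
    by - (rule exI[where x = \<tau>])
qed

lemma klr_sigma_unique:
  fixes \<tau> \<tau>' :: "('f::field, 'k) orbit_klr_elem \<Rightarrow> ('f, 'k) orbit_klr_elem"
  assumes \<tau>: "is_klr_sigma \<Gamma> n \<sigma> \<alpha> \<tau>" "is_klr_sigma \<Gamma> n \<sigma> \<alpha> \<tau>'"
  shows "\<tau> = \<tau>'"
proof (rule extensionalityI)
  note \<tau>s = \<tau>[unfolded is_klr_sigma_def alg_iso_def]
  show "\<tau> \<in> extensional (carrier R)" "\<tau>' \<in> extensional (carrier R)"
    using \<tau>s by blast+
  show "\<tau> x = \<tau>' x" if "x \<in> carrier R" for x
    by (rule R_hom_eq[OF _ _ _ _ _ that]) (use \<tau>s in auto)
qed

lemma klr_sigma:
  "is_klr_sigma \<Gamma> n \<sigma> \<alpha> (klr_sigma \<Gamma> n \<sigma> \<alpha> :: ('f::field, 'k) orbit_klr_elem \<Rightarrow> ('f, 'k) orbit_klr_elem)"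
proof -
  obtain \<tau> :: "('f, 'k) orbit_klr_elem \<Rightarrow> ('f, 'k) orbit_klr_elem"
    where \<tau>: "is_klr_sigma \<Gamma> n \<sigma> \<alpha> \<tau>"
    by (rule exE[OF klr_sigma_exists])
  have "klr_sigma \<Gamma> n \<sigma> \<alpha> = \<tau>"
    unfolding klr_sigma_def by (rule the_equality[of "is_klr_sigma \<Gamma> n \<sigma> \<alpha>" \<tau>, OF \<tau>])
      (rule klr_sigma_unique[OF _ \<tau>])
  then show ?thesis
    using \<tau> by simp
qed

end

section \<open>The presentation of the fixed point algebra\<close>

lemma (in unital_algebra) finsum_in:
  assumes "finite S" "f \<in> S \<rightarrow> carrier A" "\<zero> \<in> U" "\<And>s. s \<in> S \<Longrightarrow> f s \<in> U"
    and "\<And>x z. x \<in> U \<Longrightarrow> z \<in> U \<Longrightarrow> x \<oplus> z \<in> U"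
  shows "finsum A f S \<in> U"
  using assms(1,2,4)
proof (induction S)
  case (insert s S)
  then have "f \<in> S \<rightarrow> carrier A" "f s \<in> carrier A"
    by auto
  then show ?case
    using insert assms(5) by (simp add: finsum_insert)
qed (simp add: assms(3))

context klr_orbit
begin

text \<open>\<open>k\<close> and \<open>l\<close> are arbitrary, because \<open>eR k\<close> has
  component zero in every summand to which \<open>k\<close> does not belong. This spares side
  conditions when idempotents are moved around.\<close>

lemma R_relations:
  fixes k l :: "nat \<Rightarrow> 'k"
  defines "R' \<equiv> R :: ('f::field, ('f, 'k) orbit_klr_elem) module"
  shows "eR l \<otimes>\<^bsub>R'\<^esub> eR k = (if l = k then eR k else \<zero>\<^bsub>R'\<^esub>)"
    and "a \<in> {1..n} \<Longrightarrow> yR a \<otimes>\<^bsub>R'\<^esub> eR k = eR k \<otimes>\<^bsub>R'\<^esub> yR a"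
    and "a \<in> {1..<n} \<Longrightarrow> psiR a \<otimes>\<^bsub>R'\<^esub> eR k = eR (swap_at a k) \<otimes>\<^bsub>R'\<^esub> psiR a"
proof -
  interpret R: unital_algebra R'
    unfolding R'_def by (rule R_unital)
  have e: "eR k \<in> carrier R'" for k
    unfolding R'_def by (rule eR_closed)
  have y: "yR a \<in> carrier R'" if "a \<in> {1..n}"
    unfolding R'_def using that by (rule yR_closed)
  have psi: "psiR a \<in> carrier R'" if "a \<in> {1..<n}"
    unfolding R'_def using that by (rule psiR_closed)
  have eqI: "x = z" if "x \<in> carrier R'" "z \<in> carrier R'" "\<And>\<beta>. \<beta> \<in> orb \<Longrightarrow> x \<beta> = z \<beta>" for x z
    using that unfolding R'_def by (rule R_ext)
  have comp: "(eR l \<otimes>\<^bsub>R'\<^esub> eR k) \<beta> = (if l = k then eR k else \<zero>\<^bsub>R'\<^esub>) \<beta>"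
      "a \<in> {1..n} \<Longrightarrow> (yR a \<otimes>\<^bsub>R'\<^esub> eR k) \<beta> = (eR k \<otimes>\<^bsub>R'\<^esub> yR a) \<beta>"
      "a \<in> {1..<n} \<Longrightarrow> (psiR a \<otimes>\<^bsub>R'\<^esub> eR k) \<beta> = (eR (swap_at a k) \<otimes>\<^bsub>R'\<^esub> psiR a) \<beta>"
    if \<beta>: "\<beta> \<in> orb" for \<beta>
  proof -
    let ?D = "klr_alg \<Gamma> n \<beta> :: ('f, ('f, 'k) klr_elem) module"
    interpret D: klr_family ?D \<Gamma> n "tuples n \<beta>" "\<lambda>k. k" swap_at
      "\<lambda>k. klr_alg_gen \<Gamma> n \<beta> (E_gen k)" "\<lambda>a. klr_alg_gen \<Gamma> n \<beta> (Y_gen a)"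
      "\<lambda>a. klr_alg_gen \<Gamma> n \<beta> (Psi_gen a)"
      using \<beta> by (rule klr_alg_family)
    show "(eR l \<otimes>\<^bsub>R'\<^esub> eR k) \<beta> = (if l = k then eR k else \<zero>\<^bsub>R'\<^esub>) \<beta>"
      using \<beta> D.e_e[of l k] D.e_closed[of k] D.e_closed[of l]
      by (cases "l = k") (simp_all add: R'_def R_simps klr_e_def)
    show "(yR a \<otimes>\<^bsub>R'\<^esub> eR k) \<beta> = (eR k \<otimes>\<^bsub>R'\<^esub> yR a) \<beta>" if "a \<in> {1..n}"
      using \<beta> that D.y_e[of a k] D.y_closed[of a] by (simp add: R'_def R_simps klr_e_def klr_y_def)
    show "(psiR a \<otimes>\<^bsub>R'\<^esub> eR k) \<beta> = (eR (swap_at a k) \<otimes>\<^bsub>R'\<^esub> psiR a) \<beta>" if a: "a \<in> {1..<n}"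
    proof -
      have "swap_at a k \<in> tuples n \<beta> \<longleftrightarrow> k \<in> tuples n \<beta>"
        using swap_at_tuples[OF a] swap_at_swap_at[of a k] by metis
      then show ?thesis
        using \<beta> a D.psi_e[of a k] D.psi_closed[of a]
        by (simp add: R'_def R_simps klr_e_def klr_psi_def)
    qed
  qed
  show "eR l \<otimes>\<^bsub>R'\<^esub> eR k = (if l = k then eR k else \<zero>\<^bsub>R'\<^esub>)"
    by (rule eqI) (use e comp(1) in auto)
  show "yR a \<otimes>\<^bsub>R'\<^esub> eR k = eR k \<otimes>\<^bsub>R'\<^esub> yR a" if "a \<in> {1..n}"
    by (rule eqI) (use e y that comp(2) in auto)
  show "psiR a \<otimes>\<^bsub>R'\<^esub> eR k = eR (swap_at a k) \<otimes>\<^bsub>R'\<^esub> psiR a" if "a \<in> {1..<n}"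
    by (rule eqI) (use e psi that comp(3) in auto)
qed

text \<open>The left ideal generated by an idempotent \<open>e(k)\<close>: the generators \<open>y\<^sub>a\<close> and \<open>\<psi>\<^sub>a\<close> suffice,
  since idempotents can be moved to the right through them.\<close>

inductive_set left_span :: "(nat \<Rightarrow> 'k) \<Rightarrow> ('f::field, 'k) orbit_klr_elem set"
  for k :: "nat \<Rightarrow> 'k" where
  e: "eR k \<in> left_span k"
| y: "a \<in> {1..n} \<Longrightarrow> u \<in> left_span k \<Longrightarrow> yR a \<otimes>\<^bsub>R\<^esub> u \<in> left_span k"
| psi: "a \<in> {1..<n} \<Longrightarrow> u \<in> left_span k \<Longrightarrow> psiR a \<otimes>\<^bsub>R\<^esub> u \<in> left_span k"
| add: "u \<in> left_span k \<Longrightarrow> v \<in> left_span k \<Longrightarrow> u \<oplus>\<^bsub>R\<^esub> v \<in> left_span k"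
| smult: "u \<in> left_span k \<Longrightarrow> c \<odot>\<^bsub>R\<^esub> u \<in> left_span k"

lemma left_span_closed:
  fixes u :: "('f::field, 'k) orbit_klr_elem"
  assumes "u \<in> left_span k"
  shows "u \<in> carrier R"
proof -
  interpret R: unital_algebra "R :: ('f, ('f, 'k) orbit_klr_elem) module" by (rule R_unital)
  show ?thesis
    using assms by induction (simp_all add: eR_closed yR_closed psiR_closed)
qed

lemma left_span_zero: "\<zero>\<^bsub>R\<^esub> \<in> (left_span k :: ('f::field, 'k) orbit_klr_elem set)"
proof -
  interpret R: unital_algebra "R :: ('f, ('f, 'k) orbit_klr_elem) module" by (rule R_unital)
  have "0 \<odot>\<^bsub>R\<^esub> eR k \<in> (left_span k :: ('f, 'k) orbit_klr_elem set)"
    by (intro left_span.smult left_span.e)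
  then show ?thesis
    by (simp add: eR_closed)
qed

lemma left_span_e:
  fixes u :: "('f::field, 'k) orbit_klr_elem"
  assumes "u \<in> left_span k"
  shows "eR l \<otimes>\<^bsub>R\<^esub> u \<in> left_span k"
proof -
  interpret R: unital_algebra "R :: ('f, ('f, 'k) orbit_klr_elem) module" by (rule R_unital)
  show ?thesis
    using assms
  \<comment> \<open>\<open>l\<close> has to vary: moving past \<open>psiR a\<close> turns it into
    \<open>swap_at a l\<close>. At the end the idempotent meets \<open>eR k\<close> and is absorbed
    or gives zero.\<close>
  proof (induction arbitrary: l)
    case e
    show ?case
      by (simp add: R_relations(1) left_span.e left_span_zero)
  next
    case (y a u)
    have "eR l \<otimes>\<^bsub>R\<^esub> (yR a \<otimes>\<^bsub>R\<^esub> u) = yR a \<otimes>\<^bsub>R\<^esub> (eR l \<otimes>\<^bsub>R\<^esub> u)"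
      by (simp add: R.m_assoc[symmetric] eR_closed yR_closed[OF y(1)] R_relations(2)[OF y(1)]
          left_span_closed[OF y(2)])
    then show ?case
      by (simp add: left_span.y[OF y(1) y(3)])
  next
    case (psi a u)
    have "eR l \<otimes>\<^bsub>R\<^esub> (psiR a \<otimes>\<^bsub>R\<^esub> u) = psiR a \<otimes>\<^bsub>R\<^esub> (eR (swap_at a l) \<otimes>\<^bsub>R\<^esub> u)"
      by (simp add: R.m_assoc[symmetric] eR_closed psiR_closed[OF psi(1)] R_relations(3)[OF psi(1)]
          left_span_closed[OF psi(2)])
    then show ?case
      by (simp add: left_span.psi[OF psi(1) psi(3)])
  next
    case (add u v)
    then show ?case
      by (simp add: R.r_distr eR_closed left_span_closed left_span.add)
  next
    case (smult u c)
    then show ?case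
      by (simp add: R.smult_mult_right[symmetric] eR_closed left_span_closed left_span.smult)
  qed
qed

lemma left_span_left_ideal:
  fixes x u :: "('f::field, 'k) orbit_klr_elem"
  assumes "x \<in> carrier R" "u \<in> left_span k"
  shows "x \<otimes>\<^bsub>R\<^esub> u \<in> left_span k"
proof -
  interpret R: unital_algebra "R :: ('f, ('f, 'k) orbit_klr_elem) module" by (rule R_unital)
  show ?thesis
    using assms
  proof (induction x arbitrary: u rule: R_induct)
    case one
    then show ?case by (simp add: left_span_closed)
  next
    case (e l)
    then show ?case by (intro left_span_e)
  next
    case (y a)
    then show ?case by (intro left_span.y)
  next
    case (psi a)
    then show ?case by (intro left_span.psi)
  next
    case (add x z)
    then show ?case by (simp add: R.l_distr left_span_closed left_span.add)
  next
    case (mult x z)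
    then show ?case by (simp add: R.m_assoc left_span_closed)
  next
    case (smult c x)
    then show ?case by (simp add: R.smult_mult_left[symmetric] left_span_closed left_span.smult)
  qed
qed

text \<open>Meant for \<open>S\<close> the image of the presented algebra, which contains all y and
  \<psi>: the factor \<open>eR k\<close> stays at the right end while the rest is collected in
  \<open>S\<close>.\<close>

lemma left_span_subalgebra:
  fixes S :: "('f::field, 'k) orbit_klr_elem set"
  assumes S: "S \<subseteq> carrier R" "\<one>\<^bsub>R\<^esub> \<in> S"
    and add: "\<And>x z. x \<in> S \<Longrightarrow> z \<in> S \<Longrightarrow> x \<oplus>\<^bsub>R\<^esub> z \<in> S"
    and mult: "\<And>x z. x \<in> S \<Longrightarrow> z \<in> S \<Longrightarrow> x \<otimes>\<^bsub>R\<^esub> z \<in> S"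
    and smult: "\<And>c x. x \<in> S \<Longrightarrow> c \<odot>\<^bsub>R\<^esub> x \<in> S"
    and y: "\<And>a. a \<in> {1..n} \<Longrightarrow> yR a \<in> S"
    and psi: "\<And>a. a \<in> {1..<n} \<Longrightarrow> psiR a \<in> S"
    and u: "u \<in> left_span k"
  shows "\<exists>b\<in>S. u = b \<otimes>\<^bsub>R\<^esub> eR k"
proof -
  interpret R: unital_algebra "R :: ('f, ('f, 'k) orbit_klr_elem) module" by (rule R_unital)
  have cl: "b \<in> carrier R" if "b \<in> S" for b
    using S(1) that by blast
  show ?thesis
    using u
  proof induction
    case e
    show ?case
      by (rule bexI[OF _ S(2)]) (simp add: eR_closed)
  next
    case (y a u)
    then obtain b where b: "b \<in> S" "u = b \<otimes>\<^bsub>R\<^esub> eR k" by blast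
    have "yR a \<otimes>\<^bsub>R\<^esub> u = (yR a \<otimes>\<^bsub>R\<^esub> b) \<otimes>\<^bsub>R\<^esub> eR k"
      by (simp add: b(2) R.m_assoc cl[OF b(1)] yR_closed[OF y(1)] eR_closed)
    then show ?case
      using mult[OF assms(6)[OF y(1)] b(1)] by blast
  next
    case (psi a u)
    then obtain b where b: "b \<in> S" "u = b \<otimes>\<^bsub>R\<^esub> eR k" by blast
    have "psiR a \<otimes>\<^bsub>R\<^esub> u = (psiR a \<otimes>\<^bsub>R\<^esub> b) \<otimes>\<^bsub>R\<^esub> eR k"
      by (simp add: b(2) R.m_assoc cl[OF b(1)] psiR_closed[OF psi(1)] eR_closed)
    then show ?case
      using mult[OF assms(7)[OF psi(1)] b(1)] by blast
  next
    case (add u v)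
    then obtain b c where b: "b \<in> S" "u = b \<otimes>\<^bsub>R\<^esub> eR k" and c: "c \<in> S" "v = c \<otimes>\<^bsub>R\<^esub> eR k" by blast
    have "u \<oplus>\<^bsub>R\<^esub> v = (b \<oplus>\<^bsub>R\<^esub> c) \<otimes>\<^bsub>R\<^esub> eR k"
      by (simp add: b(2) c(2) R.l_distr cl[OF b(1)] cl[OF c(1)] eR_closed)
    then show ?case
      using assms(3)[OF b(1) c(1)] by blast
  next
    case (smult u c)
    then obtain b where b: "b \<in> S" "u = b \<otimes>\<^bsub>R\<^esub> eR k" by blast
    have "c \<odot>\<^bsub>R\<^esub> u = (c \<odot>\<^bsub>R\<^esub> b) \<otimes>\<^bsub>R\<^esub> eR k"
      by (simp add: b(2) R.smult_mult_left cl[OF b(1)] eR_closed)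
    then show ?case
      using assms(5)[OF b(1)] by blast
  qed
qed

text \<open>The homomorphism is built one summand at a time, each component being a push-forward
  along the orbit map, so that a kernel element can be studied in a single summand.\<close>

lemma fixed_presentation:
  "has_presentation (klr_fixed_alg \<Gamma> n \<sigma> \<alpha> :: ('f::field, ('f, 'k) orbit_klr_elem) module)
    (klr_gens n J) (klr_fixed_gen \<Gamma> n \<sigma> \<alpha>) (klr_free_relations \<Gamma> n J orbit_rep (orbit_swap n \<sigma>))"
proof -
  let ?R = "R :: ('f, ('f, 'k) orbit_klr_elem) module"
  let ?D = "\<lambda>\<beta>. klr_alg \<Gamma> n \<beta> :: ('f, ('f, 'k) klr_elem) module"
  let ?g = "\<lambda>\<beta>. klr_alg_gen \<Gamma> n \<beta> :: _ \<Rightarrow> ('f, 'k) klr_elem"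
  define \<tau> where "\<tau> = (klr_sigma \<Gamma> n \<sigma> \<alpha> :: ('f, 'k) orbit_klr_elem \<Rightarrow> _)"
  define S where "S = (klr_free_relations \<Gamma> n J orbit_rep (orbit_swap n \<sigma>)
    :: (((nat \<Rightarrow> 'k) set klr_gen list \<Rightarrow> 'f) \<times> _) set)"
  define A where "A = presented_alg (klr_gens n J) S"
  define gA where "gA = presented_gen (klr_gens n J) S"
  let ?f = "klr_fixed_gen \<Gamma> n \<sigma> \<alpha> :: _ \<Rightarrow> ('f, 'k) orbit_klr_elem"
  interpret R: unital_algebra ?R by (rule R_unital)
  have \<tau>: "\<tau> \<in> alg_hom ?R ?R" and \<tau>_e: "\<And>k. k \<in> I \<Longrightarrow> \<tau> (eR k) = eR (mp k)"
    and \<tau>_y: "\<And>a. a \<in> {1..n} \<Longrightarrow> \<tau> (yR a) = yR a"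
    and \<tau>_psi: "\<And>a. a \<in> {1..<n} \<Longrightarrow> \<tau> (psiR a) = psiR a"
    using klr_sigma unfolding \<tau>_def is_klr_sigma_def alg_iso_def by blast+
  have J_I: "\<gamma> \<subseteq> I" if "\<gamma> \<in> J" for \<gamma>
    using J_eq(1)[OF that] by blast
  have J_fin: "finite \<gamma>" if "\<gamma> \<in> J" for \<gamma>
    using finite_subset[OF J_I[OF that] orbit_tuples_finite] .
  have e_cl: "eR k \<in> carrier ?R" for k
    by (rule eR_closed)
  have y_cl: "yR a \<in> carrier ?R" if "a \<in> {1..n}" for a
    using that by (rule yR_closed)
  have psi_cl: "psiR a \<in> carrier ?R" if "a \<in> {1..<n}" for a
    using that by (rule psiR_closed)
  have g_cl: "?g \<beta> (E_gen k) \<in> carrier (?D \<beta>)" if "\<beta> \<in> orb" "k \<in> tuples n \<beta>" for \<beta> k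
    using that by (rule klr_alg_elems(2))
  have f_closed: "?f x \<in> carrier ?R" if "x \<in> klr_gens n J" for x
    using that e_cl y_cl psi_cl
    by (auto simp: klr_gens_def intro!: R.finsum_closed)
  have index: "klr_index n J (orbit_swap n \<sigma>)"
  proof
    show "finite J" by (rule J_finite)
    fix a \<gamma> assume a: "a \<in> {1..<n}" and \<gamma>: "\<gamma> \<in> J"
    obtain k where "k \<in> I" "\<gamma> = cyc_orbit mp k"
      using \<gamma> by (auto simp: tuple_orbits_def)
    then show "orbit_swap n \<sigma> a \<gamma> \<in> J"
      using orbit_swap_eq[OF a] swap_at_orbit_tuples[OF a] by (simp add: tuple_orbits_def)
  qed
  interpret A: klr_family A \<Gamma> n J orbit_rep "orbit_swap n \<sigma>" "\<lambda>\<gamma>. gA (E_gen \<gamma>)"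
    "\<lambda>a. gA (Y_gen a)" "\<lambda>a. gA (Psi_gen a)"
    unfolding A_def gA_def S_def by (rule klr_index.klr_presented_family[OF index])
  interpret P: presentation "klr_gens n J" S
    unfolding S_def by (rule klr_index.klr_presentation[OF index])
  have gA_closed: "gA x \<in> carrier A" if "x \<in> klr_gens n J" for x
    unfolding A_def gA_def using that by (rule P.presented_gen_closed)
  \<comment> \<open>An orbit of tuples meets several compositions; the fibre over it, for one of
    them, is the part of the orbit with that content.\<close>
  have fibre: "klr_cover.fibre (tuples n \<beta>) (cyc_orbit mp) \<gamma> = \<gamma> \<inter> tuples n \<beta>"
    if \<beta>: "\<beta> \<in> orb" and \<gamma>: "\<gamma> \<in> J" for \<beta> \<gamma>
    unfolding klr_cover.fibre_def[OF cover_orbits[OF \<beta>]]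
    using J_eq(2)[OF \<gamma>] cyc_orbit_self[of _ mp] by blast
  have f_E: "?f (E_gen \<gamma>) \<beta> =
      finsum (?D \<beta>) (\<lambda>k. ?g \<beta> (E_gen k)) (klr_cover.fibre (tuples n \<beta>) (cyc_orbit mp) \<gamma>)"
    if \<beta>: "\<beta> \<in> orb" and \<gamma>: "\<gamma> \<in> J" for \<beta> \<gamma>
  proof -
    interpret D: unital_algebra "?D \<beta>"
      using \<beta> by (rule klr_alg_elems)
    have "?f (E_gen \<gamma>) \<beta> = finsum (?D \<beta>) (\<lambda>k. eR k \<beta>) \<gamma>"
      unfolding klr_fixed_gen.simps using \<beta> J_fin[OF \<gamma>] e_cl by (intro R_finsum) auto
    also have "\<dots> = finsum (?D \<beta>) (\<lambda>k. ?g \<beta> (E_gen k)) (\<gamma> \<inter> tuples n \<beta>)"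
      using \<beta> J_fin[OF \<gamma>] g_cl[OF \<beta>]
      by (intro D.add.finprod_mono_neutral_cong_right) (auto simp: klr_e_def)
    finally show ?thesis
      by (simp add: fibre[OF \<beta> \<gamma>])
  qed
  have "\<forall>\<beta>\<in>orb. \<exists>h. h \<in> alg_hom A (?D \<beta>) \<and> (\<forall>x\<in>klr_gens n J. h (gA x) = ?f x \<beta>)"
  proof
    fix \<beta> assume \<beta>: "\<beta> \<in> orb"
    interpret C: klr_cover \<Gamma> n "tuples n \<beta>" J orbit_rep "orbit_swap n \<sigma>" "cyc_orbit mp"
      using \<beta> by (rule cover_orbits)
    interpret D: klr_family "?D \<beta>" \<Gamma> n "tuples n \<beta>" "\<lambda>k. k" swap_at
      "\<lambda>k. ?g \<beta> (E_gen k)" "\<lambda>a. ?g \<beta> (Y_gen a)" "\<lambda>a. ?g \<beta> (Psi_gen a)"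
      using \<beta> by (rule klr_alg_family)
    obtain h where "h \<in> alg_hom A (?D \<beta>)"
      and "\<And>j. j \<in> J \<Longrightarrow> h (gA (E_gen j)) = finsum (?D \<beta>) (\<lambda>k. ?g \<beta> (E_gen k)) (C.fibre j)"
      and "\<And>a. a \<in> {1..n} \<Longrightarrow> h (gA (Y_gen a)) = ?g \<beta> (Y_gen a)"
      and "\<And>a. a \<in> {1..<n} \<Longrightarrow> h (gA (Psi_gen a)) = ?g \<beta> (Psi_gen a)"
      using C.J.klr_universal[OF C.klr_family_push[OF D.klr_family_axioms], folded S_def,
          folded A_def gA_def] by blast
    moreover from this have "h (gA x) = ?f x \<beta>" if "x \<in> klr_gens n J" for x
      using that \<beta> f_E by (auto simp: klr_gens_def klr_y_def klr_psi_def simp del: klr_fixed_gen.simps(1))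
    ultimately show "\<exists>h. h \<in> alg_hom A (?D \<beta>) \<and> (\<forall>x\<in>klr_gens n J. h (gA x) = ?f x \<beta>)"
      by blast
  qed
  from bchoice[OF this] obtain h where
      h: "\<And>\<beta>. \<beta> \<in> orb \<Longrightarrow> h \<beta> \<in> alg_hom A (?D \<beta>)"
    and h_gen: "\<And>\<beta> x. \<beta> \<in> orb \<Longrightarrow> x \<in> klr_gens n J \<Longrightarrow> h \<beta> (gA x) = ?f x \<beta>"
    by blast
  define \<phi> where "\<phi> x = (\<lambda>\<beta>\<in>orb. h \<beta> x)" for x
  have \<phi>: "\<phi> \<in> alg_hom A ?R"
    by (rule alg_homI) (auto simp: \<phi>_def R_simps alg_hom_closed[OF h] alg_hom_add[OF h]
        alg_hom_mult[OF h] alg_hom_one[OF h] alg_hom_smult[OF h] intro!: restrict_ext)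
  have \<phi>_gen: "\<phi> (gA x) = ?f x" if x: "x \<in> klr_gens n J" for x
  proof (rule R_ext[OF alg_hom_closed[OF \<phi> gA_closed[OF x]] f_closed[OF x]])
    show "\<phi> (gA x) \<beta> = ?f x \<beta>" if "\<beta> \<in> orb" for \<beta>
      using that h_gen[OF that x] by (simp add: \<phi>_def)
  qed
  have \<tau>_E: "\<tau> (?f (E_gen \<gamma>)) = ?f (E_gen \<gamma>)" if \<gamma>: "\<gamma> \<in> J" for \<gamma>
  proof -
    have e: "eR \<in> \<gamma> \<rightarrow> carrier ?R"
      using e_cl by blast
    have per: "(mp ^^ p) k = k" if "k \<in> \<gamma>" for k
      using tuple_period orbit_tuples_extensional J_I[OF \<gamma>] that by blast
    \<comment> \<open>\<sigma> permutes the finite orbit: it is injective there because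
      \<open>mp ^^ (p - 1)\<close> inverts it, hence also onto. The sum over the orbit is therefore
      unchanged.\<close>
    have inj: "inj_on mp \<gamma>"
    proof (rule inj_onI)
      fix k l assume kl: "k \<in> \<gamma>" "l \<in> \<gamma>" "mp k = mp l"
      have "(mp ^^ p) k = (mp ^^ (p - 1)) (mp k)" for k
        using p funpow_Suc_right[of "p - 1" mp] by simp
      then show "k = l"
        using per kl by metis
    qed
    have step: "mp k \<in> \<gamma>" if "k \<in> \<gamma>" for k
      using J_eq(2)[OF \<gamma> that] cyc_orbit_step[OF cyc_orbit_self, of mp k] by simp
    have img: "mp ` \<gamma> = \<gamma>"
      using step by (intro endo_inj_surj J_fin[OF \<gamma>] inj) blast
    have "\<tau> (?f (E_gen \<gamma>)) = (\<Oplus>\<^bsub>?R\<^esub>k\<in>\<gamma>. \<tau> (eR k))"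
      unfolding klr_fixed_gen.simps
      by (rule alg_hom_finsum[OF \<tau> R.unital_algebra_axioms R.unital_algebra_axioms J_fin[OF \<gamma>] e])
    also have "\<dots> = (\<Oplus>\<^bsub>?R\<^esub>k\<in>\<gamma>. eR (mp k))"
      using \<tau>_e J_I[OF \<gamma>] e_cl by (intro R.finsum_cong') auto
    also have "\<dots> = (\<Oplus>\<^bsub>?R\<^esub>k\<in>mp ` \<gamma>. eR k)"
      using e_cl by (intro R.finsum_reindex[symmetric] inj) auto
    finally show ?thesis
      by (simp add: img)
  qed
  have \<tau>_f: "\<tau> (?f x) = ?f x" if "x \<in> klr_gens n J" for x
    using that \<tau>_E \<tau>_y \<tau>_psi by (auto simp: klr_gens_def simp del: klr_fixed_gen.simps(1))
  have \<phi>_fixed: "\<tau> (\<phi> x) = \<phi> x" if "x \<in> carrier A" for x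
    using that
  proof (induction x rule: P.presented_induct[folded A_def gA_def, consumes 1,
        case_names one add smult gen])
    case one
    then show ?case by (simp add: alg_hom_one[OF \<phi>] alg_hom_one[OF \<tau>])
  next
    case (add f g)
    then show ?case
      by (simp add: alg_hom_add[OF \<phi>] alg_hom_add[OF \<tau>] alg_hom_closed[OF \<phi>])
  next
    case (smult c f)
    then show ?case
      by (simp add: alg_hom_smult[OF \<phi>] alg_hom_smult[OF \<tau>] alg_hom_closed[OF \<phi>])
  next
    case (gen x f)
    then show ?case
      by (simp add: alg_hom_mult[OF \<phi>] alg_hom_mult[OF \<tau>] alg_hom_closed[OF \<phi>] gA_closed
          \<phi>_gen \<tau>_f f_closed del: klr_fixed_gen.simps)
  qed
  have sum_E: "x = (\<Oplus>\<^bsub>A\<^esub>\<gamma>\<in>J. x \<otimes>\<^bsub>A\<^esub> gA (E_gen \<gamma>))" if x: "x \<in> carrier A" for x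
    using A.finsum_rdistr[OF J_finite x, of "\<lambda>\<gamma>. gA (E_gen \<gamma>)"] A.e_closed A.sum_e x by auto
  have inj: "inj_on \<phi> (carrier A)"
  proof (rule alg_hom_inj_on[OF \<phi> A.unital_algebra_axioms R.unital_algebra_axioms])
    fix x assume x: "x \<in> carrier A" and zero: "\<phi> x = \<zero>\<^bsub>?R\<^esub>"
    \<comment> \<open>One tuple of the orbit and the one summand containing it are enough: the
      vanishing of that component of the image already kills \<open>x\<close> times the idempotent
      of the orbit.\<close>
    have "x \<otimes>\<^bsub>A\<^esub> gA (E_gen \<gamma>) = \<zero>\<^bsub>A\<^esub>" if \<gamma>: "\<gamma> \<in> J" for \<gamma>
    proof -
      obtain k where k: "k \<in> \<gamma>"
        using J_nonempty[OF \<gamma>] by blast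
      obtain \<beta> where \<beta>: "\<beta> \<in> orb" "k \<in> tuples n \<beta>"
        using J_eq(1)[OF \<gamma> k] by (auto simp: orbit_tuples_def)
      interpret C: klr_cover \<Gamma> n "tuples n \<beta>" J orbit_rep "orbit_swap n \<sigma>" "cyc_orbit mp"
        using \<beta>(1) by (rule cover_orbits)
      have "h \<beta> x = \<zero>\<^bsub>?D \<beta>\<^esub>"
        using zero \<beta>(1) by (simp add: \<phi>_def R_simps fun_eq_iff split: if_splits)
      moreover have "h \<beta> (gA (E_gen j)) = finsum (?D \<beta>) (\<lambda>k. ?g \<beta> (E_gen k)) (C.fibre j)"
        if "j \<in> J" for j
        using h_gen[OF \<beta>(1), of "E_gen j"] f_E[OF \<beta>(1) that] that by (simp add: klr_gens_def del: klr_fixed_gen.simps)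
      moreover have "h \<beta> (gA (Y_gen a)) = ?g \<beta> (Y_gen a)" if "a \<in> {1..n}" for a
        using h_gen[OF \<beta>(1), of "Y_gen a"] that \<beta>(1) by (simp add: klr_gens_def klr_y_def)
      moreover have "h \<beta> (gA (Psi_gen a)) = ?g \<beta> (Psi_gen a)" if "a \<in> {1..<n}" for a
        using h_gen[OF \<beta>(1), of "Psi_gen a"] that \<beta>(1) by (simp add: klr_gens_def klr_psi_def)
      ultimately have "x \<otimes>\<^bsub>A\<^esub> gA (E_gen (cyc_orbit mp k)) = \<zero>\<^bsub>A\<^esub>"
        using C.push_kernel[where ?'f = 'f, folded S_def klr_alg_def klr_alg_gen_def,
            folded A_def gA_def, OF h[OF \<beta>(1)] _ _ _ x _ \<beta>(2)] by blast
      then show ?thesis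
        using J_eq(2)[OF \<gamma> k] by simp
    qed
    then have "(\<Oplus>\<^bsub>A\<^esub>\<gamma>\<in>J. x \<otimes>\<^bsub>A\<^esub> gA (E_gen \<gamma>)) = \<zero>\<^bsub>A\<^esub>"
      by (intro A.add.finprod_one_eqI)
    then show "x = \<zero>\<^bsub>A\<^esub>"
      using sum_E[OF x] by simp
  qed
  have E_mult: "x \<otimes>\<^bsub>?R\<^esub> ?f (E_gen \<gamma>) \<in> \<phi> ` carrier A"
    if x: "x \<in> carrier ?R" "\<tau> x = x" and \<gamma>: "\<gamma> \<in> J" for x \<gamma>
  proof -
    obtain k where k: "k \<in> \<gamma>"
      using J_nonempty[OF \<gamma>] by blast
    \<comment> \<open>The product \<open>x\<close> times e(k) lies in the left ideal of e(k), and
      there \<open>x\<close> can be traded for an element of the image.\<close>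
    have "\<exists>b\<in>\<phi> ` carrier A. x \<otimes>\<^bsub>?R\<^esub> eR k = b \<otimes>\<^bsub>?R\<^esub> eR k"
    proof (rule left_span_subalgebra)
      show "x \<otimes>\<^bsub>?R\<^esub> eR k \<in> left_span k"
        by (rule left_span_left_ideal[OF x(1) left_span.e])
      show "\<phi> ` carrier A \<subseteq> carrier ?R"
        using alg_hom_closed[OF \<phi>] by blast
      show "\<one>\<^bsub>?R\<^esub> \<in> \<phi> ` carrier A"
        using alg_hom_one[OF \<phi>] A.one_closed by (metis imageI)
      show "u \<oplus>\<^bsub>?R\<^esub> v \<in> \<phi> ` carrier A" if "u \<in> \<phi> ` carrier A" "v \<in> \<phi> ` carrier A" for u v
        using that by (auto simp: alg_hom_add[OF \<phi>, symmetric])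
      show "u \<otimes>\<^bsub>?R\<^esub> v \<in> \<phi> ` carrier A" if "u \<in> \<phi> ` carrier A" "v \<in> \<phi> ` carrier A" for u v
        using that by (auto simp: alg_hom_mult[OF \<phi>, symmetric])
      show "c \<odot>\<^bsub>?R\<^esub> u \<in> \<phi> ` carrier A" if "u \<in> \<phi> ` carrier A" for c u
        using that by (auto simp: alg_hom_smult[OF \<phi>, symmetric])
      show "yR a \<in> \<phi> ` carrier A" if "a \<in> {1..n}" for a
      proof -
        have g: "Y_gen a \<in> klr_gens n J"
          using that by (simp add: klr_gens_def)
        then have "\<phi> (gA (Y_gen a)) \<in> \<phi> ` carrier A"
          by (intro imageI gA_closed)
        then show ?thesis
          by (simp add: \<phi>_gen[OF g])
      qed
      show "psiR a \<in> \<phi> ` carrier A" if "a \<in> {1..<n}" for a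
      proof -
        have g: "Psi_gen a \<in> klr_gens n J"
          using that by (simp add: klr_gens_def)
        then have "\<phi> (gA (Psi_gen a)) \<in> \<phi> ` carrier A"
          by (intro imageI gA_closed)
        then show ?thesis
          by (simp add: \<phi>_gen[OF g])
      qed
    qed
    then obtain z where z: "z \<in> carrier A" and xz: "x \<otimes>\<^bsub>?R\<^esub> eR k = \<phi> z \<otimes>\<^bsub>?R\<^esub> eR k"
      by blast
    have \<phi>z: "\<phi> z \<in> carrier ?R" "\<tau> (\<phi> z) = \<phi> z"
      using alg_hom_closed[OF \<phi> z] \<phi>_fixed[OF z] by simp_all
    \<comment> \<open>The automorphism fixes \<open>x\<close> and \<open>\<phi> z\<close> and moves
      e(k) along its orbit, so one equation at \<open>k\<close> gives the same equation, with the
      same \<open>z\<close>, at every tuple of the orbit.\<close>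
    have pow: "x \<otimes>\<^bsub>?R\<^esub> eR ((mp ^^ j) k) = \<phi> z \<otimes>\<^bsub>?R\<^esub> eR ((mp ^^ j) k) \<and> (mp ^^ j) k \<in> I" for j
    proof (induction j)
      case 0
      then show ?case using xz J_I[OF \<gamma>] k by auto
    next
      case (Suc j)
      have move: "w \<otimes>\<^bsub>?R\<^esub> eR (mp ((mp ^^ j) k)) = \<tau> (w \<otimes>\<^bsub>?R\<^esub> eR ((mp ^^ j) k))"
        if "w \<in> carrier ?R" "\<tau> w = w" for w
        using Suc that by (simp add: alg_hom_mult[OF \<tau>] e_cl \<tau>_e)
      have "x \<otimes>\<^bsub>?R\<^esub> eR (mp ((mp ^^ j) k)) = \<phi> z \<otimes>\<^bsub>?R\<^esub> eR (mp ((mp ^^ j) k))"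
        using Suc unfolding move[OF x] move[OF \<phi>z] by simp
      then show ?case
        using Suc mp_orbit_tuples by simp
    qed
    have e: "eR \<in> \<gamma> \<rightarrow> carrier ?R"
      using e_cl by blast
    have "x \<otimes>\<^bsub>?R\<^esub> ?f (E_gen \<gamma>) = (\<Oplus>\<^bsub>?R\<^esub>l\<in>\<gamma>. x \<otimes>\<^bsub>?R\<^esub> eR l)"
      unfolding klr_fixed_gen.simps by (rule R.finsum_rdistr[OF J_fin[OF \<gamma>] x(1) e])
    also have "\<dots> = (\<Oplus>\<^bsub>?R\<^esub>l\<in>\<gamma>. \<phi> z \<otimes>\<^bsub>?R\<^esub> eR l)"
    proof (rule R.finsum_cong')
      fix l assume "l \<in> \<gamma>"
      then obtain j where "l = (mp ^^ j) k"
        using J_eq(2)[OF \<gamma> k] by (auto simp: cyc_orbit_def)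
      then show "x \<otimes>\<^bsub>?R\<^esub> eR l = \<phi> z \<otimes>\<^bsub>?R\<^esub> eR l"
        using pow by simp
    qed (use \<phi>z e_cl in auto)
    also have "\<dots> = \<phi> z \<otimes>\<^bsub>?R\<^esub> ?f (E_gen \<gamma>)"
      unfolding klr_fixed_gen.simps by (rule R.finsum_rdistr[OF J_fin[OF \<gamma>] \<phi>z(1) e, symmetric])
    also have "\<dots> = \<phi> (z \<otimes>\<^bsub>A\<^esub> gA (E_gen \<gamma>))"
      using \<gamma> z A.e_closed[OF \<gamma>] \<phi>_gen[of "E_gen \<gamma>"]
      by (simp add: alg_hom_mult[OF \<phi>] klr_gens_def del: klr_fixed_gen.simps)
    finally show ?thesis
      using z A.e_closed[OF \<gamma>] by blast
  qed
  have surj: "x \<in> \<phi> ` carrier A" if x: "x \<in> carrier ?R" "\<tau> x = x" for x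
  proof -
    have fE: "(\<lambda>\<gamma>. ?f (E_gen \<gamma>)) \<in> J \<rightarrow> carrier ?R"
      using f_closed by (auto simp: klr_gens_def simp del: klr_fixed_gen.simps)
    have "\<one>\<^bsub>?R\<^esub> = \<phi> (\<Oplus>\<^bsub>A\<^esub>\<gamma>\<in>J. gA (E_gen \<gamma>))"
      by (simp add: A.sum_e alg_hom_one[OF \<phi>])
    also have "\<dots> = (\<Oplus>\<^bsub>?R\<^esub>\<gamma>\<in>J. \<phi> (gA (E_gen \<gamma>)))"
      using A.e_closed by (intro alg_hom_finsum[OF \<phi> A.unital_algebra_axioms R.unital_algebra_axioms J_finite]) auto
    also have "\<dots> = (\<Oplus>\<^bsub>?R\<^esub>\<gamma>\<in>J. ?f (E_gen \<gamma>))"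
      using \<phi>_gen fE by (intro R.finsum_cong') (auto simp: klr_gens_def simp del: klr_fixed_gen.simps)
    finally have "x \<otimes>\<^bsub>?R\<^esub> \<one>\<^bsub>?R\<^esub> = x \<otimes>\<^bsub>?R\<^esub> (\<Oplus>\<^bsub>?R\<^esub>\<gamma>\<in>J. ?f (E_gen \<gamma>))"
      by simp
    then have "x = (\<Oplus>\<^bsub>?R\<^esub>\<gamma>\<in>J. x \<otimes>\<^bsub>?R\<^esub> ?f (E_gen \<gamma>))"
      using R.finsum_rdistr[OF J_finite x(1) fE] x(1) by (simp del: klr_fixed_gen.simps)
    moreover have "(\<Oplus>\<^bsub>?R\<^esub>\<gamma>\<in>J. x \<otimes>\<^bsub>?R\<^esub> ?f (E_gen \<gamma>)) \<in> \<phi> ` carrier A"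
    proof (rule R.finsum_in[OF J_finite])
      show "(\<lambda>\<gamma>. x \<otimes>\<^bsub>?R\<^esub> ?f (E_gen \<gamma>)) \<in> J \<rightarrow> carrier ?R"
        using fE x(1) by (auto simp: Pi_iff simp del: klr_fixed_gen.simps)
      show "\<zero>\<^bsub>?R\<^esub> \<in> \<phi> ` carrier A"
        using alg_hom_zero[OF \<phi> A.unital_algebra_axioms R.unital_algebra_axioms] A.zero_closed
        by (metis imageI)
      show "u \<oplus>\<^bsub>?R\<^esub> v \<in> \<phi> ` carrier A" if "u \<in> \<phi> ` carrier A" "v \<in> \<phi> ` carrier A" for u v
        using that by (auto simp: alg_hom_add[OF \<phi>, symmetric])
    qed (rule E_mult[OF x])
    ultimately show ?thesis
      by simp
  qed
  let ?F = "klr_fixed_alg \<Gamma> n \<sigma> \<alpha> :: ('f, ('f, 'k) orbit_klr_elem) module"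
  \<comment> \<open>The fixed point algebra shares all operations with the direct sum, so only the
    image of the homomorphism remains to be identified with the smaller carrier.\<close>
  have F: "carrier ?F = {x \<in> carrier ?R. \<tau> x = x}" "mult ?F = mult ?R" "one ?F = one ?R"
      "add ?F = add ?R" "smult ?F = smult ?R"
    by (simp_all add: klr_fixed_alg_def fixed_alg_def \<tau>_def)
  have "\<phi> \<in> alg_hom A ?F"
    using \<phi> \<phi>_fixed alg_hom_closed[OF \<phi>] by (auto simp: alg_hom_def ring_hom_def F)
  moreover have "\<phi> ` carrier A = carrier ?F"
    using surj \<phi>_fixed alg_hom_closed[OF \<phi>] by (auto simp: F)
  ultimately have "\<phi> \<in> alg_iso A ?F"
    using inj by (simp add: alg_iso_def bij_betw_def)
  then show ?thesis
    unfolding has_presentation_def S_def[symmetric] A_def[symmetric] gA_def[symmetric]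
    using \<phi>_gen by blast
qed

end

theorem corollary2p27:
  fixes n p :: nat
    and \<zeta> :: "'f::field"
    and \<Gamma> :: "'k rel"
    and \<sigma> :: "'k \<Rightarrow> 'k"
    and \<alpha> :: "'k \<Rightarrow> nat"
  assumes "n \<ge> 1" and "p \<ge> 1"
    and "primitive_root_of_unity p \<zeta>"
    and "irrefl \<Gamma>"
    and "bij \<sigma>"
    and "\<And>k k'. (k, k') \<in> \<Gamma> \<Longrightarrow> (\<sigma> k, \<sigma> k') \<in> \<Gamma>"
    and "\<And>k. (\<sigma> ^^ p) k = k"
    and "\<And>k q. 1 \<le> q \<Longrightarrow> q \<le> p - 1 \<Longrightarrow> (\<sigma> ^^ q) k \<noteq> k"
    and "composition n \<alpha>"
  shows "has_presentation
    (klr_fixed_alg \<Gamma> n \<sigma> \<alpha> :: ('f, ('f, 'k) orbit_klr_elem) module)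
    (klr_gens n (tuple_orbits n \<sigma> \<alpha>))
    (klr_fixed_gen \<Gamma> n \<sigma> \<alpha>)
    (klr_free_relations \<Gamma> n (tuple_orbits n \<sigma> \<alpha>) orbit_rep (orbit_swap n \<sigma>))"
proof -
  interpret klr_orbit n p \<Gamma> \<sigma> \<alpha>
    using assms by unfold_locales (auto simp: composition_def)
  show ?thesis
    by (rule fixed_presentation)
qed

end
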